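(* Let $\mathcal{H}$ be a Hilbert space and let $F:\mathcal{B}(\mathbb{R})\to\mathcal{L}_s^+(\mathcal{H})$ be a commutative normalized POVM. Then $F$ admits a strong Feller Markov kernel if and only if $F$ is uniformly continuous.
   Context: $\mathcal{B}(\mathbb{R})$ is the Borel $\sigma$-algebra of $\mathbb{R}$; $\mathcal{L}_s^+(\mathcal{H})$ is the set of positive bounded self-adjoint operators on $\mathcal{H}$. A POVM (semispectral measure) is a map $F:\mathcal{B}(\mathbb{R})\to\mathcal{L}_s^+(\mathcal{H})$ with $F(\bigcup_n\Delta_n)=\sum_nF(\Delta_n)$ for every countable family of pairwise disjoint Borel sets, the series converging in the weak operator topology. It is normalized if $F(\mathbb{R})=\mathbf{1}$ (the identity), and commutative if all the operators $F(\Delta)$ commute with each other. $F$ is uniformly continuous if for every sequence of pairwise disjoint Borel sets $\Delta_i$ with union $\Delta$ one has $\lim_{n\to\infty}\sum_{i=1}^nF(\Delta_i)=F(\Delta)$ in the operator norm topology. A Markov kernel on $[0,1]$ is a map $\mu:[0,1]\times\mathcal{B}(\mathbb{R})\to[0,1]$, $(\lambda,\Delta)\mapsto\mu_\Delta(\lambda)$, such that $\mu_\Delta(\cdot)$ is Borel measurable for each $\Delta$ and $\mu_{(\cdot)}(\lambda)$ is a probability measure for each $\lambda$. It is strong Feller if $\mu_\Delta(\cdot)$ is a continuous function for each $\Delta\in\mathcal{B}(\mathbb{R})$. A sharp version (sharp reconstruction) of a commutative POVM $F$ is a bounded self-adjoint operator $A$ (identified with its spectral measure $E$) such that there is a Markov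 kernel $\mu$ on $\sigma(A)$ with $F(\Delta)=\mu_\Delta(A)$ for all $\Delta\in\mathcal{B}(\mathbb{R})$, and such that the von Neumann algebra generated by $A$ equals the von Neumann algebra generated by $\{F(\Delta):\Delta\in\mathcal{B}(\mathbb{R})\}$. (Sharp versions are unique up to almost everywhere bijections.) $F$ admits a strong Feller Markov kernel if there exist a sharp version $A$ of $F$ with $\sigma(A)\subset[0,1]$ and spectral measure $E$, and a strong Feller Markov kernel $\mu$ on $[0,1]$, such that $F(\Delta)=\int\mu_\Delta(\lambda)\,dE_\lambda$ for all $\Delta\in\mathcal{B}(\mathbb{R})$. *)

theory Defs
  imports "HOL-Probability.Probability"
begin

text \<open>Complex Hilbert spaces, separable or not, possibly zero.  The inner product is conjugate
  linear in its first argument.  Building on \<^class>\<open>real_inner\<close> (the underlying real Hilbert space,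
  whose inner product is the real part of the complex one) makes the library's norm, bounded
  operators and operator norm available: a bounded complex-linear operator has the same norm as
  its underlying real-linear one.\<close>

class complex_hilbert_space = real_inner + complete_space +
  fixes scaleC :: "complex \<Rightarrow> 'a \<Rightarrow> 'a"  (infixr \<open>*\<^sub>C\<close> 75)
    and cinner :: "'a \<Rightarrow> 'a \<Rightarrow> complex"
  assumes scaleC_add_right: "c *\<^sub>C (x + y) = c *\<^sub>C x + c *\<^sub>C y"
    and scaleC_add_left: "(c + d) *\<^sub>C x = c *\<^sub>C x + d *\<^sub>C x"
    and scaleC_scaleC: "c *\<^sub>C (d *\<^sub>C x) = (c * d) *\<^sub>C x"
    and scaleR_scaleC: "r *\<^sub>R x = complex_of_real r *\<^sub>C x"
    and cinner_commute: "cinner x y = cnj (cinner y x)"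
    and cinner_add_right: "cinner x (y + z) = cinner x y + cinner x z"
    and cinner_scaleC_right: "cinner x (c *\<^sub>C y) = c * cinner x y"
    and inner_eq_Re_cinner: "inner x y = Re (cinner x y)"

instantiation complex :: complex_hilbert_space
begin

definition "scaleC_complex = ((*) :: complex \<Rightarrow> complex \<Rightarrow> complex)"
definition "cinner_complex = (\<lambda>x y :: complex. cnj x * y)"

instance
  by standard
    (auto simp: scaleC_complex_def cinner_complex_def inner_complex_def algebra_simps
      scaleR_conv_of_real)

end

lemma cinner_zero_right [simp]: "cinner x 0 = 0"
  using cinner_add_right[of x 0 0] by simp

lemma cinner_sum_right: "cinner x (\<Sum>i\<in>I. f i) = (\<Sum>i\<in>I. cinner x (f i))"
  by (induction I rule: infinite_finite_induct) (auto simp: cinner_add_right)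

lemma norm_scaleC: "norm (c *\<^sub>C x) = cmod c * norm x"
proof -
  have im: "Im (cinner x x) = 0"
    using arg_cong[OF cinner_commute[of x x], of Im] by simp
  have "cinner (c *\<^sub>C x) (c *\<^sub>C x) = c * cnj (c * cnj (cinner x x))"
    by (metis cinner_commute cinner_scaleC_right)
  also have "\<dots> = (c * cnj c) * cinner x x"
    by simp
  also have "\<dots> = of_real ((cmod c)\<^sup>2) * cinner x x"
    using complex_norm_square[of c] by simp
  finally have "inner (c *\<^sub>C x) (c *\<^sub>C x) = (cmod c)\<^sup>2 * inner x x"
    by (simp add: inner_eq_Re_cinner)
  then show ?thesis
    by (simp add: norm_eq_sqrt_inner real_sqrt_mult)
qed

lemma bounded_linear_scaleC: "bounded_linear (\<lambda>x. c *\<^sub>C x)"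
proof (rule bounded_linear_intro)
  show "c *\<^sub>C (r *\<^sub>R x) = r *\<^sub>R (c *\<^sub>C x)" for r and x :: 'a
    by (simp add: scaleR_scaleC scaleC_scaleC mult.commute)
qed (auto simp: scaleC_add_right norm_scaleC intro: eq_refl)

text \<open>Elements of \<^typ>\<open>'h \<Rightarrow>\<^sub>L 'h\<close> are only real linear, so complex linearity is
  imposed by membership in the following set.\<close>

definition complex_operators :: "('h::complex_hilbert_space \<Rightarrow>\<^sub>L 'h) set" where
  "complex_operators = {T :: 'h \<Rightarrow>\<^sub>L 'h. \<forall>c x. T (c *\<^sub>C x) = c *\<^sub>C T x}"

definition scaleC_blinfun ::
    "complex \<Rightarrow> ('h::complex_hilbert_space \<Rightarrow>\<^sub>L 'h) \<Rightarrow> ('h \<Rightarrow>\<^sub>L 'h)" where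
  "scaleC_blinfun c T = Blinfun (\<lambda>x. c *\<^sub>C T x)"

lemma scaleC_blinfun_apply: "scaleC_blinfun c T x = c *\<^sub>C T x"
  unfolding scaleC_blinfun_def
  by (simp add: bounded_linear_Blinfun_apply
      bounded_linear_compose[OF bounded_linear_scaleC blinfun.bounded_linear_right])

definition is_adjoint ::
    "('h::complex_hilbert_space \<Rightarrow>\<^sub>L 'h) \<Rightarrow> ('h \<Rightarrow>\<^sub>L 'h) \<Rightarrow> bool" where
  "is_adjoint S T \<longleftrightarrow> (\<forall>x y. cinner (S x) y = cinner x (T y))"

definition selfadjoint :: "('h::complex_hilbert_space \<Rightarrow>\<^sub>L 'h) \<Rightarrow> bool" where
  "selfadjoint T \<longleftrightarrow> T \<in> complex_operators \<and> is_adjoint T T"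

definition positive_operator :: "('h::complex_hilbert_space \<Rightarrow>\<^sub>L 'h) \<Rightarrow> bool" where
  "positive_operator T \<longleftrightarrow> selfadjoint T \<and> (\<forall>x. 0 \<le> Re (cinner x (T x)))"

definition weak_operator_topology :: "('h::complex_hilbert_space \<Rightarrow>\<^sub>L 'h) topology" where
  "weak_operator_topology =
     pullback_topology complex_operators (\<lambda>T (x, y). cinner x (T y)) euclidean"

definition spectrum :: "('h::complex_hilbert_space \<Rightarrow>\<^sub>L 'h) \<Rightarrow> complex set" where
  "spectrum A = {z. \<not> (\<exists>B \<in> complex_operators.
     B o\<^sub>L (A - scaleC_blinfun z id_blinfun) = id_blinfun \<and>
     (A - scaleC_blinfun z id_blinfun) o\<^sub>L B = id_blinfun)}"

text \<open>The spectrum of a self-adjoint operator, as a set of real numbers.\<close>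

definition real_spectrum :: "('h::complex_hilbert_space \<Rightarrow>\<^sub>L 'h) \<Rightarrow> real set" where
  "real_spectrum A = {t. complex_of_real t \<in> spectrum A}"

definition von_neumann_algebra :: "('h::complex_hilbert_space \<Rightarrow>\<^sub>L 'h) set \<Rightarrow> bool" where
  "von_neumann_algebra M \<longleftrightarrow>
     id_blinfun \<in> M \<and>
     (\<forall>S\<in>M. \<forall>T\<in>M. S + T \<in> M \<and> S o\<^sub>L T \<in> M) \<and>
     (\<forall>c. \<forall>T\<in>M. scaleC_blinfun c T \<in> M) \<and>
     (\<forall>T\<in>M. \<exists>S\<in>M. is_adjoint S T) \<and>
     closedin weak_operator_topology M"

definition generated_von_neumann_algebra ::
    "('h::complex_hilbert_space \<Rightarrow>\<^sub>L 'h) set \<Rightarrow> ('h \<Rightarrow>\<^sub>L 'h) set" where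
  "generated_von_neumann_algebra X = von_neumann_algebra hull X"

text \<open>Operator measures are functions on all sets of reals; only their values on Borel sets
  matter.\<close>

definition povm :: "(real set \<Rightarrow> ('h::complex_hilbert_space \<Rightarrow>\<^sub>L 'h)) \<Rightarrow> bool" where
  "povm F \<longleftrightarrow>
     (\<forall>\<Delta>\<in>sets borel. positive_operator (F \<Delta>)) \<and>
     (\<forall>\<Delta> :: nat \<Rightarrow> real set. range \<Delta> \<subseteq> sets borel \<longrightarrow> disjoint_family \<Delta> \<longrightarrow>
        limitin weak_operator_topology (\<lambda>n. \<Sum>i<n. F (\<Delta> i)) (F (\<Union>i. \<Delta> i)) sequentially)"

definition normalized :: "(real set \<Rightarrow> ('h::complex_hilbert_space \<Rightarrow>\<^sub>L 'h)) \<Rightarrow> bool" where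
  "normalized F \<longleftrightarrow> F UNIV = id_blinfun"

definition commutative :: "(real set \<Rightarrow> ('h::complex_hilbert_space \<Rightarrow>\<^sub>L 'h)) \<Rightarrow> bool" where
  "commutative F \<longleftrightarrow>
     (\<forall>\<Delta>\<in>sets borel. \<forall>\<Delta>'\<in>sets borel. F \<Delta> o\<^sub>L F \<Delta>' = F \<Delta>' o\<^sub>L F \<Delta>)"

text \<open>Here the limit is taken in the topology of \<^typ>\<open>'h \<Rightarrow>\<^sub>L 'h\<close>, i.e. in operator
  norm.\<close>

definition uniformly_continuous ::
    "(real set \<Rightarrow> ('h::complex_hilbert_space \<Rightarrow>\<^sub>L 'h)) \<Rightarrow> bool" where
  "uniformly_continuous F \<longleftrightarrow>
     (\<forall>\<Delta> :: nat \<Rightarrow> real set. range \<Delta> \<subseteq> sets borel \<longrightarrow> disjoint_family \<Delta> \<longrightarrow>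
        (\<lambda>n. \<Sum>i<n. F (\<Delta> i)) \<longlonglongrightarrow> F (\<Union>i. \<Delta> i))"

definition diagonal_measure ::
    "(real set \<Rightarrow> ('h::complex_hilbert_space \<Rightarrow>\<^sub>L 'h)) \<Rightarrow> 'h \<Rightarrow> real measure" where
  "diagonal_measure E x =
     measure_of UNIV (sets borel) (\<lambda>\<Delta>. ennreal (Re (cinner x (E \<Delta> x))))"

lemma space_diagonal_measure [simp]: "space (diagonal_measure E x) = UNIV"
  unfolding diagonal_measure_def by (rule space_measure_of) simp

lemma sets_diagonal_measure [simp, measurable_cong]: "sets (diagonal_measure E x) = sets borel"
  unfolding diagonal_measure_def
  using sets.sigma_sets_eq[of "borel :: real measure"] by (simp add: sets_measure_of_conv)

lemma limitin_weak_operator_topologyD: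
  assumes "limitin weak_operator_topology f T G"
  shows "((\<lambda>i. cinner x (f i y)) \<longlongrightarrow> cinner x (T y)) G"
proof (rule topological_tendstoI)
  fix U assume "open U" and T: "cinner x (T y) \<in> U"
  have "open ((\<lambda>g :: 'a \<times> 'a \<Rightarrow> complex. g (x, y)) -` U)"
    using continuous_on_product_coordinates \<open>open U\<close> by (rule open_vimage[rotated])
  then have "openin weak_operator_topology
      ((\<lambda>(T :: 'a \<Rightarrow>\<^sub>L 'a) (x, y). cinner x (T y)) -` ((\<lambda>g. g (x, y)) -` U) \<inter> complex_operators)"
    unfolding weak_operator_topology_def openin_pullback_topology by auto
  then have "\<forall>\<^sub>F i in G. f i \<in>
      ((\<lambda>(T :: 'a \<Rightarrow>\<^sub>L 'a) (x, y). cinner x (T y)) -` ((\<lambda>g. g (x, y)) -` U) \<inter> complex_operators)"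
    using assms T unfolding limitin_def
    by (auto simp: weak_operator_topology_def topspace_pullback_topology)
  then show "\<forall>\<^sub>F i in G. cinner x (f i y) \<in> U"
    by (rule eventually_mono) auto
qed

lemma emeasure_diagonal_measure:
  assumes "povm E" and "\<Delta> \<in> sets borel"
  shows "emeasure (diagonal_measure E x) \<Delta> = ennreal (Re (cinner x (E \<Delta> x)))"
proof -
  let ?\<mu> = "\<lambda>\<Delta>. Re (cinner x (E \<Delta> x))"
  have nonneg: "0 \<le> ?\<mu> \<Delta>" if "\<Delta> \<in> sets borel" for \<Delta>
    using assms(1) that by (auto simp: povm_def positive_operator_def)
  have sums: "(\<lambda>i. ?\<mu> (D i)) sums ?\<mu> (\<Union>i. D i)"
    if "range D \<subseteq> sets borel" "disjoint_family D" for D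
  proof -
    have "limitin weak_operator_topology (\<lambda>n. \<Sum>i<n. E (D i)) (E (\<Union>i. D i)) sequentially"
      using assms(1) that by (auto simp: povm_def)
    from tendsto_Re[OF limitin_weak_operator_topologyD[OF this, of x x]] show ?thesis
      by (simp add: sums_def blinfun.sum_left cinner_sum_right)
  qed
  have "(\<lambda>_. ?\<mu> {}) sums ?\<mu> {}"
    using sums[of "\<lambda>_. {}"] by (simp add: disjoint_family_on_def)
  then have zero: "?\<mu> {} = 0"
    using sums_summable summable_const_iff by blast
  show ?thesis
  proof (rule emeasure_measure_of[OF diagonal_measure_def])
    show "positive (sets (diagonal_measure E x)) (\<lambda>\<Delta>. ennreal (?\<mu> \<Delta>))"
      by (simp add: positive_def zero)
    show "countably_additive (sets (diagonal_measure E x)) (\<lambda>\<Delta>. ennreal (?\<mu> \<Delta>))"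
    proof (rule countably_additiveI)
      fix D :: "nat \<Rightarrow> real set"
      assume D: "range D \<subseteq> sets (diagonal_measure E x)" "disjoint_family D"
      then have "(\<lambda>i. ?\<mu> (D i)) sums ?\<mu> (\<Union>i. D i)"
        by (intro sums) auto
      then show "(\<Sum>i. ennreal (?\<mu> (D i))) = ennreal (?\<mu> (\<Union>i. D i))"
        using D nonneg by (intro suminf_ennreal_eq) auto
    qed
  qed (use assms(2) in auto)
qed

text \<open>The operator integral \<open>T = \<integral>\<^sub>S f dE\<close> in the weak sense, for real functions \<open>f\<close>.  In a
  complex Hilbert space a bounded operator is determined by its quadratic form, so \<open>T\<close> is unique.\<close>

definition has_operator_integral ::
    "(real set \<Rightarrow> ('h::complex_hilbert_space \<Rightarrow>\<^sub>L 'h)) \<Rightarrow> real set \<Rightarrow> (real \<Rightarrow> real) \<Rightarrow>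
      ('h \<Rightarrow>\<^sub>L 'h) \<Rightarrow> bool" where
  "has_operator_integral E S f T \<longleftrightarrow>
     T \<in> complex_operators \<and>
     (\<forall>x. set_integrable (diagonal_measure E x) S f \<and>
          cinner x (T x) = complex_of_real (LINT t:S|diagonal_measure E x. f t))"

definition spectral_measure ::
    "('h::complex_hilbert_space \<Rightarrow>\<^sub>L 'h) \<Rightarrow> (real set \<Rightarrow> ('h \<Rightarrow>\<^sub>L 'h)) \<Rightarrow> bool" where
  "spectral_measure A E \<longleftrightarrow>
     povm E \<and> normalized E \<and>
     (\<forall>\<Delta>\<in>sets borel. E \<Delta> o\<^sub>L E \<Delta> = E \<Delta>) \<and>
     has_operator_integral E UNIV (\<lambda>t. t) A"

definition markov_kernel_on :: "real set \<Rightarrow> (real \<Rightarrow> real measure) \<Rightarrow> bool" where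
  "markov_kernel_on S \<mu> \<longleftrightarrow>
     (\<forall>t\<in>S. prob_space (\<mu> t) \<and> sets (\<mu> t) = sets borel) \<and>
     (\<forall>\<Delta>\<in>sets borel. (\<lambda>t. measure (\<mu> t) \<Delta>) \<in> borel_measurable (restrict_space borel S))"

definition strong_feller_on :: "real set \<Rightarrow> (real \<Rightarrow> real measure) \<Rightarrow> bool" where
  "strong_feller_on S \<mu> \<longleftrightarrow> (\<forall>\<Delta>\<in>sets borel. continuous_on S (\<lambda>t. measure (\<mu> t) \<Delta>))"

text \<open>The operator \<open>\<mu>\<^sub>\<Delta>(A)\<close> of the Borel functional calculus is the integral of
  \<open>\<mu>\<^sub>\<Delta>\<close> over the spectrum of \<open>A\<close> with respect to the spectral measure of \<open>A\<close>.\<close>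

definition sharp_version ::
    "(real set \<Rightarrow> ('h::complex_hilbert_space \<Rightarrow>\<^sub>L 'h)) \<Rightarrow> ('h \<Rightarrow>\<^sub>L 'h) \<Rightarrow> bool" where
  "sharp_version F A \<longleftrightarrow>
     selfadjoint A \<and>
     (\<exists>E \<mu>. spectral_measure A E \<and>
        markov_kernel_on (real_spectrum A) \<mu> \<and>
        (\<forall>\<Delta>\<in>sets borel.
           has_operator_integral E (real_spectrum A) (\<lambda>t. measure (\<mu> t) \<Delta>) (F \<Delta>))) \<and>
     generated_von_neumann_algebra {A} = generated_von_neumann_algebra (F ` sets borel)"

definition admits_strong_feller_kernel ::
    "(real set \<Rightarrow> ('h::complex_hilbert_space \<Rightarrow>\<^sub>L 'h)) \<Rightarrow> bool" where
  "admits_strong_feller_kernel F \<longleftrightarrow>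
     (\<exists>A E \<mu>. sharp_version F A \<and>
        spectrum A \<subseteq> complex_of_real ` {0..1} \<and>
        spectral_measure A E \<and>
        markov_kernel_on {0..1} \<mu> \<and>
        strong_feller_on {0..1} \<mu> \<and>
        (\<forall>\<Delta>\<in>sets borel.
           has_operator_integral E {0..1} (\<lambda>t. measure (\<mu> t) \<Delta>) (F \<Delta>)))"

end

theory Submission
  imports Defs
begin

text \<open>If the kernel is strong Feller, then for pairwise disjoint \<open>\<Delta>\<^sub>i\<close> the remainders
  \<open>\<mu>\<^sub>\<Delta> - \<Sum>i<n. \<mu>\<^sub>\<Delta>\<^sub>i\<close> are continuous on the compact interval \<open>[0,1]\<close> and decrease to \<open>0\<close>, hence
  uniformly, and the operator integral turns uniform convergence into norm convergence.

  Conversely, uniform continuity implies that every norm closed algebra containing the countably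
  many operators \<open>F (-\<infinity>, q]\<close>, \<open>q\<close> rational, contains all \<open>F(\<Delta>)\<close>.  Each of these is a norm limit of
  combinations of its spectral projections onto \<open>[i/n, \<infinity>)\<close>.  This gives a sequence \<open>P\<^sub>j\<close> of
  commuting projections in the von Neumann algebra of \<open>F\<close>, and \<open>A = \<Sum>\<^sub>j 99 \<cdot> 100\<^sup>-\<^sup>j\<^sup>-\<^sup>1 P\<^sub>j\<close> generates
  the same norm closed algebra as the \<open>P\<^sub>j\<close>.  Therefore \<open>F(\<Delta>) = f\<^sub>\<Delta>(A)\<close> with \<open>f\<^sub>\<Delta>\<close> continuous on \<open>\<sigma>(A)\<close>;
  since \<open>C(\<sigma>(A))\<close> embeds isometrically, \<open>\<Delta> \<mapsto> f\<^sub>\<Delta>(t)\<close> is a probability measure for each \<open>t\<close>, and linear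
  interpolation over the gaps of \<open>\<sigma>(A)\<close> extends this kernel continuously to \<open>[0,1]\<close>.\<close>

section \<open>Operators on a Hilbert space\<close>

\<comment> \<open>The obstacle is continuity of f_\<Delta>. A generator of the von Neumann algebra
  of F alone would make F(\<Delta>) only a Borel function of it; continuity requires F(\<Delta>) to
  lie in the norm closed algebra generated by A. Countably many commuting self-adjoint operators
  need not have such a generator (the two coordinates on a square do not), whereas commuting
  projections do: their joint spectrum is a closed subset of a Cantor set and embeds in the line.
  Hence the detour through spectral projections, which may leave the norm closed algebra of F but
  not its von Neumann algebra, so that A is still a sharp version. Base 100 is generous: after
  rescaling, what remains of A is within 1/50 of the next projection. Uniform continuity enters
  again for countable additivity of f_\<Delta>(t) at every single t; weak convergence would give it
  only up to null sets. Interpolation has weights independent of \<Delta> and so keeps additivity,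
  which extending each f_\<Delta> separately would lose.\<close>
subclass (in complex_hilbert_space) banach ..

lemma cinner_scaleC_left: "cinner (c *\<^sub>C x) y = cnj c * cinner x y"
  by (metis cinner_commute cinner_scaleC_right complex_cnj_mult)

text \<open>Both parts of the complex inner product are values of the real one, so weak limits and
  adjointness can be treated with \<open>inner\<close> alone.\<close>

lemma cinner_eq_Complex: "cinner x y = Complex (inner x y) (inner (\<i> *\<^sub>C x) y)"
  by (simp add: inner_eq_Re_cinner cinner_scaleC_left complex_eq_iff)

lemma blinfun_compose_assoc: "(R o\<^sub>L S) o\<^sub>L T = R o\<^sub>L (S o\<^sub>L T)"
  by (rule blinfun_eqI) simp

lemma compose_commute:
  "S o\<^sub>L R = R o\<^sub>L S \<Longrightarrow> T o\<^sub>L R = R o\<^sub>L T \<Longrightarrow> (S o\<^sub>L T) o\<^sub>L R = R o\<^sub>L (S o\<^sub>L T)"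
  by (metis blinfun_compose_assoc)

lemma blinfun_compose_id [simp]: "T o\<^sub>L id_blinfun = T" "id_blinfun o\<^sub>L T = T"
  by (auto intro: blinfun_eqI)

section \<open>Symmetric and positive operators over the real inner product\<close>

definition symmetric :: "('a::real_inner \<Rightarrow>\<^sub>L 'a) \<Rightarrow> bool" where
  "symmetric T \<longleftrightarrow> (\<forall>x y. inner (T x) y = inner x (T y))"

definition psd :: "('a::real_inner \<Rightarrow>\<^sub>L 'a) \<Rightarrow> bool" where
  "psd T \<longleftrightarrow> symmetric T \<and> (\<forall>x. 0 \<le> inner x (T x))"

lemma symmetricD: "symmetric T \<Longrightarrow> inner (T x) y = inner x (T y)"
  by (simp add: symmetric_def)

lemma complex_operatorsD: "T \<in> complex_operators \<Longrightarrow> T (c *\<^sub>C x) = c *\<^sub>C T x"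
  by (simp add: complex_operators_def)

text \<open>The imaginary part of \<open>cinner\<close> is \<open>inner\<close> with \<i> applied to
  one argument, and a complex linear \<open>T\<close> commutes with \<i>.\<close>

lemma is_adjoint_iff_symmetric:
  assumes "T \<in> complex_operators"
  shows "is_adjoint T T \<longleftrightarrow> symmetric T"
proof
  assume "is_adjoint T T"
  then show "symmetric T"
    by (simp add: is_adjoint_def symmetric_def inner_eq_Re_cinner)
next
  assume "symmetric T"
  then show "is_adjoint T T"
    by (simp add: is_adjoint_def cinner_eq_Complex symmetricD complex_operatorsD[OF assms, symmetric])
qed

lemma selfadjoint_iff: "selfadjoint T \<longleftrightarrow> T \<in> complex_operators \<and> symmetric T"
  unfolding selfadjoint_def using is_adjoint_iff_symmetric by blast

lemma positive_operator_iff: "positive_operator T \<longleftrightarrow> T \<in> complex_operators \<and> psd T"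
  unfolding positive_operator_def selfadjoint_iff psd_def by (simp add: inner_eq_Re_cinner)

lemma cinner_symmetric:
  assumes "T \<in> complex_operators" "symmetric T"
  shows "cinner x (T x) = complex_of_real (inner x (T x))"
proof -
  have "is_adjoint T T"
    using assms is_adjoint_iff_symmetric by blast
  then have "cinner x (T x) = cnj (cinner x (T x))"
    by (metis cinner_commute is_adjoint_def)
  then have "Im (cinner x (T x)) = 0"
    by (metis Reals_cnj_iff complex_is_Real_iff)
  then show ?thesis
    by (simp add: complex_eq_iff inner_eq_Re_cinner)
qed

lemma complex_operators_zero: "0 \<in> complex_operators"
  using scaleC_add_right[of _ 0 0] by (auto simp: complex_operators_def)

lemma complex_operators_id: "id_blinfun \<in> complex_operators"
  by (simp add: complex_operators_def)

lemma complex_operators_add: "S \<in> complex_operators \<Longrightarrow> T \<in> complex_operators \<Longrightarrow> S + T \<in> complex_operators"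
  by (simp add: complex_operators_def blinfun.add_left scaleC_add_right)

lemma complex_operators_scaleR: "T \<in> complex_operators \<Longrightarrow> r *\<^sub>R T \<in> complex_operators"
  by (simp add: complex_operators_def blinfun.scaleR_left scaleR_scaleC scaleC_scaleC mult.commute)

lemma complex_operators_compose: "S \<in> complex_operators \<Longrightarrow> T \<in> complex_operators \<Longrightarrow> S o\<^sub>L T \<in> complex_operators"
  by (simp add: complex_operators_def)

lemma complex_operators_diff: "S \<in> complex_operators \<Longrightarrow> T \<in> complex_operators \<Longrightarrow> S - T \<in> complex_operators"
  using complex_operators_add[of S "(-1) *\<^sub>R T"] complex_operators_scaleR[of T "-1"] by simp

lemma complex_operators_pointwise_limit:
  fixes T :: "'h::complex_hilbert_space \<Rightarrow>\<^sub>L 'h"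
  assumes "\<And>n. S n \<in> complex_operators" "\<And>x. (\<lambda>n. S n x) \<longlonglongrightarrow> T x"
  shows "T \<in> complex_operators"
  unfolding complex_operators_def
proof (intro CollectI allI)
  fix c x
  have "(\<lambda>n. S n (c *\<^sub>C x)) \<longlonglongrightarrow> c *\<^sub>C T x"
    using bounded_linear.tendsto[OF bounded_linear_scaleC assms(2)[of x], of c]
    by (simp add: complex_operatorsD[OF assms(1)])
  then show "T (c *\<^sub>C x) = c *\<^sub>C T x"
    using LIMSEQ_unique assms(2) by blast
qed

lemma symmetric_zero: "symmetric 0"
  by (simp add: symmetric_def)

lemma symmetric_id: "symmetric id_blinfun"
  by (simp add: symmetric_def)

lemma symmetric_add: "symmetric S \<Longrightarrow> symmetric T \<Longrightarrow> symmetric (S + T)"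
  by (simp add: symmetric_def blinfun.add_left inner_add)

lemma symmetric_scaleR: "symmetric T \<Longrightarrow> symmetric (r *\<^sub>R T)"
  by (simp add: symmetric_def blinfun.scaleR_left)

lemma symmetric_diff: "symmetric S \<Longrightarrow> symmetric T \<Longrightarrow> symmetric (S - T)"
  by (simp add: symmetric_def blinfun.diff_left inner_diff)

lemma symmetric_sum: "(\<And>i. i \<in> I \<Longrightarrow> symmetric (f i)) \<Longrightarrow> symmetric (sum f I)"
  by (induction I rule: infinite_finite_induct) (auto simp: symmetric_zero symmetric_add)

lemma symmetric_pointwise_limit:
  fixes T :: "'a::real_inner \<Rightarrow>\<^sub>L 'a"
  assumes "\<And>n. symmetric (S n)" "\<And>x. (\<lambda>n. S n x) \<longlonglongrightarrow> T x"
  shows "symmetric T"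
  unfolding symmetric_def
proof (intro allI)
  fix x y
  have "(\<lambda>n. inner (S n x) y) \<longlonglongrightarrow> inner (T x) y" "(\<lambda>n. inner x (S n y)) \<longlonglongrightarrow> inner x (T y)"
    by (intro tendsto_intros assms(2))+
  then show "inner (T x) y = inner x (T y)"
    using LIMSEQ_unique by (simp add: symmetricD[OF assms(1)])
qed

text \<open>Polarization: by symmetry the two cross terms of the form at \<open>x + y\<close>
  coincide. Operators are identified below by their quadratic forms, that is, by measures.\<close>

lemma symmetric_eqI:
  fixes T :: "'a::real_inner \<Rightarrow>\<^sub>L 'a"
  assumes "symmetric S" "symmetric T" "\<And>x. inner x (S x) = inner x (T x)"
  shows "S = T"
proof (rule blinfun_eqI)
  fix y
  have q: "inner z (S z) = inner z (T z)" for z by (rule assms(3))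
  have "inner x (S y) = inner x (T y)" for x
    using q[of "x + y"] q[of x] q[of y] symmetricD[OF assms(1), of x y] symmetricD[OF assms(2), of x y]
    by (simp add: blinfun.add_right inner_add inner_commute)
  then show "S y = T y"
    by (metis vector_eq_ldot)
qed

text \<open>Cauchy-Schwarz for the positive form of \<open>T\<close>: the form stays nonnegative
  along the line \<open>x - t *\<^sub>R T x\<close>, which is a quadratic polynomial in
  \<open>t\<close> with leading coefficient \<open>d \<le> c * b\<close>.\<close>

lemma psd_norm_square_le:
  assumes "psd T" "\<And>x. inner x (T x) \<le> c * (norm x)\<^sup>2"
  shows "(norm (T x))\<^sup>2 \<le> c * inner x (T x)"
proof -
  define a where "a = inner x (T x)"
  define b where "b = (norm (T x))\<^sup>2"
  define d where "d = inner (T x) (T (T x))"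
  have sym: "symmetric T" and pos: "0 \<le> inner z (T z)" for z
    using assms(1) by (auto simp: psd_def)
  have bb: "inner x (T (T x)) = b" "inner (T x) (T x) = b"
    using symmetricD[OF sym, of x "T x"] by (auto simp: b_def power2_norm_eq_inner)
  have quad: "0 \<le> a - 2 * t * b + t\<^sup>2 * d" for t
    using pos[of "x - t *\<^sub>R T x"]
    by (simp add: blinfun.diff_right blinfun.scaleR_right inner_diff bb a_def[symmetric] d_def[symmetric]
        power2_eq_square algebra_simps)
  have ab: "0 \<le> a" "0 \<le> b" and db: "0 \<le> d" "d \<le> c * b"
    using pos assms(2)[of "T x"] by (auto simp: a_def b_def d_def)
  show ?thesis
  proof (cases "b = 0")
    case True
    then show ?thesis
      using assms(2)[of x] ab pos[of x]
      by (simp add: b_def)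
  next
    case False
    with ab have b: "0 < b" by simp
    have c: "0 \<le> c"
      using db b zero_le_mult_iff[of c b] by auto
    show ?thesis
    proof (cases "c = 0")
      case True
      then have "d = 0" using db by simp
      \<comment> \<open>With \<open>d = 0\<close> the polynomial is linear in \<open>t\<close>; its
        value at \<open>(a + 1) / b\<close> is \<open>- a - 2\<close>, which is negative.\<close>
      then show ?thesis
        using quad[of "(a + 1) / b"] b ab mult_nonneg_nonneg[OF ab] by (simp add: field_simps)
    next
      case False
      with c have c: "0 < c" by simp
      \<comment> \<open>The choice \<open>t = 1/c\<close> minimizes
        \<open>a - 2 * t * b + t\<^sup>2 * (c * b)\<close>.\<close>
      have "0 \<le> a - 2 * (1/c) * b + (1/c)\<^sup>2 * (c * b)"
        using quad[of "1/c"] mult_left_mono[OF db(2) zero_le_power2, of "1/c"] by linarith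
      also have "\<dots> = a - b / c"
        using c by (simp add: power2_eq_square field_simps)
      finally show ?thesis
        using c by (simp add: field_simps a_def[symmetric] b_def[symmetric])
    qed
  qed
qed

lemma psd_norm_le:
  assumes "psd T" "\<And>x. inner x (T x) \<le> c * (norm x)\<^sup>2" "0 \<le> c"
  shows "norm T \<le> c"
proof (rule norm_blinfun_bound)
  show "norm (T x) \<le> c * norm x" for x
  proof (rule power2_le_imp_le)
    have "(norm (T x))\<^sup>2 \<le> c * inner x (T x)"
      using assms psd_norm_square_le by blast
    also have "\<dots> \<le> c * (c * (norm x)\<^sup>2)"
      using assms by (intro mult_left_mono) auto
    finally show "(norm (T x))\<^sup>2 \<le> (c * norm x)\<^sup>2"
      by (simp add: power_mult_distrib power2_eq_square algebra_simps)
  qed (use assms in auto)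
qed (use assms in auto)

section \<open>Weak limits and closed operator algebras\<close>

lemma limitin_weak_operator_topologyI:
  fixes T :: "'h::complex_hilbert_space \<Rightarrow>\<^sub>L 'h"
  assumes "\<And>n. S n \<in> complex_operators" "T \<in> complex_operators"
    and "\<And>x y. (\<lambda>n. inner x (S n y)) \<longlonglongrightarrow> inner x (T y)"
  shows "limitin weak_operator_topology S T sequentially"
proof -
  let ?f = "\<lambda>(T :: 'h \<Rightarrow>\<^sub>L 'h) (x, y). cinner x (T y)"
  have lim: "(\<lambda>n. cinner x (S n y)) \<longlonglongrightarrow> cinner x (T y)" for x y
    unfolding cinner_eq_Complex by (intro tendsto_Complex assms)
  have "limitin (product_topology (\<lambda>_. euclidean) UNIV) (\<lambda>n. ?f (S n)) (?f T) sequentially"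
    unfolding limitin_componentwise using lim by auto
  then have *: "limitin euclidean (\<lambda>n. ?f (S n)) (?f T) sequentially"
    by (simp add: euclidean_product_topology)
  show ?thesis
    unfolding limitin_def
  proof (intro conjI allI impI)
    show "T \<in> topspace weak_operator_topology"
      using assms(2) by (auto simp: weak_operator_topology_def topspace_pullback_topology)
    fix U assume "openin weak_operator_topology U \<and> T \<in> U"
    then obtain V where V: "open V" "U = ?f -` V \<inter> complex_operators" "?f T \<in> V"
      unfolding weak_operator_topology_def openin_pullback_topology by auto
    then have "\<forall>\<^sub>F n in sequentially. ?f (S n) \<in> V"
      using * by (auto simp: limitin_def)
    then show "\<forall>\<^sub>F n in sequentially. S n \<in> U"
      using V(2) assms(1) by (auto elim: eventually_mono)
  qed
qed

text \<open>Von Neumann algebras and commutants enter only through the following closure properties,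
  shared by both.\<close>

definition seq_closed_algebra :: "('h::complex_hilbert_space \<Rightarrow>\<^sub>L 'h) set \<Rightarrow> bool" where
  "seq_closed_algebra M \<longleftrightarrow> M \<subseteq> complex_operators \<and> id_blinfun \<in> M \<and>
     (\<forall>S\<in>M. \<forall>T\<in>M. S + T \<in> M \<and> S o\<^sub>L T \<in> M) \<and> (\<forall>r. \<forall>T\<in>M. r *\<^sub>R T \<in> M) \<and>
     (\<forall>S T. range S \<subseteq> M \<longrightarrow> T \<in> complex_operators \<longrightarrow>
        (\<forall>x y. (\<lambda>n::nat. inner x (blinfun_apply (S n) y)) \<longlonglongrightarrow> inner x (T y)) \<longrightarrow> T \<in> M)"

text \<open>An algebra over the reals, matching the real polynomials in self-adjoint operators that
  are formed below.\<close>

definition norm_closed_algebra :: "('a::real_normed_vector \<Rightarrow>\<^sub>L 'a) set \<Rightarrow> bool" where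
  "norm_closed_algebra N \<longleftrightarrow> id_blinfun \<in> N \<and>
     (\<forall>S\<in>N. \<forall>T\<in>N. S + T \<in> N \<and> S o\<^sub>L T \<in> N) \<and> (\<forall>r. \<forall>T\<in>N. r *\<^sub>R T \<in> N) \<and> closed N"

lemma seq_closed_algebra_limit:
  fixes T :: "'h::complex_hilbert_space \<Rightarrow>\<^sub>L 'h"
  assumes "seq_closed_algebra M" "\<And>n. S n \<in> M" "T \<in> complex_operators"
    "\<And>x y. (\<lambda>n::nat. inner x (S n y)) \<longlonglongrightarrow> inner x (T y)"
  shows "T \<in> M"
  using assms unfolding seq_closed_algebra_def by (metis image_subsetI)

lemma seq_closed_algebra_pointwise_limit:
  fixes T :: "'h::complex_hilbert_space \<Rightarrow>\<^sub>L 'h"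
  assumes "seq_closed_algebra M" "\<And>n::nat. S n \<in> M" "\<And>x. (\<lambda>n. S n x) \<longlonglongrightarrow> T x"
  shows "T \<in> M"
proof (rule seq_closed_algebra_limit[OF assms(1,2)])
  show "T \<in> complex_operators"
    using complex_operators_pointwise_limit[OF _ assms(3)] assms(1,2)
    unfolding seq_closed_algebra_def by blast
  show "(\<lambda>n. inner x (S n y)) \<longlonglongrightarrow> inner x (T y)" for x y
    by (intro tendsto_intros assms)
qed

lemma seq_closed_imp_norm_closed:
  assumes "seq_closed_algebra M"
  shows "norm_closed_algebra M"
proof -
  have "T \<in> M" if "\<forall>n. S n \<in> M" "S \<longlonglongrightarrow> T" for S T
    using that seq_closed_algebra_pointwise_limit[OF assms, of S T]
    by (simp add: blinfun.tendsto)
  then show ?thesis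
    using assms unfolding norm_closed_algebra_def seq_closed_algebra_def closed_sequential_limits
    by blast
qed

lemma scaleC_blinfun_of_real: "scaleC_blinfun (complex_of_real r) T = r *\<^sub>R T"
  by (rule blinfun_eqI) (simp add: scaleC_blinfun_apply blinfun.scaleR_left scaleR_scaleC)

lemma von_neumann_imp_seq_closed:
  assumes "von_neumann_algebra M"
  shows "seq_closed_algebra M"
proof -
  have cl: "closedin weak_operator_topology M"
    using assms by (simp add: von_neumann_algebra_def)
  then have sub: "M \<subseteq> complex_operators"
    using closedin_subset by (fastforce simp: weak_operator_topology_def topspace_pullback_topology)
  have "T \<in> M" if "range S \<subseteq> M" "T \<in> complex_operators"
    "\<forall>x y. (\<lambda>n::nat. inner x (S n y)) \<longlonglongrightarrow> inner x (T y)" for S T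
  proof (rule limitin_closedin[OF _ cl])
    show "limitin weak_operator_topology S T sequentially"
      using that sub by (intro limitin_weak_operator_topologyI) auto
    show "\<forall>\<^sub>F n in sequentially. S n \<in> M"
      using that(1) by (auto intro: always_eventually)
  qed simp
  then show ?thesis
    using assms sub unfolding seq_closed_algebra_def von_neumann_algebra_def
    unfolding scaleC_blinfun_of_real[symmetric] by blast
qed

text \<open>Composition with a fixed operator is weakly continuous on either side; on the left,
  symmetry moves \<open>S\<close> to the other slot of the inner product.\<close>

lemma commutant_seq_closed:
  assumes "symmetric S"
  shows "seq_closed_algebra {T \<in> complex_operators. T o\<^sub>L S = S o\<^sub>L T}"
  unfolding seq_closed_algebra_def
proof (intro conjI ballI allI impI)
  fix U T
  assume U: "range U \<subseteq> {T \<in> complex_operators. T o\<^sub>L S = S o\<^sub>L T}" and T: "T \<in> complex_operators"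
    and lim: "\<forall>x y. (\<lambda>n::nat. inner x (blinfun_apply (U n) y)) \<longlonglongrightarrow> inner x (T y)"
  have US: "U n (S y) = S (U n y)" for n y
    using U by (metis (mono_tags, lifting) blinfun_apply_blinfun_compose mem_Collect_eq range_subsetD)
  have "T (S y) = S (T y)" for y
  proof -
    have "inner x (T (S y)) = inner x (S (T y))" for x
    proof (rule LIMSEQ_unique)
      show "(\<lambda>n. inner x (U n (S y))) \<longlonglongrightarrow> inner x (T (S y))"
        using lim by blast
      show "(\<lambda>n. inner x (U n (S y))) \<longlonglongrightarrow> inner x (S (T y))"
        using lim assms by (simp add: US symmetricD[symmetric])
    qed
    then show ?thesis by (metis vector_eq_ldot)
  qed
  then show "T \<in> {T \<in> complex_operators. T o\<^sub>L S = S o\<^sub>L T}"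
    using T by (auto intro: blinfun_eqI)
qed (auto simp: complex_operators_id complex_operators_add complex_operators_compose complex_operators_scaleR
    bounded_bilinear.add_left[OF bounded_bilinear_blinfun_compose]
    bounded_bilinear.add_right[OF bounded_bilinear_blinfun_compose]
    bounded_bilinear.scaleR_left[OF bounded_bilinear_blinfun_compose]
    bounded_bilinear.scaleR_right[OF bounded_bilinear_blinfun_compose]
    blinfun_compose_id intro: compose_commute)

section \<open>The Hausdorff moment problem\<close>

lemma smult_sum_right: "smult c (\<Sum>i\<in>I. f i) = (\<Sum>i\<in>I. smult c (f i))"
  by (induction I rule: infinite_finite_induct) (auto simp: smult_add_right)

definition Bernstein_poly :: "nat \<Rightarrow> nat \<Rightarrow> real poly" where
  "Bernstein_poly n k = smult (real (n choose k)) ([:0, 1:] ^ k * [:1, -1:] ^ (n - k))"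

text \<open>The product of \<open>n choose k\<close> and \<open>k choose j\<close> equals that of
  \<open>n choose j\<close> and \<open>(n - j) choose (k - j)\<close>. After X^j is pulled out, the
  binomial expansion of (X + (1 - X))^(n - j) = 1 is left. This is what makes factorial moments
  exact.\<close>

lemma sum_choose_Bernstein_poly:
  assumes "j \<le> n"
  shows "(\<Sum>k\<le>n. smult (real (k choose j)) (Bernstein_poly n k)) = smult (real (n choose j)) ([:0, 1:] ^ j)"
proof -
  let ?X = "[:0, 1:] :: real poly" and ?Y = "[:1, -1:] :: real poly"
  have "(\<Sum>k\<le>n. smult (real (k choose j)) (Bernstein_poly n k)) =
        (\<Sum>k\<in>{j..n}. smult (real (k choose j)) (Bernstein_poly n k))"
    by (rule sum.mono_neutral_right) auto
  also have "\<dots> = (\<Sum>i\<le>n - j. smult (real ((i + j) choose j)) (Bernstein_poly n (i + j)))"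
    using assms
    by (intro sum.reindex_bij_witness[of _ "\<lambda>i. i + j" "\<lambda>k. k - j"]) auto
  also have "\<dots> = (\<Sum>i\<le>n - j. smult (real (n choose j)) (?X ^ j * (of_nat ((n - j) choose i) * ?X ^ i * ?Y ^ (n - j - i))))"
  proof (rule sum.cong)
    fix i assume "i \<in> {..n - j}"
    then have "(n choose (i + j)) * ((i + j) choose j) = (n choose j) * ((n - j) choose i)"
      using choose_mult[of j "i + j" n] assms by simp
    then have "real (n choose (i + j)) * real ((i + j) choose j) = real (n choose j) * real ((n - j) choose i)"
      by (metis of_nat_mult)
    then show "smult (real ((i + j) choose j)) (Bernstein_poly n (i + j)) =
        smult (real (n choose j)) (?X ^ j * (of_nat ((n - j) choose i) * ?X ^ i * ?Y ^ (n - j - i)))"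
      by (simp add: Bernstein_poly_def of_nat_poly power_add mult_ac diff_diff_eq add.commute)
  qed simp
  also have "\<dots> = smult (real (n choose j)) (?X ^ j * (?X + ?Y) ^ (n - j))"
    unfolding binomial_ring by (simp only: sum_distrib_left smult_sum_right)
  also have "?X + ?Y = 1"
    by (simp add: one_pCons)
  finally show ?thesis
    by simp
qed

text \<open>Both terms are products of \<open>j\<close> factors in [0,1], so their distance is at
  most the sum of the \<open>j\<close> factorwise distances, each at most
  \<open>j / n\<close>.\<close>

lemma choose_ratio_approx:
  assumes "k \<le> n" "j \<le> n" "0 < n"
  shows "\<bar>real (k choose j) / real (n choose j) - (real k / real n) ^ j\<bar> \<le> real j * real j / real n"
proof -
  \<comment> \<open>Truncated subtraction keeps the formula valid for \<open>j > m\<close>: the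
    factor with \<open>i = m\<close> vanishes.\<close>
  have prod: "real (m choose j) = (\<Prod>i<j. real (m - i)) / fact j" for m
  proof (cases "j \<le> m")
    case True
    then show ?thesis
      by (simp add: binomial_gbinomial gbinomial_prod_rev of_nat_diff atLeast0LessThan)
  next
    case False
    then have "\<exists>i<j. real (m - i) = 0" by (intro exI[of _ m]) auto
    then show ?thesis using False by (auto simp: binomial_eq_0)
  qed
  let ?z = "\<lambda>i. real (k - i) / real (n - i)"
  have "real (k choose j) / real (n choose j) = (\<Prod>i<j. ?z i)"
    by (simp add: prod prod_dividef)
  moreover have "\<bar>(\<Prod>i<j. ?z i) - (\<Prod>i<j. real k / real n)\<bar> \<le> (\<Sum>i<j. \<bar>?z i - real k / real n\<bar>)"
    using assms norm_prod_diff[of "{..<j}" ?z "\<lambda>_. real k / real n"]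
    by (simp add: divide_le_eq_1)
  moreover have "\<bar>?z i - real k / real n\<bar> \<le> real j / real n" if "i < j" for i
  proof (cases "i \<le> k")
    case True
    have pos: "0 < real n" "0 < real n - real i" using that assms by auto
    have "?z i - real k / real n = - (real i * (real n - real k)) / (real n * (real n - real i))"
      using True that assms pos by (simp add: of_nat_diff field_simps)
    then have "\<bar>?z i - real k / real n\<bar> = (real i / real n) * ((real n - real k) / (real n - real i))"
      using assms pos by (simp add: abs_mult)
    also have "\<dots> \<le> (real i / real n) * 1"
      using True assms pos by (intro mult_left_mono) auto
    also have "\<dots> \<le> real j / real n"
      using that by (simp add: divide_right_mono)
    finally show ?thesis .
  next
    case False
    then have "\<bar>?z i - real k / real n\<bar> = real k / real n" by simp
    also have "\<dots> \<le> real j / real n"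
      using False that by (intro divide_right_mono) auto
    finally show ?thesis .
  qed
  then have "(\<Sum>i<j. \<bar>?z i - real k / real n\<bar>) \<le> real j * (real j / real n)"
    using sum_bounded_above[of "{..<j}" "\<lambda>i. \<bar>?z i - real k / real n\<bar>" "real j / real n"] by simp
  ultimately show ?thesis by simp
qed

text \<open>The Bernstein weights \<open>L (b\<^sub>n\<^sub>,\<^sub>k)\<close> at the points \<open>k / n\<close> form probability measures whose
  factorial moments are exact; a weak limit of them, from Helly's theorem, has the moments \<open>L\<close>.\<close>

lemma Hausdorff_moment:
  fixes L :: "real poly \<Rightarrow> real"
  assumes add: "\<And>p q. L (p + q) = L p + L q" and smult: "\<And>c p. L (smult c p) = c * L p"
    and sq: "\<And>p. 0 \<le> L (p * p)" and sqX: "\<And>p. 0 \<le> L ([:0, 1:] * (p * p))"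
    and sqY: "\<And>p. 0 \<le> L ([:1, -1:] * (p * p))" and one: "L 1 = 1"
  obtains M where "real_distribution M" "measure M {0..1} = 1" "\<And>p. (\<integral>t. poly p t \<partial>M) = L p"
proof -
  let ?X = "[:0, 1:] :: real poly" and ?Y = "[:1, -1:] :: real poly"
  have zero: "L 0 = 0"
    using smult[of 0 0] by simp
  have L_sum: "L (\<Sum>i\<in>I. f i) = (\<Sum>i\<in>I. L (f i))" for f :: "nat \<Rightarrow> real poly" and I
    by (induction I rule: infinite_finite_induct) (auto simp: add zero)
  \<comment> \<open>Splitting off the even parts of both exponents leaves the square
    \<open>q * q\<close> times one of 1, X, Y, XY. The first three cases are hypotheses.\<close>
  have nonneg: "0 \<le> L (?X ^ k * ?Y ^ m)" for k m
  proof -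
    define q where "q = ?X ^ (k div 2) * ?Y ^ (m div 2)"
    have k: "?X ^ k = ?X ^ (k div 2) * ?X ^ (k div 2) * ?X ^ (k mod 2)"
      by (metis mult.commute mult_2_right power_add mult_div_mod_eq)
    have m: "?Y ^ m = ?Y ^ (m div 2) * ?Y ^ (m div 2) * ?Y ^ (m mod 2)"
      by (metis mult.commute mult_2_right power_add mult_div_mod_eq)
    have eq: "?X ^ k * ?Y ^ m = ?X ^ (k mod 2) * (?Y ^ (m mod 2) * (q * q))"
      unfolding q_def by (subst k, subst m) (simp only: mult_ac)
    \<comment> \<open>Multiplying the mixed product by X + Y = 1 turns it into a sum of squares
      weighted by Y and by X.\<close>
    have XY: "?X * (?Y * (q * q)) = ?Y * ((?X * q) * (?X * q)) + ?X * ((?Y * q) * (?Y * q))"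
    proof -
      have "?X + ?Y = 1" by (simp add: one_pCons)
      then have "?X * (?Y * (q * q)) = (?X + ?Y) * (?X * (?Y * (q * q)))" by simp
      also have "\<dots> = ?Y * ((?X * q) * (?X * q)) + ?X * ((?Y * q) * (?Y * q))"
        by (simp only: ring_distribs mult_ac add_ac)
      finally show ?thesis .
    qed
    have "0 \<le> L (?X * (?Y * (q * q)))"
      unfolding XY add by (intro add_nonneg_nonneg sqX sqY)
    moreover have "k mod 2 = 0 \<or> k mod 2 = 1" "m mod 2 = 0 \<or> m mod 2 = 1" by auto
    ultimately show ?thesis
      unfolding eq using sq[of q] sqX[of q] sqY[of q] by (elim disjE) simp_all
  qed
  define w where "w n k = L (Bernstein_poly n k)" for n k
  have w_nonneg: "0 \<le> w n k" for n k
    by (simp add: w_def Bernstein_poly_def smult nonneg)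
  have w_moment: "(\<Sum>k\<le>n. real (k choose j) * w n k) = real (n choose j) * L (?X ^ j)" if "j \<le> n" for j n
    using arg_cong[OF sum_choose_Bernstein_poly[OF that], of L] by (simp add: L_sum smult w_def)
  have w_sum: "(\<Sum>k\<le>n. w n k) = 1" for n
    using w_moment[of 0 n] one by simp
  define P where "P n = embed_pmf (\<lambda>k. if k \<le> n then w n k else 0)" for n
  have pmf_P: "pmf (P n) k = (if k \<le> n then w n k else 0)" for n k
    unfolding P_def
  proof (rule pmf_embed_pmf)
    have "(\<integral>\<^sup>+ k. ennreal (if k \<le> n then w n k else 0) \<partial>count_space UNIV)
        = (\<Sum>k\<le>n. ennreal (if k \<le> n then w n k else 0))"
      by (rule nn_integral_count_space') auto
    also have "\<dots> = 1"
      using w_sum[of n] by (simp add: sum_ennreal w_nonneg)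
    finally show "(\<integral>\<^sup>+ k. ennreal (if k \<le> n then w n k else 0) \<partial>count_space UNIV) = 1" .
  qed (auto simp: w_nonneg)
  \<comment> \<open>The shift to \<open>Suc n\<close> avoids division by zero in the points
    \<open>k / n\<close>.\<close>
  define m where "m n = distr (measure_pmf (P (Suc n))) borel (\<lambda>k. real k / real (Suc n))" for n
  have rd: "real_distribution (m n)" for n
    unfolding m_def by (rule prob_space.real_distribution_distr[OF measure_pmf.prob_space_axioms]) simp
  have int_m: "(\<integral>t. f t \<partial>m n) = (\<Sum>k\<le>Suc n. f (real k / real (Suc n)) * w (Suc n) k)"
    if [measurable]: "f \<in> borel_measurable borel" for f :: "real \<Rightarrow> real" and n
  proof -
    have "(\<integral>t. f t \<partial>m n) = (\<integral>k. f (real k / real (Suc n)) \<partial>measure_pmf (P (Suc n)))"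
      unfolding m_def by (rule integral_distr) auto
    also have "\<dots> = (\<Sum>k\<le>Suc n. f (real k / real (Suc n)) * pmf (P (Suc n)) k)"
      by (rule integral_measure_pmf_real) (auto simp: set_pmf_eq pmf_P split: if_splits)
    finally show ?thesis by (simp add: pmf_P)
  qed
  have "tight m"
    unfolding tight_def
  proof (intro conjI allI impI)
    fix e :: real assume "0 < e"
    \<comment> \<open>The interval is open on the left and must contain the atom at 0.\<close>
    have "measure (m n) {-1<..1} = 1" for n
    proof -
      interpret real_distribution "m n" by (rule rd)
      have "measure (m n) {-1<..1} = (\<integral>t. indicator {-1<..1} t \<partial>m n)"
        by simp
      also have "\<dots> = (\<Sum>k\<le>Suc n. indicator {-1<..1} (real k / real (Suc n)) * w (Suc n) k)"
        by (rule int_m) auto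
      also have "\<dots> = (\<Sum>k\<le>Suc n. w (Suc n) k)"
      proof (rule sum.cong)
        fix k assume "k \<in> {..Suc n}"
        then have "real k / real (Suc n) \<in> {-1<..1}"
          by (auto simp: divide_simps)
        then show "indicator {-1<..1} (real k / real (Suc n)) * w (Suc n) k = w (Suc n) k" by simp
      qed simp
      finally show ?thesis by (simp only: w_sum)
    qed
    then show "\<exists>a b::real. a < b \<and> (\<forall>n. 1 - e < measure (m n) {a<..b})"
      using \<open>0 < e\<close> by (intro exI[of _ "-1"] exI[of _ 1]) auto
  qed (rule rd)
  from tight_imp_convergent_subsubsequence[OF this strict_mono_id]
  obtain r M where r: "strict_mono r" and M: "real_distribution M" and conv: "weak_conv_m (m \<circ> r) M"
    by auto
  interpret M: real_distribution M by (rule M)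
  have lim: "(\<lambda>n. \<integral>t. f t \<partial>m (r n)) \<longlonglongrightarrow> (\<integral>t. f t \<partial>M)"
    if "\<And>t. isCont f t" "\<And>t. \<bar>f t\<bar> \<le> B" for f :: "real \<Rightarrow> real" and B
    using weak_conv_imp_integral_bdd_continuous_conv[of "m \<circ> r" M f B] rd M conv that by simp
  \<comment> \<open>Clamping to [0,1] turns powers into bounded continuous test functions and
    changes nothing on the support of the measures \<open>m n\<close>.\<close>
  define c where "c = (\<lambda>t::real. max 0 (min 1 t))"
  have c_cont: "isCont c t" for t
    unfolding c_def by (intro continuous_intros)
  have [measurable]: "c \<in> borel_measurable borel"
    unfolding c_def by simp
  have c_bounds: "0 \<le> c t" "c t \<le> 1" for t
    by (auto simp: c_def)
  have AE: "AE t in M. t \<in> {0..1}"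
  proof -
    \<comment> \<open>A bounded continuous function vanishing exactly on [0,1]: its integral is 0
      for every \<open>m n\<close>, hence for the limit, which therefore lives on [0,1].\<close>
    let ?f = "\<lambda>t. min 1 \<bar>t - c t\<bar>"
    have fc: "isCont ?f t" for t
      by (intro continuous_intros c_cont)
    have "(\<lambda>n. \<integral>t. ?f t \<partial>m (r n)) \<longlonglongrightarrow> (\<integral>t. ?f t \<partial>M)"
      by (rule lim[of ?f 1, OF fc]) auto
    moreover have "(\<integral>t. ?f t \<partial>m n) = 0" for n
    proof (subst int_m)
      have "?f (real k / real (Suc n)) = 0" if "k \<le> Suc n" for k
        using that by (simp add: c_def divide_simps)
      then show "(\<Sum>k\<le>Suc n. ?f (real k / real (Suc n)) * w (Suc n) k) = 0"
        by (intro sum.neutral) auto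
    qed simp
    ultimately have "(\<integral>t. ?f t \<partial>M) = 0"
      by (simp add: LIMSEQ_const_iff)
    moreover have "integrable M ?f"
      by (rule M.integrable_const_bound[where B=1]) auto
    ultimately have "AE t in M. ?f t = 0"
      by (subst (asm) integral_nonneg_eq_0_iff_AE) auto
    then show ?thesis
      by eventually_elim (auto simp: c_def min_def max_def split: if_splits)
  qed
  have mom: "(\<integral>t. t ^ j \<partial>M) = L (?X ^ j)" for j
  proof -
    have "(\<lambda>n. \<integral>t. c t ^ j \<partial>m (r n)) \<longlonglongrightarrow> (\<integral>t. c t ^ j \<partial>M)"
      by (rule lim[of _ 1]) (auto intro!: continuous_intros c_cont power_le_one simp: c_bounds)
    moreover have "(\<lambda>n. \<integral>t. c t ^ j \<partial>m (r n)) \<longlonglongrightarrow> L (?X ^ j)"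
    proof -
      \<comment> \<open>\<open>L\<close> of the j-th power is an exact average of quotients of
        binomial coefficients with the same weights; replacing each quotient by a power costs at
        most \<open>j * j / Suc n\<close>.\<close>
      have bound: "\<bar>(\<integral>t. c t ^ j \<partial>m n) - L (?X ^ j)\<bar> \<le> real j * real j * inverse (real (Suc n))" if "j \<le> n" for n
      proof -
        let ?N = "Suc n"
        have "(\<integral>t. c t ^ j \<partial>m n) = (\<Sum>k\<le>?N. c (real k / real ?N) ^ j * w ?N k)"
          by (rule int_m) simp
        also have "\<dots> = (\<Sum>k\<le>?N. (real k / real ?N) ^ j * w ?N k)"
        proof (rule sum.cong)
          fix k assume "k \<in> {..?N}"
          then have "c (real k / real ?N) = real k / real ?N"
            by (simp add: c_def divide_simps)
          then show "c (real k / real ?N) ^ j * w ?N k = (real k / real ?N) ^ j * w ?N k" by simp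
        qed simp
        finally have 1: "(\<integral>t. c t ^ j \<partial>m n) = (\<Sum>k\<le>?N. (real k / real ?N) ^ j * w ?N k)" .
        have "0 < ?N choose j" using that by simp
        then have 2: "L (?X ^ j) = (\<Sum>k\<le>?N. real (k choose j) / real (?N choose j) * w ?N k)"
          using w_moment[of j ?N] that by (simp add: sum_divide_distrib[symmetric] field_simps)
        have "\<bar>(\<integral>t. c t ^ j \<partial>m n) - L (?X ^ j)\<bar> =
            \<bar>\<Sum>k\<le>?N. (real (k choose j) / real (?N choose j) - (real k / real ?N) ^ j) * w ?N k\<bar>"
          unfolding 1 2 by (subst abs_minus_commute) (simp only: sum_subtractf[symmetric] left_diff_distrib[symmetric])
        also have "\<dots> \<le> (\<Sum>k\<le>?N. \<bar>real (k choose j) / real (?N choose j) - (real k / real ?N) ^ j\<bar> * w ?N k)"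
          by (rule order_trans[OF sum_abs]) (simp add: abs_mult w_nonneg)
        also have "\<dots> \<le> (\<Sum>k\<le>?N. (real j * real j / real ?N) * w ?N k)"
          using that by (intro sum_mono mult_right_mono choose_ratio_approx w_nonneg) auto
        also have "\<dots> = real j * real j / real ?N"
          by (simp only: sum_distrib_left[symmetric] w_sum mult_1_right)
        finally show ?thesis by (simp add: divide_inverse)
      qed
      have "(\<lambda>n. (\<integral>t. c t ^ j \<partial>m n) - L (?X ^ j)) \<longlonglongrightarrow> 0"
      proof (rule Lim_null_comparison)
        show "\<forall>\<^sub>F n in sequentially. norm ((\<integral>t. c t ^ j \<partial>m n) - L (?X ^ j)) \<le> real j * real j * inverse (real (Suc n))"
          using bound by (auto simp: eventually_sequentially)
        show "(\<lambda>n. real j * real j * inverse (real (Suc n))) \<longlonglongrightarrow> 0"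
          by (rule tendsto_mult_right_zero[OF LIMSEQ_inverse_real_of_nat])
      qed
      then have "(\<lambda>n. (\<integral>t. c t ^ j \<partial>m n)) \<longlonglongrightarrow> L (?X ^ j)"
        by (simp add: LIM_zero_cancel)
      then show ?thesis
        using LIMSEQ_subseq_LIMSEQ[OF _ r] by (fastforce simp: o_def)
    qed
    ultimately have "(\<integral>t. c t ^ j \<partial>M) = L (?X ^ j)"
      using LIMSEQ_unique by blast
    moreover have "(\<integral>t. c t ^ j \<partial>M) = (\<integral>t. t ^ j \<partial>M)"
      by (rule integral_cong_AE) (use AE in \<open>auto simp: c_def\<close>)
    ultimately show ?thesis by simp
  qed
  have int_pow: "integrable M (\<lambda>t. t ^ j)" for j
  proof (rule M.integrable_const_bound[where B=1])
    show "AE t in M. norm (t ^ j) \<le> 1"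
      using AE by eventually_elim (auto simp: power_abs intro!: power_le_one)
  qed simp
  have "integrable M (poly p) \<and> (\<integral>t. poly p t \<partial>M) = L p" for p
  proof -
    have p: "p = (\<Sum>i\<le>degree p. smult (coeff p i) (?X ^ i))"
      using poly_as_sum_of_monoms[of p] by (simp add: monom_altdef)
    have "L p = (\<Sum>i\<le>degree p. coeff p i * L (?X ^ i))"
      by (subst p) (simp only: L_sum smult)
    moreover have "integrable M (\<lambda>t. \<Sum>i\<le>degree p. coeff p i * t ^ i)"
      by (intro Bochner_Integration.integrable_sum integrable_mult_right int_pow)
    moreover have "(\<integral>t. (\<Sum>i\<le>degree p. coeff p i * t ^ i) \<partial>M) = (\<Sum>i\<le>degree p. coeff p i * L (?X ^ i))"
      by (subst Bochner_Integration.integral_sum) (auto simp: int_pow mom)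
    ultimately show ?thesis
      by (simp add: poly_altdef[abs_def])
  qed
  moreover have "measure M {0..1} = 1"
    using AE by (subst M.prob_eq_1) auto
  ultimately show ?thesis
    using that M by blast
qed

section \<open>The spectral theorem\<close>

definition op_poly :: "('a::real_normed_vector \<Rightarrow>\<^sub>L 'a) \<Rightarrow> real poly \<Rightarrow> ('a \<Rightarrow>\<^sub>L 'a)" where
  "op_poly A p = fold_coeffs (\<lambda>a T. a *\<^sub>R id_blinfun + (A o\<^sub>L T)) p 0"

lemma op_poly_0 [simp]: "op_poly A 0 = 0"
  by (simp add: op_poly_def)

lemma op_poly_pCons [simp]: "op_poly A (pCons a p) = a *\<^sub>R id_blinfun + (A o\<^sub>L op_poly A p)"
  by (cases "p = 0 \<and> a = 0") (auto simp: op_poly_def)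

lemma op_poly_1 [simp]: "op_poly A 1 = id_blinfun"
  by (simp add: one_pCons)

lemma op_poly_add: "op_poly A (p + q) = op_poly A p + op_poly A q"
  by (induction p q rule: poly_induct2)
     (auto simp: blinfun.bilinear_simps algebra_simps intro!: blinfun_eqI)

lemma op_poly_smult: "op_poly A (smult c p) = c *\<^sub>R op_poly A p"
  by (induction p) (auto simp: blinfun.bilinear_simps algebra_simps intro!: blinfun_eqI)

lemma op_poly_diff: "op_poly A (p - q) = op_poly A p - op_poly A q"
  using op_poly_add[of A p "- q"] op_poly_smult[of A "-1" q] by simp

lemma op_poly_mult: "op_poly A (p * q) = op_poly A p o\<^sub>L op_poly A q"
  by (induction p) (auto simp: op_poly_add op_poly_smult blinfun.bilinear_simps intro!: blinfun_eqI)

lemma op_poly_commute: "A o\<^sub>L op_poly A p = op_poly A p o\<^sub>L A"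
  using op_poly_mult[of A "[:0, 1:]" p] op_poly_mult[of A p "[:0, 1:]"]
  by (simp add: mult.commute)

lemma symmetric_op_poly: "symmetric A \<Longrightarrow> symmetric (op_poly A p)"
proof (induction p)
  case (pCons a p)
  have "A (op_poly A p x) = op_poly A p (A x)" for x
    by (metis blinfun_apply_blinfun_compose op_poly_commute)
  with pCons show ?case
    by (simp add: symmetric_def blinfun.bilinear_simps inner_add)
qed (simp add: symmetric_zero)

lemma op_poly_in_algebra:
  assumes "norm_closed_algebra N" "A \<in> N"
  shows "op_poly A p \<in> N"
proof (induction p)
  case 0
  then show ?case
    using assms unfolding norm_closed_algebra_def by (metis op_poly_0 scaleR_zero_left)
next
  case (pCons a p)
  then show ?case
    using assms unfolding norm_closed_algebra_def by simp
qed

lemma seq_closed_algebraD: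
  assumes "seq_closed_algebra M"
  shows "id_blinfun \<in> M" "S \<in> M \<Longrightarrow> T \<in> M \<Longrightarrow> S + T \<in> M" "S \<in> M \<Longrightarrow> T \<in> M \<Longrightarrow> S o\<^sub>L T \<in> M"
    "T \<in> M \<Longrightarrow> r *\<^sub>R T \<in> M"
  using assms by (simp_all add: seq_closed_algebra_def)

lemma seq_closed_complex_operators: "seq_closed_algebra complex_operators"
  by (auto simp: seq_closed_algebra_def complex_operators_id complex_operators_add
      complex_operators_compose complex_operators_scaleR)

lemma compose_symmetric:
  assumes "symmetric S" "symmetric T" "S o\<^sub>L T = T o\<^sub>L S"
  shows "symmetric (S o\<^sub>L T)"
proof -
  have "S (T x) = T (S x)" for x
    using assms(3) by (metis blinfun_apply_blinfun_compose)
  then show ?thesis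
    using assms by (simp add: symmetric_def)
qed

lemma real_polynomial_function_poly:
  assumes "real_polynomial_function g"
  obtains p where "g = poly p"
proof -
  obtain a n where "g = (\<lambda>x. \<Sum>i\<le>n. a i * x ^ i)"
    using assms real_polynomial_function_iff_sum by auto
  then have "g = poly (\<Sum>i\<le>n. monom (a i) i)"
    by (simp add: poly_sum poly_monom fun_eq_iff)
  then show ?thesis using that by blast
qed

lemma Weierstrass_poly:
  fixes f :: "real \<Rightarrow> real"
  assumes "compact S" "continuous_on S f" "0 < e"
  obtains p where "\<And>t. t \<in> S \<Longrightarrow> \<bar>poly p t - f t\<bar> < e"
  using Stone_Weierstrass_real_polynomial_function[OF assms] real_polynomial_function_poly
  by (metis abs_minus_commute)

text \<open>Weierstrass approximation of continuous ramps with error below \<open>1 / Suc n\<close>.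
  The uniform bound 2 is the height 1 of the ramp plus that error, and it is what dominated
  convergence needs.\<close>

lemma half_line_polys:
  fixes a :: real
  obtains P where "\<And>n t. t \<in> {0..1} \<Longrightarrow> \<bar>poly (P n) t\<bar> \<le> 2"
    and "\<And>t. t \<in> {0..1} \<Longrightarrow> (\<lambda>n. poly (P n) t) \<longlonglongrightarrow> indicator {..a} t"
proof -
  \<comment> \<open>For \<open>n > 0\<close>, a ramp that is 1 up to \<open>a\<close> and 0 from
    \<open>a + 1/n\<close> on.\<close>
  define f where "f n t = max 0 (min 1 (1 - real n * (t - a)))" for n and t :: real
  have "\<exists>p. \<forall>t\<in>{0..1}. \<bar>poly p t - f n t\<bar> < inverse (real (Suc n))" for n
  proof -
    have "continuous_on {0..1} (f n)"
      unfolding f_def by (intro continuous_intros)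
    then obtain p where "\<And>t. t \<in> {0..1} \<Longrightarrow> \<bar>poly p t - f n t\<bar> < inverse (real (Suc n))"
      using Weierstrass_poly[of "{0..1}" "f n" "inverse (real (Suc n))"] by auto
    then show ?thesis by blast
  qed
  then obtain P where P: "\<bar>poly (P n) t - f n t\<bar> < inverse (real (Suc n))" if "t \<in> {0..1}" for n t
    by metis
  have f01: "0 \<le> f n t" "f n t \<le> 1" for n t
    by (auto simp: f_def)
  have "\<bar>poly (P n) t\<bar> \<le> 2" if "t \<in> {0..1}" for n t
  proof -
    have "inverse (real (Suc n)) \<le> 1" by (simp add: field_simps)
    then show ?thesis using P[OF that, of n] f01[of n t] by linarith
  qed
  moreover have "(\<lambda>n. poly (P n) t) \<longlonglongrightarrow> indicator {..a} t" if "t \<in> {0..1}" for t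
  proof -
    have "(\<lambda>n. poly (P n) t - f n t) \<longlonglongrightarrow> 0"
      by (rule Lim_null_comparison[OF _ LIMSEQ_inverse_real_of_nat])
         (use P[OF that] in \<open>auto intro!: always_eventually less_imp_le\<close>)
    moreover have "(\<lambda>n. f n t) \<longlonglongrightarrow> indicator {..a} t"
    proof (cases "t \<le> a")
      case True
      then have "f n t = 1" for n
        by (auto simp: f_def min_def max_def mult_nonneg_nonpos)
      then show ?thesis using True by simp
    next
      case False
      then obtain N where N: "1 < real N * (t - a)"
        using ex_less_of_nat_mult[of "t - a" 1] by auto
      have "f n t = 0" if "N \<le> n" for n
      proof -
        have "real N * (t - a) \<le> real n * (t - a)"
          using that False by (intro mult_right_mono) auto
        then show ?thesis using N by (auto simp: f_def)
      qed
      then have "(\<lambda>n. f n t) \<longlonglongrightarrow> 0"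
        by (intro tendsto_eventually) (auto simp: eventually_sequentially)
      then show ?thesis using False by simp
    qed
    ultimately show ?thesis
      using tendsto_add[of "\<lambda>n. poly (P n) t - f n t" 0 sequentially "\<lambda>n. f n t"] by simp
  qed
  ultimately show ?thesis using that by blast
qed

lemma poly_measurable [measurable]: "poly p \<in> borel_measurable borel" for p :: "real poly"
  by (intro borel_measurable_continuous_onI continuous_intros)

text \<open>Dynkin's argument for the intersection stable family of rational half lines. Rational
  end points keep the generating family countable, so that later countably many operators determine
  all values of a POVM.\<close>

lemma borel_induct [consumes 1, case_names empty half_line compl union]:
  assumes "D \<in> sets (borel :: real measure)" and "Q {}" and "\<And>q. Q {..real_of_rat q}"
    and "\<And>D. D \<in> sets borel \<Longrightarrow> Q D \<Longrightarrow> Q (- D)"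
    and "\<And>D :: nat \<Rightarrow> real set. range D \<subseteq> sets borel \<Longrightarrow> disjoint_family D \<Longrightarrow> (\<And>i. Q (D i)) \<Longrightarrow> Q (\<Union>i. D i)"
  shows "Q D"
proof -
  let ?G = "range (\<lambda>q. {..real_of_rat q})"
  have "(borel :: real measure) = sigma UNIV ?G"
  proof (rule borel_eq_sigmaI1[OF borel_eq_atMost])
    fix X :: "real set" assume "X \<in> range (\<lambda>a. {..a})"
    then obtain a where X: "X = {..a}" by auto
    have "{..a} = (\<Inter>q\<in>{q. a \<le> real_of_rat q}. {..real_of_rat q})"
    proof (intro equalityI subsetI)
      fix t assume t: "t \<in> (\<Inter>q\<in>{q. a \<le> real_of_rat q}. {..real_of_rat q})"
      show "t \<in> {..a}"
      proof (rule ccontr)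
        assume "t \<notin> {..a}"
        then obtain q where "a < real_of_rat q" "real_of_rat q < t"
          using of_rat_dense[of a t] by auto
        moreover have "t \<le> real_of_rat q"
          using t \<open>a < real_of_rat q\<close> by (simp add: less_imp_le)
        ultimately show False by simp
      qed
    qed auto
    moreover have "{q. a \<le> real_of_rat q} \<noteq> {}"
    proof -
      obtain n where "a \<le> real n" using real_arch_simple by blast
      then have "of_nat n \<in> {q. a \<le> real_of_rat q}" by simp
      then show ?thesis by blast
    qed
    moreover have "(\<Inter>q\<in>{q. a \<le> real_of_rat q}. {..real_of_rat q}) \<in> sets (sigma UNIV ?G)"
      if "{q. a \<le> real_of_rat q} \<noteq> {}"
      using that by (intro sets.countable_INT' countableI_type) (auto intro: sigma_sets.Basic)
    ultimately show "X \<in> sets (sigma UNIV ?G)"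
      unfolding X by simp
  qed auto
  then have "sets (borel :: real measure) = sets (sigma UNIV ?G)"
    by (rule arg_cong)
  also have "\<dots> = sigma_sets UNIV ?G"
    by (rule sets_measure_of) simp
  finally have sets: "sets (borel :: real measure) = sigma_sets UNIV ?G" .
  have "{..real_of_rat p} \<inter> {..real_of_rat q} = {..real_of_rat (min p q)}" for p q
    by (auto simp: min_def of_rat_less_eq intro: order_trans)
  then have "Int_stable ?G" "?G \<subseteq> Pow UNIV"
    by (auto simp: Int_stable_def)
  then show ?thesis
    using assms(1) unfolding sets
  proof (induction rule: sigma_sets_induct_disjoint)
    case (compl D)
    then show ?case
      using assms(4)[of D] by (simp add: sets Compl_eq_Diff_UNIV)
  next
    case (union D)
    then show ?case
      using assms(5)[of D] by (simp add: sets)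
  qed (use assms in auto)
qed

section \<open>The spectral measure of an operator between 0 and 1\<close>

locale positive_contraction =
  fixes A :: "'h::complex_hilbert_space \<Rightarrow>\<^sub>L 'h"
  assumes complex: "A \<in> complex_operators" and psd: "psd A"
    and le_one: "inner x (A x) \<le> inner x x"
begin

lemma sym: "symmetric A"
  using psd by (simp add: psd_def)

lemma op_poly_complex: "op_poly A p \<in> complex_operators"
  by (intro op_poly_in_algebra seq_closed_imp_norm_closed seq_closed_complex_operators complex)

lemma inner_op_poly: "inner (op_poly A p x) (op_poly A q x) = inner x (op_poly A (p * q) x)"
  by (simp add: op_poly_mult symmetricD[OF symmetric_op_poly[OF sym]])

text \<open>The positivity conditions of the moment problem are: a norm square, \<open>A\<close>
  nonnegative, and \<open>A\<close> at most the identity, the last two evaluated at the vector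
  \<open>op_poly A p x\<close>. Division by \<open>inner x x\<close> normalizes the functional, so
  \<open>x = 0\<close> is separate.\<close>

lemma ex_moment_measure:
  "\<exists>m. finite_measure m \<and> sets m = sets borel \<and> (AE t in m. t \<in> {0..1}) \<and>
     (\<forall>p. (\<integral>t. poly p t \<partial>m) = inner x (op_poly A p x))"
proof (cases "x = 0")
  case True
  then show ?thesis
    by (intro exI[of _ "null_measure borel"]) (auto intro!: finite_measureI AE_I[where N=UNIV])
next
  case False
  define c where "c = inner x x"
  have c: "0 < c" using False by (simp add: c_def)
  define L where "L p = inner x (op_poly A p x) / c" for p
  have X: "inner x (op_poly A ([:0, 1:] * (p * p)) x) = inner (op_poly A p x) (A (op_poly A p x))" for p
    using inner_op_poly[of p x "[:0, 1:] * p"] by (simp add: mult_ac op_poly_mult)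
  have Y: "inner x (op_poly A ([:1, -1:] * (p * p)) x) =
     inner (op_poly A p x) (op_poly A p x) - inner (op_poly A p x) (A (op_poly A p x))" for p
  proof -
    have "[:1, -1:] * (p * p) = p * p - [:0, 1:] * (p * p)"
      by simp
    then show ?thesis
      by (simp only: op_poly_diff blinfun.diff_left inner_diff_right X inner_op_poly)
  qed
  obtain M where M: "real_distribution M" "measure M {0..1} = 1" "\<And>p. (\<integral>t. poly p t \<partial>M) = L p"
  proof (rule Hausdorff_moment[of L])
    show "0 \<le> L ([:0, 1:] * (p * p))" for p
      unfolding L_def X using c psd by (simp add: psd_def)
    show "0 \<le> L ([:1, -1:] * (p * p))" for p
      unfolding L_def Y using c le_one by simp
  qed (use c in \<open>auto simp: L_def op_poly_add op_poly_smult blinfun.bilinear_simps inner_add_right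
        add_divide_distrib inner_op_poly[symmetric] c_def[symmetric]\<close>)
  interpret M: real_distribution M by (rule M)
  let ?m = "density M (\<lambda>_. ennreal c)"
  have "AE t in M. t \<in> {0..1}"
    using M.prob_eq_1[of "{0..1}"] M(2) by simp
  moreover have "(\<integral>t. poly p t \<partial>?m) = inner x (op_poly A p x)" for p
  proof -
    have "(\<integral>t. poly p t \<partial>?m) = (\<integral>t. c * poly p t \<partial>M)"
      using c by (subst integral_density) auto
    then show ?thesis using M(3) c by (simp add: L_def)
  qed
  moreover have "finite_measure ?m"
    by (rule finite_measureI) (simp add: emeasure_density M.emeasure_space_1[simplified] nn_integral_cmult)
  ultimately show ?thesis
    by (intro exI[of _ ?m]) (auto simp: AE_density)
qed

definition mu :: "'h \<Rightarrow> real measure" where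
  "mu x = (SOME m. finite_measure m \<and> sets m = sets borel \<and> (AE t in m. t \<in> {0..1}) \<and>
     (\<forall>p. (\<integral>t. poly p t \<partial>m) = inner x (op_poly A p x)))"

lemma mu: "finite_measure (mu x)" "sets (mu x) = sets borel" "AE t in mu x. t \<in> {0..1}"
  "(\<integral>t. poly p t \<partial>mu x) = inner x (op_poly A p x)"
  using someI_ex[OF ex_moment_measure[of x]] unfolding mu_def[symmetric] by blast+

lemma space_mu [simp]: "space (mu x) = UNIV"
  using sets_eq_imp_space_eq[OF mu(2)] by simp

lemma borel_measurable_mu [simp]: "f \<in> borel_measurable (mu x) \<longleftrightarrow> f \<in> borel_measurable borel"
  using measurable_cong_sets[OF mu(2) refl, of x borel] by blast

lemma measure_mu_UNIV: "measure (mu x) UNIV = inner x x"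
proof -
  interpret finite_measure "mu x" by (rule mu)
  show ?thesis using mu(4)[of x 1] by simp
qed

lemma measure_mu_le: "measure (mu x) D \<le> inner x x"
proof -
  interpret finite_measure "mu x" by (rule mu)
  show ?thesis using bounded_measure[of D] by (simp add: measure_mu_UNIV)
qed

text \<open>Applying polynomials in \<open>A\<close> to \<open>x\<close> is an isometry for the L2
  norm of \<open>mu x\<close>; through it, convergence of functions becomes convergence of
  vectors.\<close>

lemma norm_op_poly_square: "(norm (op_poly A p x))\<^sup>2 = (\<integral>t. (poly p t)\<^sup>2 \<partial>mu x)"
  using mu(4)[of x "p * p"] by (simp add: power2_norm_eq_inner inner_op_poly power2_eq_square[of "poly _ _"])

lemma norm_op_poly_le:
  assumes "\<And>t. t \<in> {0..1} \<Longrightarrow> \<bar>poly p t\<bar> \<le> C"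
  shows "norm (op_poly A p x) \<le> C * norm x"
proof (rule power2_le_imp_le)
  interpret finite_measure "mu x" by (rule mu)
  have "(poly p t)\<^sup>2 \<le> C\<^sup>2" if "t \<in> {0..1}" for t
    using assms[OF that] by (metis abs_ge_zero power2_abs power_mono)
  then have "AE t in mu x. (poly p t)\<^sup>2 \<le> C\<^sup>2"
    using mu(3)[of x] by (auto elim: eventually_mono)
  then have "(\<integral>t. (poly p t)\<^sup>2 \<partial>mu x) \<le> (\<integral>t. C\<^sup>2 \<partial>mu x)"
    by (intro integral_mono_AE' ) auto
  then show "(norm (op_poly A p x))\<^sup>2 \<le> (C * norm x)\<^sup>2"
    by (simp add: norm_op_poly_square measure_mu_UNIV power_mult_distrib power2_norm_eq_inner[of x] mult.commute)
  show "0 \<le> C * norm x"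
    using assms[of 0] by (intro mult_nonneg_nonneg) auto
qed

text \<open>Bounded pointwise convergence is convergence in L2 of every finite measure
  \<open>mu x\<close>, so by the isometry the vectors \<open>op_poly A (P n) x\<close> are Cauchy.
  The bound \<open>C\<close> on the polynomials bounds the limit operator as well.\<close>

lemma op_poly_pointwise_limit:
  fixes f :: "real \<Rightarrow> real"
  assumes bound: "\<And>n t. t \<in> {0..1} \<Longrightarrow> \<bar>poly (P n) t\<bar> \<le> C"
    and lim: "\<And>t. t \<in> {0..1} \<Longrightarrow> (\<lambda>n. poly (P n) t) \<longlonglongrightarrow> f t"
    and [measurable]: "f \<in> borel_measurable borel"
  obtains T :: "'h \<Rightarrow>\<^sub>L 'h" where "\<And>x. (\<lambda>n. op_poly A (P n) x) \<longlonglongrightarrow> T x"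
proof -
  have f_bound: "\<bar>f t\<bar> \<le> C" if "t \<in> {0..1}" for t
    by (rule LIMSEQ_le_const2[OF tendsto_rabs[OF lim[OF that]]]) (use bound that in auto)
  have "Cauchy (\<lambda>n. op_poly A (P n) x)" for x
  proof -
    interpret finite_measure "mu x" by (rule mu)
    define d where "d = (\<lambda>n. \<integral>t. (poly (P n) t - f t)\<^sup>2 \<partial>mu x)"
    have sq_le: "(poly (P n) t - f t)\<^sup>2 \<le> (2 * C)\<^sup>2" if "t \<in> {0..1}" for n t
    proof -
      have "\<bar>poly (P n) t - f t\<bar> \<le> 2 * C" using bound[OF that, of n] f_bound[OF that] by linarith
      then show ?thesis by (metis abs_ge_zero power2_abs power_mono)
    qed
    have int: "integrable (mu x) (\<lambda>t. (poly (P n) t - f t)\<^sup>2)" for n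
    proof (rule integrable_const_bound[where B="(2 * C)\<^sup>2"])
      show "AE t in mu x. norm ((poly (P n) t - f t)\<^sup>2) \<le> (2 * C)\<^sup>2"
        using mu(3)[of x] by eventually_elim (use sq_le in \<open>simp del: power_mult_distrib\<close>)
    qed simp
    have "d \<longlonglongrightarrow> (\<integral>t. 0 \<partial>mu x)"
      unfolding d_def
    proof (rule integral_dominated_convergence[where w="\<lambda>_. (2 * C)\<^sup>2"])
      show "AE t in mu x. (\<lambda>n. (poly (P n) t - f t)\<^sup>2) \<longlonglongrightarrow> 0"
        using mu(3)[of x]
      proof eventually_elim
        case (elim t)
        have "(\<lambda>n. (poly (P n) t - f t)\<^sup>2) \<longlonglongrightarrow> (f t - f t)\<^sup>2"
          by (intro tendsto_power tendsto_diff lim[OF elim] tendsto_const)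
        then show ?case by simp
      qed
      show "AE t in mu x. norm ((poly (P n) t - f t)\<^sup>2) \<le> (2 * C)\<^sup>2" for n
        using mu(3)[of x] by eventually_elim (use sq_le in \<open>simp del: power_mult_distrib\<close>)
    qed auto
    then have d: "d \<longlonglongrightarrow> 0" by simp
    have est: "(norm (op_poly A (P n) x - op_poly A (P k) x))\<^sup>2 \<le> 2 * d n + 2 * d k" for n k
    proof -
      have "(norm (op_poly A (P n) x - op_poly A (P k) x))\<^sup>2 = (\<integral>t. (poly (P n) t - poly (P k) t)\<^sup>2 \<partial>mu x)"
        using norm_op_poly_square[of "P n - P k" x] by (simp add: op_poly_diff blinfun.diff_left)
      also have "\<dots> \<le> (\<integral>t. 2 * (poly (P n) t - f t)\<^sup>2 + 2 * (poly (P k) t - f t)\<^sup>2 \<partial>mu x)"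
      proof (rule integral_mono')
        fix t
        have "0 \<le> ((poly (P n) t - f t) + (poly (P k) t - f t))\<^sup>2" by simp
        then show "(poly (P n) t - poly (P k) t)\<^sup>2 \<le> 2 * (poly (P n) t - f t)\<^sup>2 + 2 * (poly (P k) t - f t)\<^sup>2"
          by (simp add: power2_eq_square algebra_simps)
      next
        show "integrable (mu x) (\<lambda>t. 2 * (poly (P n) t - f t)\<^sup>2 + 2 * (poly (P k) t - f t)\<^sup>2)"
          by (intro Bochner_Integration.integrable_add integrable_mult_right int)
      qed simp
      also have "\<dots> = 2 * d n + 2 * d k"
        by (simp add: d_def int)
      finally show ?thesis .
    qed
    show ?thesis
    proof (rule CauchyI)
      fix e :: real assume e: "0 < e"
      then have "\<forall>\<^sub>F n in sequentially. d n < e\<^sup>2 / 4"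
        using d by (intro order_tendstoD) auto
      then obtain N where N: "d n < e\<^sup>2 / 4" if "N \<le> n" for n
        by (auto simp: eventually_sequentially)
      have "norm (op_poly A (P n) x - op_poly A (P k) x) < e" if "N \<le> n" "N \<le> k" for n k
      proof (rule power2_less_imp_less)
        show "(norm (op_poly A (P n) x - op_poly A (P k) x))\<^sup>2 < e\<^sup>2"
          using est[of n k] N[OF that(1)] N[OF that(2)] by linarith
      qed (use e in simp)
      then show "\<exists>M. \<forall>m\<ge>M. \<forall>n\<ge>M. norm (op_poly A (P m) x - op_poly A (P n) x) < e" by blast
    qed
  qed
  then have conv: "(\<lambda>n. op_poly A (P n) x) \<longlonglongrightarrow> lim (\<lambda>n. op_poly A (P n) x)" for x
    by (simp add: Cauchy_convergent_iff convergent_LIMSEQ_iff)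
  define g where "g x = lim (\<lambda>n. op_poly A (P n) x)" for x
  have g: "(\<lambda>n. op_poly A (P n) x) \<longlonglongrightarrow> g x" for x
    using conv by (simp add: g_def)
  have "bounded_linear g"
  proof (rule bounded_linear_intro)
    fix x y r
    show "g (x + y) = g x + g y"
      using LIMSEQ_unique[OF g[of "x + y"]] tendsto_add[OF g[of x] g[of y]] by (simp add: blinfun.add_right)
    show "g (r *\<^sub>R x) = r *\<^sub>R g x"
      using LIMSEQ_unique[OF g[of "r *\<^sub>R x"]] tendsto_scaleR[OF tendsto_const g[of x], of r]
      by (simp add: blinfun.scaleR_right)
    show "norm (g x) \<le> norm x * C"
      by (rule LIMSEQ_le_const2[OF tendsto_norm[OF g[of x]]])
         (use norm_op_poly_le[of _ C] bound in \<open>auto simp: mult.commute\<close>)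
  qed
  then have "blinfun_apply (Blinfun g) x = g x" for x
    by (simp add: bounded_linear_Blinfun_apply)
  then show ?thesis
    using that[of "Blinfun g"] g by simp
qed

text \<open>\<open>T\<close> is the value at \<open>D\<close> of the spectral measure. The quadratic
  form and symmetry make it unique; membership in all algebras around \<open>A\<close> is carried
  along because it yields commutation and later places the projections in the von Neumann
  algebra.\<close>

definition represents :: "real set \<Rightarrow> ('h \<Rightarrow>\<^sub>L 'h) \<Rightarrow> bool" where
  "represents D T \<longleftrightarrow> symmetric T \<and> (\<forall>M. seq_closed_algebra M \<longrightarrow> A \<in> M \<longrightarrow> T \<in> M) \<and>
     (\<forall>x. inner x (T x) = measure (mu x) D)"

text \<open>Dominated convergence for the product of the two symbols, bounded by 2 * 2. Allowing two
  different half lines makes this the source of multiplicativity of the spectral measure.\<close>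

lemma inner_op_poly_limit:
  assumes "\<And>n t. t \<in> {0..1} \<Longrightarrow> \<bar>poly (P n) t\<bar> \<le> 2"
    and "\<And>t. t \<in> {0..1} \<Longrightarrow> (\<lambda>n. poly (P n) t) \<longlonglongrightarrow> indicator {..a} t"
    and "\<And>n t. t \<in> {0..1} \<Longrightarrow> \<bar>poly (Q n) t\<bar> \<le> 2"
    and "\<And>t. t \<in> {0..1} \<Longrightarrow> (\<lambda>n. poly (Q n) t) \<longlonglongrightarrow> indicator {..b} t"
  shows "(\<lambda>n. inner (op_poly A (P n) x) (op_poly A (Q n) x)) \<longlonglongrightarrow> measure (mu x) ({..a} \<inter> {..b})"
proof -
  interpret finite_measure "mu x" by (rule mu)
  have "(\<lambda>n. \<integral>t. poly (P n) t * poly (Q n) t \<partial>mu x) \<longlonglongrightarrow> (\<integral>t. indicator {..a} t * indicator {..b} t \<partial>mu x)"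
  proof (rule integral_dominated_convergence[where w="\<lambda>_. 4"])
    show "AE t in mu x. (\<lambda>n. poly (P n) t * poly (Q n) t) \<longlonglongrightarrow> indicator {..a} t * indicator {..b} t"
      using mu(3)[of x] by eventually_elim (intro tendsto_mult assms)
    show "AE t in mu x. norm (poly (P n) t * poly (Q n) t) \<le> 4" for n
      using mu(3)[of x]
    proof eventually_elim
      case (elim t)
      then show ?case
        using mult_mono[OF assms(1)[OF elim, of n] assms(3)[OF elim, of n]] by (simp add: abs_mult)
    qed
  qed auto
  moreover have "(\<integral>t. indicator {..a} t * indicator {..b} t \<partial>mu x) = measure (mu x) ({..a} \<inter> {..b})"
    by (subst indicator_inter_arith[symmetric]) (simp add: mu(2))
  ultimately show ?thesis
    using mu(4)[of x "P _ * Q _"] by (simp add: inner_op_poly)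
qed

lemma ex_half_line_operator:
  obtains P T where "\<And>n t. t \<in> {0..1} \<Longrightarrow> \<bar>poly (P n) t\<bar> \<le> 2"
    and "\<And>t. t \<in> {0..1} \<Longrightarrow> (\<lambda>n. poly (P n) t) \<longlonglongrightarrow> indicator {..a} t"
    and "\<And>x. (\<lambda>n. op_poly A (P n) x) \<longlonglongrightarrow> blinfun_apply T x" and "represents {..a} T"
proof -
  obtain P where P: "\<And>n t. t \<in> {0..1} \<Longrightarrow> \<bar>poly (P n) t\<bar> \<le> 2"
    "\<And>t. t \<in> {0..1} \<Longrightarrow> (\<lambda>n. poly (P n) t) \<longlonglongrightarrow> indicator {..a} t"
    using half_line_polys[of a] by blast
  obtain T where T: "(\<lambda>n. op_poly A (P n) x) \<longlonglongrightarrow> blinfun_apply T x" for x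
    using op_poly_pointwise_limit[OF P] by auto
  have "(\<lambda>n. inner (op_poly A (P n) x) (op_poly A (P n) x)) \<longlonglongrightarrow> inner (T x) (T x)" for x
    by (intro tendsto_intros T)
  then have TT: "inner (T x) (T x) = measure (mu x) {..a}" for x
    using LIMSEQ_unique[OF _ inner_op_poly_limit[OF P P]] by simp
  have T_sym: "symmetric T"
    using T by (rule symmetric_pointwise_limit[OF symmetric_op_poly[OF sym]])
  have "inner x (T x) = measure (mu x) {..a}" for x
  proof (rule LIMSEQ_unique)
    show "(\<lambda>n. inner x (op_poly A (P n) x)) \<longlonglongrightarrow> inner x (T x)"
      by (intro tendsto_intros T)
    interpret finite_measure "mu x" by (rule mu)
    have "(\<lambda>n. \<integral>t. poly (P n) t \<partial>mu x) \<longlonglongrightarrow> (\<integral>t. indicator {..a} t \<partial>mu x)"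
    proof (rule integral_dominated_convergence[where w="\<lambda>_. 2"])
      show "AE t in mu x. (\<lambda>n. poly (P n) t) \<longlonglongrightarrow> indicator {..a} t"
        using mu(3)[of x] by eventually_elim (intro P)
      show "AE t in mu x. norm (poly (P n) t) \<le> 2" for n
        using mu(3)[of x] by eventually_elim (use P in auto)
    qed auto
    then show "(\<lambda>n. inner x (op_poly A (P n) x)) \<longlonglongrightarrow> measure (mu x) {..a}"
      by (simp add: mu(2,4))
  qed
  moreover have "T \<in> M" if "seq_closed_algebra M" "A \<in> M" for M
    using seq_closed_algebra_pointwise_limit[OF that(1) _ T]
      op_poly_in_algebra[OF seq_closed_imp_norm_closed] that by blast
  ultimately show ?thesis
    using that P T T_sym unfolding represents_def by blast
qed

lemma represents_in_algebra: "represents D T \<Longrightarrow> seq_closed_algebra M \<Longrightarrow> A \<in> M \<Longrightarrow> T \<in> M"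
  by (simp add: represents_def)

lemma represents_unique: "represents D S \<Longrightarrow> represents D T \<Longrightarrow> S = T"
  unfolding represents_def using symmetric_eqI[of S T] by auto

text \<open>A double commutant argument: \<open>T\<close> commutes with \<open>A\<close>, so
  \<open>A\<close> lies in the commutant of \<open>T\<close>; being an algebra of the required kind,
  this commutant contains \<open>S\<close> too.\<close>

lemma represents_commute:
  assumes "represents C S" "represents D T"
  shows "S o\<^sub>L T = T o\<^sub>L S"
proof -
  have "T \<in> {T \<in> complex_operators. T o\<^sub>L A = A o\<^sub>L T}"
    using assms(2) commutant_seq_closed[OF sym] complex unfolding represents_def by blast
  then have "A \<in> {S \<in> complex_operators. S o\<^sub>L T = T o\<^sub>L S}"
    using complex by simp
  then have "S \<in> {S \<in> complex_operators. S o\<^sub>L T = T o\<^sub>L S}"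
    using assms commutant_seq_closed[of T] unfolding represents_def by blast
  then show ?thesis by simp
qed

lemma represents_compl:
  assumes "represents D T" "D \<in> sets borel"
  shows "represents (- D) (id_blinfun - T)"
  unfolding represents_def
proof (intro conjI allI impI)
  show "symmetric (id_blinfun - T)"
    using assms by (simp add: represents_def symmetric_diff symmetric_id)
  show "id_blinfun - T \<in> M" if "seq_closed_algebra M" "A \<in> M" for M
  proof -
    have "T \<in> M" using assms that by (simp add: represents_def)
    then have "id_blinfun + (-1) *\<^sub>R T \<in> M"
      using that by (intro seq_closed_algebraD)
    then show ?thesis by simp
  qed
  show "inner x ((id_blinfun - T) x) = measure (mu x) (- D)" for x
  proof -
    interpret finite_measure "mu x" by (rule mu)
    have "measure (mu x) (UNIV - D) = inner x x - measure (mu x) D"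
      using finite_measure_compl[of D] assms by (simp add: mu(2) measure_mu_UNIV)
    then show ?thesis
      using assms by (simp add: represents_def blinfun.diff_left inner_diff Compl_eq_Diff_UNIV)
  qed
qed

text \<open>The partial sums increase and stay below the identity, so
  \<open>psd_norm_square_le\<close> with constant 1 bounds the squared distance of two of them at
  \<open>x\<close> by a block of a convergent series. No orthogonality of the \<open>T i\<close>
  enters; multiplicativity is proved only afterwards.\<close>

lemma represents_Union:
  assumes rep: "\<And>i. represents (D i) (T i)" and D: "range D \<subseteq> sets borel" "disjoint_family D"
  obtains S where "represents (\<Union>i. D i) S" "\<And>x. (\<lambda>n. \<Sum>i<n. T i x) \<longlonglongrightarrow> blinfun_apply S x"
proof -
  define R where "R n = (\<Sum>i<n. T i)" for n
  have R_sym: "symmetric (R n)" for n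
    unfolding R_def using rep by (intro symmetric_sum) (auto simp: represents_def)
  have quad: "inner x (R n x) = (\<Sum>i<n. measure (mu x) (D i))" for n x
    using rep by (simp add: R_def blinfun.sum_left inner_sum_right represents_def)
  have quad_le: "(\<Sum>i\<in>I. measure (mu x) (D i)) \<le> inner x x" if "finite I" for I x
  proof -
    interpret finite_measure "mu x" by (rule mu)
    have "(\<Sum>i\<in>I. measure (mu x) (D i)) = measure (mu x) (\<Union>i\<in>I. D i)"
      using D that by (intro finite_measure_finite_Union[symmetric])
        (auto simp: mu(2) disjoint_family_on_def)
    then show ?thesis using measure_mu_le by simp
  qed
  have sums: "(\<lambda>n. \<Sum>i<n. measure (mu x) (D i)) \<longlonglongrightarrow> measure (mu x) (\<Union>i. D i)" for x
  proof -
    interpret finite_measure "mu x" by (rule mu)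
    show ?thesis
      using finite_measure_UNION[of D] D by (simp add: mu(2) sums_def)
  qed
  have est: "(norm (R m x - R n x))\<^sup>2 \<le> (\<Sum>i<m. measure (mu x) (D i)) - (\<Sum>i<n. measure (mu x) (D i))"
    if "n \<le> m" for m n x
  proof -
    have q: "inner y ((R m - R n) y) = (\<Sum>i\<in>{n..<m}. measure (mu y) (D i))" for y
      using sum_diff_nat_ivl[of 0 n m "\<lambda>i. measure (mu y) (D i)"] that
      by (simp add: blinfun.diff_left inner_diff quad atLeast0LessThan)
    have "psd (R m - R n)"
      unfolding psd_def using R_sym by (auto simp: q symmetric_diff intro!: sum_nonneg)
    moreover have "inner y ((R m - R n) y) \<le> 1 * (norm y)\<^sup>2" for y
      unfolding q using quad_le[of "{n..<m}" y] by (simp add: power2_norm_eq_inner)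
    ultimately have "(norm ((R m - R n) x))\<^sup>2 \<le> 1 * inner x ((R m - R n) x)"
      by (rule psd_norm_square_le)
    then show ?thesis
      by (simp add: blinfun.diff_left inner_diff quad)
  qed
  have "Cauchy (\<lambda>n. R n x)" for x
  proof (rule CauchyI)
    fix e :: real assume e: "0 < e"
    have "Cauchy (\<lambda>n. \<Sum>i<n. measure (mu x) (D i))"
      using sums[of x] by (rule LIMSEQ_imp_Cauchy)
    then obtain N where N: "\<And>m n. N \<le> m \<Longrightarrow> N \<le> n \<Longrightarrow>
        norm ((\<Sum>i<m. measure (mu x) (D i)) - (\<Sum>i<n. measure (mu x) (D i))) < e\<^sup>2"
      using e CauchyD[of "\<lambda>n. \<Sum>i<n. measure (mu x) (D i)" "e\<^sup>2"] by auto
    have *: "norm (R m x - R n x) < e" if "N \<le> n" "n \<le> m" for m n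
    proof (rule power2_less_imp_less)
      have "N \<le> m" using that by simp
      then show "(norm (R m x - R n x))\<^sup>2 < e\<^sup>2"
        using est[OF that(2), of x] N[of m n] that(1) unfolding real_norm_def by linarith
    qed (use e in simp)
    have "norm (R m x - R n x) < e" if "N \<le> n" "N \<le> m" for m n
      using *[of n m] *[of m n] that by (metis nle_le norm_minus_commute)
    then show "\<exists>M. \<forall>m\<ge>M. \<forall>n\<ge>M. norm (R m x - R n x) < e" by blast
  qed
  define g where "g x = lim (\<lambda>n. R n x)" for x
  have g: "(\<lambda>n. R n x) \<longlonglongrightarrow> g x" for x
    using \<open>Cauchy (\<lambda>n. R n x)\<close> by (simp add: g_def Cauchy_convergent_iff convergent_LIMSEQ_iff)
  have "bounded_linear g"
  proof (rule bounded_linear_intro)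
    fix x y r
    show "g (x + y) = g x + g y"
      using LIMSEQ_unique[OF g[of "x + y"]] tendsto_add[OF g[of x] g[of y]] by (simp add: blinfun.add_right)
    show "g (r *\<^sub>R x) = r *\<^sub>R g x"
      using LIMSEQ_unique[OF g[of "r *\<^sub>R x"]] tendsto_scaleR[OF tendsto_const g[of x], of r]
      by (simp add: blinfun.scaleR_right)
    have "norm (R n x) \<le> norm x" for n
    proof (rule power2_le_imp_le)
      have "R 0 = 0" by (simp add: R_def)
      then show "(norm (R n x))\<^sup>2 \<le> (norm x)\<^sup>2"
        using est[of 0 n x] quad_le[of "{..<n}" x] by (simp add: power2_norm_eq_inner)
    qed simp
    then show "norm (g x) \<le> norm x * 1"
      by (intro LIMSEQ_le_const2[OF tendsto_norm[OF g[of x]]]) auto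
  qed
  then have g_apply: "blinfun_apply (Blinfun g) x = g x" for x
    by (simp add: bounded_linear_Blinfun_apply)
  have lim: "(\<lambda>n. R n x) \<longlonglongrightarrow> Blinfun g x" for x
    using g by (simp add: g_apply)
  have "inner x (Blinfun g x) = measure (mu x) (\<Union>i. D i)" for x
  proof (rule LIMSEQ_unique)
    show "(\<lambda>n. inner x (R n x)) \<longlonglongrightarrow> inner x (Blinfun g x)"
      by (intro tendsto_intros lim)
    show "(\<lambda>n. inner x (R n x)) \<longlonglongrightarrow> measure (mu x) (\<Union>i. D i)"
      unfolding quad by (rule sums)
  qed
  moreover have "Blinfun g \<in> M" if M: "seq_closed_algebra M" "A \<in> M" for M
  proof -
    have T: "T i \<in> M" for i
      by (rule represents_in_algebra[OF rep M])
    have "R n \<in> M" for n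
    proof (induction n)
      case 0
      show ?case
        using seq_closed_algebraD(4)[OF M(1) M(2), of 0] by (simp add: R_def)
    next
      case (Suc n)
      then show ?case
        using seq_closed_algebraD(2)[OF M(1) _ T[of n]] by (simp add: R_def)
    qed
    then show ?thesis
      using lim by (rule seq_closed_algebra_pointwise_limit[OF M(1)])
  qed
  moreover have "symmetric (Blinfun g)"
    using symmetric_pointwise_limit[OF R_sym lim] .
  ultimately have "represents (\<Union>i. D i) (Blinfun g)"
    unfolding represents_def by blast
  then show ?thesis
    using that[of "Blinfun g"] lim by (simp add: R_def blinfun.sum_left)
qed

end

context positive_contraction
begin

lemma represents_half_line_compose:
  assumes "represents {..a} S" "represents {..b} T"
  shows "represents ({..a} \<inter> {..b}) (S o\<^sub>L T)"
proof -
  obtain P S' where P: "\<And>n t. t \<in> {0..1} \<Longrightarrow> \<bar>poly (P n) t\<bar> \<le> 2"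
    "\<And>t. t \<in> {0..1} \<Longrightarrow> (\<lambda>n. poly (P n) t) \<longlonglongrightarrow> indicator {..a} t"
    and S': "\<And>x. (\<lambda>n. op_poly A (P n) x) \<longlonglongrightarrow> blinfun_apply S' x" "represents {..a} S'"
    using ex_half_line_operator[of a] by blast
  obtain Q T' where Q: "\<And>n t. t \<in> {0..1} \<Longrightarrow> \<bar>poly (Q n) t\<bar> \<le> 2"
    "\<And>t. t \<in> {0..1} \<Longrightarrow> (\<lambda>n. poly (Q n) t) \<longlonglongrightarrow> indicator {..b} t"
    and T': "\<And>x. (\<lambda>n. op_poly A (Q n) x) \<longlonglongrightarrow> blinfun_apply T' x" "represents {..b} T'"
    using ex_half_line_operator[of b] by blast
  have eq: "S' = S" "T' = T"
    using represents_unique assms S' T' by blast+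
  have S: "symmetric S" and T: "symmetric T"
    using assms by (auto simp: represents_def)
  have "inner x (S (T x)) = measure (mu x) ({..a} \<inter> {..b})" for x
  proof (rule LIMSEQ_unique)
    have "(\<lambda>n. inner (op_poly A (P n) x) (op_poly A (Q n) x)) \<longlonglongrightarrow> inner (S x) (T x)"
      using S'(1) T'(1) unfolding eq by (intro tendsto_inner) auto
    then show "(\<lambda>n. inner (op_poly A (P n) x) (op_poly A (Q n) x)) \<longlonglongrightarrow> inner x (S (T x))"
      by (simp add: symmetricD[OF S])
    show "(\<lambda>n. inner (op_poly A (P n) x) (op_poly A (Q n) x)) \<longlonglongrightarrow> measure (mu x) ({..a} \<inter> {..b})"
      by (rule inner_op_poly_limit[OF P Q])
  qed
  then show ?thesis
    using compose_symmetric[OF S T represents_commute[OF assms]] represents_in_algebra[OF assms(1)]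
      represents_in_algebra[OF assms(2)]
    unfolding represents_def by (auto intro!: seq_closed_algebraD(3))
qed

lemma represents_empty: "represents {} 0"
  unfolding represents_def using seq_closed_algebraD(4)[of _ A 0] by (simp add: symmetric_zero)

lemma ex_represents:
  assumes "D \<in> sets borel"
  shows "\<exists>T. represents D T"
  using assms
proof (induction rule: borel_induct)
  case empty
  then show ?case using represents_empty by blast
next
  case (half_line q)
  obtain T where "represents {..real_of_rat q} T"
    by (rule ex_half_line_operator)
  then show ?case by blast
next
  case (compl D)
  then show ?case using represents_compl by blast
next
  case (union D)
  then obtain T where "\<And>i. represents (D i) (T i)" by metis
  then show ?case using represents_Union union by metis
qed

definition spec :: "real set \<Rightarrow> 'h \<Rightarrow>\<^sub>L 'h" where
  "spec D = (SOME T. represents D T)"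

lemma represents_spec: "D \<in> sets borel \<Longrightarrow> represents D (spec D)"
  unfolding spec_def by (rule someI_ex[OF ex_represents])

lemma spec_eqI: "D \<in> sets borel \<Longrightarrow> represents D T \<Longrightarrow> spec D = T"
  using represents_spec represents_unique by blast

lemma spec_compl: "D \<in> sets borel \<Longrightarrow> spec (- D) = id_blinfun - spec D"
  by (intro spec_eqI represents_compl represents_spec) auto

lemma spec_sums:
  assumes "range D \<subseteq> sets borel" "disjoint_family D"
  shows "(\<lambda>n. \<Sum>i<n. spec (D i) x) \<longlonglongrightarrow> spec (\<Union>i. D i) x"
proof -
  have D: "D i \<in> sets borel" for i :: nat using assms by auto
  obtain S where S: "represents (\<Union>i. D i) S" "\<And>x. (\<lambda>n. \<Sum>i<n. spec (D i) x) \<longlonglongrightarrow> blinfun_apply S x"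
    using represents_Union[OF represents_spec[OF D] assms] by blast
  have "(\<Union>i. D i) \<in> sets borel" using D by auto
  then have "spec (\<Union>i. D i) = S" using S(1) by (intro spec_eqI)
  then show ?thesis using S(2) by simp
qed

lemma spec_add:
  assumes "C \<in> sets borel" "D \<in> sets borel" "C \<inter> D = {}"
  shows "spec (C \<union> D) = spec C + spec D"
proof (rule symmetric_eqI)
  have "C \<union> D \<in> sets borel" using assms by auto
  note r = represents_spec[OF this] represents_spec[OF assms(1)] represents_spec[OF assms(2)]
  show "symmetric (spec (C \<union> D))" "symmetric (spec C + spec D)"
    using r by (auto simp: represents_def symmetric_add)
  fix x
  interpret finite_measure "mu x" by (rule mu)
  show "inner x (spec (C \<union> D) x) = inner x ((spec C + spec D) x)"
    using r finite_measure_Union[of C D] assms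
    by (simp add: represents_def blinfun.add_left inner_add_right mu(2))
qed

text \<open>For fixed \<open>B\<close>, the sets \<open>D\<close> on which multiplicativity holds
  form a Dynkin system, so half lines decide.\<close>

lemma spec_compose_induct:
  assumes B: "B \<in> sets borel" and half: "\<And>a. spec {..a} o\<^sub>L spec B = spec ({..a} \<inter> B)"
    and D: "D \<in> sets borel"
  shows "spec D o\<^sub>L spec B = spec (D \<inter> B)"
  using D
proof (induction rule: borel_induct)
  case empty
  have "spec {} = 0" by (intro spec_eqI represents_empty) auto
  then show ?case by simp
next
  case (half_line a)
  then show ?case by (rule half)
next
  case (compl D)
  have "spec (D \<inter> B \<union> - D \<inter> B) = spec (D \<inter> B) + spec (- D \<inter> B)"
    using compl B by (intro spec_add) auto
  moreover have "D \<inter> B \<union> - D \<inter> B = B" by auto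
  ultimately show ?case
    using compl
    by (simp add: spec_compl bounded_bilinear.diff_left[OF bounded_bilinear_blinfun_compose] algebra_simps)
next
  case (union D)
  have "spec (\<Union>i. D i) (spec B x) = spec ((\<Union>i. D i) \<inter> B) x" for x
  proof (rule LIMSEQ_unique)
    show "(\<lambda>n. \<Sum>i<n. spec (D i) (spec B x)) \<longlonglongrightarrow> spec (\<Union>i. D i) (spec B x)"
      by (rule spec_sums[OF union(1,2)])
    have "(\<lambda>n. \<Sum>i<n. spec (D i \<inter> B) x) \<longlonglongrightarrow> spec (\<Union>i. D i \<inter> B) x"
      using union(1,2) B by (intro spec_sums) (auto simp: disjoint_family_on_def)
    moreover have "spec (D i) (spec B x) = spec (D i \<inter> B) x" for i
      using union(3)[of i] by (metis blinfun_apply_blinfun_compose)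
    ultimately show "(\<lambda>n. \<Sum>i<n. spec (D i) (spec B x)) \<longlonglongrightarrow> spec ((\<Union>i. D i) \<inter> B) x"
      by (simp add: Int_UN_distrib2)
  qed
  then show ?case by (auto intro: blinfun_eqI)
qed

lemma spec_commute: "C \<in> sets borel \<Longrightarrow> D \<in> sets borel \<Longrightarrow> spec C o\<^sub>L spec D = spec D o\<^sub>L spec C"
  using represents_commute represents_spec by blast

lemma spec_compose:
  assumes "C \<in> sets borel" "D \<in> sets borel"
  shows "spec C o\<^sub>L spec D = spec (C \<inter> D)"
proof -
  have half2: "spec {..a} o\<^sub>L spec {..b} = spec ({..a} \<inter> {..b})" for a b
    by (intro spec_eqI[symmetric] represents_half_line_compose represents_spec) auto
  \<comment> \<open>The induction runs twice: here it extends one factor beyond half lines; after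
    exchanging the factors by commutation it extends the other.\<close>
  have "spec B o\<^sub>L spec {..b} = spec (B \<inter> {..b})" if "B \<in> sets borel" for B b
    using spec_compose_induct[OF _ half2 that] by simp
  then have "spec {..a} o\<^sub>L spec B = spec ({..a} \<inter> B)" if "B \<in> sets borel" for a B
    using that spec_commute[of "{..a}" B] by (simp add: Int_commute)
  then show ?thesis
    using assms spec_compose_induct by blast
qed

lemma spec_complex: "D \<in> sets borel \<Longrightarrow> spec D \<in> complex_operators"
  using represents_in_algebra[OF represents_spec seq_closed_complex_operators complex] .

lemma psd_spec: "D \<in> sets borel \<Longrightarrow> psd (spec D)"
  using represents_spec[of D] by (simp add: psd_def represents_def)

lemma povm_spec: "povm spec"
  unfolding povm_def
proof (intro conjI ballI allI impI)
  show "positive_operator (spec D)" if "D \<in> sets borel" for D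
    using that by (simp add: positive_operator_iff spec_complex psd_spec)
  fix D :: "nat \<Rightarrow> real set" assume D: "range D \<subseteq> sets borel" "disjoint_family D"
  show "limitin weak_operator_topology (\<lambda>n. \<Sum>i<n. spec (D i)) (spec (\<Union>i. D i)) sequentially"
  proof (rule limitin_weak_operator_topologyI)
    have sp: "spec (D i) \<in> complex_operators" for i using D by (intro spec_complex) auto
    show "(\<Sum>i<n. spec (D i)) \<in> complex_operators" for n
      by (induction n) (auto simp: complex_operators_zero intro!: complex_operators_add sp)
    show "spec (\<Union>i. D i) \<in> complex_operators"
      using D by (intro spec_complex) auto
    show "(\<lambda>n. inner x ((\<Sum>i<n. spec (D i)) y)) \<longlonglongrightarrow> inner x (spec (\<Union>i. D i) y)" for x y
      unfolding blinfun.sum_left by (intro tendsto_inner tendsto_const spec_sums D)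
  qed
qed

lemma diagonal_measure_spec: "diagonal_measure spec x = mu x"
proof (rule measure_eqI)
  show "sets (diagonal_measure spec x) = sets (mu x)" by (simp add: mu(2))
  fix D assume "D \<in> sets (diagonal_measure spec x)"
  then have D: "D \<in> sets borel" by simp
  interpret finite_measure "mu x" by (rule mu)
  show "emeasure (diagonal_measure spec x) D = emeasure (mu x) D"
    using represents_spec[OF D]
    by (simp add: emeasure_diagonal_measure[OF povm_spec D] represents_def inner_eq_Re_cinner[symmetric]
        emeasure_eq_measure)
qed

lemma spec_UNIV: "spec UNIV = id_blinfun"
proof (rule symmetric_eqI)
  show "inner x (spec UNIV x) = inner x (id_blinfun x)" for x
    using represents_spec[of UNIV] by (simp add: represents_def measure_mu_UNIV)
qed (use represents_spec[of UNIV] in \<open>auto simp: represents_def symmetric_id\<close>)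

lemma spectral_measure_spec: "spectral_measure A spec"
  unfolding spectral_measure_def
proof (intro conjI ballI povm_spec)
  show "normalized spec" by (simp add: normalized_def spec_UNIV)
  show "spec D o\<^sub>L spec D = spec D" if "D \<in> sets borel" for D
    using spec_compose[OF that that] by simp
  show "has_operator_integral spec UNIV (\<lambda>t. t) A"
    unfolding has_operator_integral_def diagonal_measure_spec
  proof (intro conjI complex allI)
    fix x
    interpret finite_measure "mu x" by (rule mu)
    show "set_integrable (mu x) UNIV (\<lambda>t. t)"
      unfolding set_integrable_def
      by (rule integrable_const_bound[where B=1]) (use mu(3)[of x] in \<open>auto elim: eventually_mono\<close>)
    show "cinner x (A x) = complex_of_real (LINT t:UNIV|mu x. t)"
      using mu(4)[of x "[:0, 1:]"] by (simp add: set_lebesgue_integral_def cinner_symmetric complex sym)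
  qed
qed

end

theorem spectral_theorem:
  assumes "A \<in> complex_operators" "psd A" "\<And>x. inner x (A x) \<le> inner x x"
  obtains E where "spectral_measure A E"
    and "\<And>D M. D \<in> sets borel \<Longrightarrow> seq_closed_algebra M \<Longrightarrow> A \<in> M \<Longrightarrow> E D \<in> M"
    and "\<And>x. AE t in diagonal_measure E x. t \<in> {0..1}"
    and "\<And>x p. (\<integral>t. poly p t \<partial>diagonal_measure E x) = inner x (op_poly A p x)"
proof -
  interpret positive_contraction A
    by standard (use assms in auto)
  show ?thesis
    using that[OF spectral_measure_spec] represents_in_algebra[OF represents_spec] mu(3,4)
    unfolding diagonal_measure_spec by blast
qed

section \<open>Continuous functions of an operator\<close>

lemma povm_complex: "povm E \<Longrightarrow> D \<in> sets borel \<Longrightarrow> E D \<in> complex_operators"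
  by (simp add: povm_def positive_operator_iff)

lemma povm_psd: "povm E \<Longrightarrow> D \<in> sets borel \<Longrightarrow> psd (E D)"
  by (simp add: povm_def positive_operator_iff)

lemma povm_symmetric: "povm E \<Longrightarrow> D \<in> sets borel \<Longrightarrow> symmetric (E D)"
  using povm_psd by (auto simp: psd_def)

lemma finite_diagonal_measure:
  assumes "povm E"
  shows "finite_measure (diagonal_measure E x)"
  by (rule finite_measureI) (simp add: emeasure_diagonal_measure assms)

lemma measure_diagonal_measure:
  assumes "povm E" "D \<in> sets borel"
  shows "measure (diagonal_measure E x) D = inner x (E D x)"
  using povm_psd[OF assms]
  by (simp add: measure_def emeasure_diagonal_measure assms inner_eq_Re_cinner[symmetric] psd_def)

lemma normalized_povm_le_one:
  assumes "povm E" "normalized E" "D \<in> sets borel"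
  shows "inner x (E D x) \<le> inner x x"
proof -
  interpret finite_measure "diagonal_measure E x"
    by (rule finite_diagonal_measure[OF assms(1)])
  show ?thesis
    using bounded_measure[of D] assms
    by (simp add: measure_diagonal_measure[symmetric]) (simp add: measure_diagonal_measure normalized_def)
qed

lemma borel_measurable_diagonal_measure [simp]:
  "f \<in> borel_measurable (diagonal_measure E x) \<longleftrightarrow> f \<in> borel_measurable borel"
  using measurable_cong_sets[OF sets_diagonal_measure refl, of E x borel] by blast

lemma has_operator_integral_iff:
  assumes "T \<in> complex_operators" "symmetric T"
  shows "has_operator_integral E S f T \<longleftrightarrow>
    (\<forall>x. set_integrable (diagonal_measure E x) S f \<and> inner x (T x) = (LINT t:S|diagonal_measure E x. f t))"
  using assms by (simp add: has_operator_integral_def cinner_symmetric)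

lemma has_operator_integralD:
  assumes "has_operator_integral E S f T"
  shows "set_integrable (diagonal_measure E x) S f" "inner x (T x) = (LINT t:S|diagonal_measure E x. f t)"
  using assms by (auto simp: has_operator_integral_def inner_eq_Re_cinner)

lemma scaleC_diff_right: "c *\<^sub>C (x - y) = c *\<^sub>C x - c *\<^sub>C y"
  using scaleC_add_right[of c "x - y" y] by simp

lemma cinner_diff_right: "cinner x (y - z) = cinner x y - cinner x z"
  using cinner_add_right[of x "y - z" z] by simp

lemma has_operator_integral_diff:
  assumes "has_operator_integral E S f T" "has_operator_integral E S g U"
  shows "has_operator_integral E S (\<lambda>t. f t - g t) (T - U)"
  using assms complex_operators_diff
  by (auto simp: has_operator_integral_def set_integral_diff blinfun.diff_left cinner_diff_right)

lemma closure_range_op_poly: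
  "T \<in> closure (range (op_poly A)) \<longleftrightarrow> (\<exists>p. (\<lambda>n. op_poly A (p n)) \<longlonglongrightarrow> T)"
proof
  assume "T \<in> closure (range (op_poly A))"
  then obtain S where S: "\<forall>n. S n \<in> range (op_poly A)" "S \<longlonglongrightarrow> T"
    using closure_sequential by blast
  define q where "q n = (SOME q. S n = op_poly A q)" for n
  have "S n = op_poly A (q n)" for n
    unfolding q_def by (rule someI_ex) (use S(1) in auto)
  then have "S = (\<lambda>n. op_poly A (q n))" by blast
  with S(2) show "\<exists>p. (\<lambda>n. op_poly A (p n)) \<longlonglongrightarrow> T"
    by (intro exI[of _ q]) simp
next
  assume "\<exists>p. (\<lambda>n. op_poly A (p n)) \<longlonglongrightarrow> T"
  then obtain p where "(\<lambda>n. op_poly A (p n)) \<longlonglongrightarrow> T" by blast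
  then show "T \<in> closure (range (op_poly A))"
    unfolding closure_sequential by (intro exI[of _ "\<lambda>n. op_poly A (p n)"]) auto
qed

section \<open>The support of the spectral measure and symbols on it\<close>

locale spectral_calculus =
  fixes A :: "'h::complex_hilbert_space \<Rightarrow>\<^sub>L 'h" and E
  assumes complex: "A \<in> complex_operators" and sym: "symmetric A"
    and spectral: "spectral_measure A E"
    and AE_01: "AE t in diagonal_measure E x. t \<in> {0..1}"
    and integral_poly: "(\<integral>t. poly p t \<partial>diagonal_measure E x) = inner x (op_poly A p x)"
begin

abbreviation "m \<equiv> diagonal_measure E"

text \<open>The support of \<open>E\<close>. That it is the spectrum is shown in
  \<open>real_spectrum_eq\<close>; until then, only the non-vanishing of \<open>E\<close> near its
  points matters.\<close>

definition K :: "real set" where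
  "K = {t. \<forall>e>0. E (ball t e) \<noteq> 0}"

lemma povm: "povm E" and normalized: "normalized E"
  and idempotent: "D \<in> sets borel \<Longrightarrow> E D o\<^sub>L E D = E D"
  using spectral by (auto simp: spectral_measure_def)

lemma measure_m: "D \<in> sets borel \<Longrightarrow> measure (m x) D = inner x (E D x)"
  by (rule measure_diagonal_measure[OF povm])

lemma measure_m_UNIV: "measure (m x) UNIV = inner x x"
  using normalized by (simp add: measure_m normalized_def)

lemma finite_m: "finite_measure (m x)"
  by (rule finite_diagonal_measure[OF povm])

lemma E_eq_0_iff:
  assumes "D \<in> sets borel"
  shows "E D = 0 \<longleftrightarrow> (\<forall>x. D \<in> null_sets (m x))"
proof
  assume "E D = 0"
  then show "\<forall>x. D \<in> null_sets (m x)"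
    using assms by (simp add: null_sets_def emeasure_diagonal_measure[OF povm])
next
  assume "\<forall>x. D \<in> null_sets (m x)"
  then have "inner x (E D x) = 0" for x
    using measure_m[OF assms, of x] by (simp add: measure_eq_0_null_sets)
  then show "E D = 0"
    using povm_symmetric[OF povm assms] by (intro symmetric_eqI symmetric_zero) auto
qed

lemma not_in_K_iff: "t \<notin> K \<longleftrightarrow> (\<exists>e>0. \<forall>x. ball t e \<in> null_sets (m x))"
  by (auto simp: K_def E_eq_0_iff)

lemma closed_K: "closed K"
proof -
  have "\<exists>e>0. ball t e \<subseteq> - K" if "t \<in> - K" for t
  proof -
    from that obtain e where e: "0 < e" "\<And>x. ball t e \<in> null_sets (m x)"
      using not_in_K_iff by auto
    have "s \<notin> K" if "s \<in> ball t (e / 2)" for s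
    proof -
      have "ball s (e / 2) \<subseteq> ball t e"
        using that by (auto simp: dist_real_def abs_if split: if_splits)
      then have "ball s (e / 2) \<in> null_sets (m x)" for x
        by (intro null_sets_subset[OF e(2)[of x]]) auto
      then show ?thesis using e(1) not_in_K_iff by (meson half_gt_zero)
    qed
    then show ?thesis using e(1) by (intro exI[of _ "e / 2"]) auto
  qed
  then have "open (- K)"
    by (subst open_contains_ball) auto
  then show ?thesis by (simp add: closed_def)
qed

lemma K_borel [measurable, simp]: "K \<in> sets borel"
  using closed_K by (rule borel_closed)

lemma K_subset: "K \<subseteq> {0..1}"
proof (rule ccontr)
  assume "\<not> K \<subseteq> {0..1}"
  then obtain t where t: "t \<in> K" "t \<in> - {0..1}" by blast
  have "open (- {0..1::real})" by (simp add: open_Compl)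
  then obtain e where e: "0 < e" "ball t e \<subseteq> - {0..1}"
    using t(2) open_contains_ball by blast
  have "ball t e \<in> null_sets (m x)" for x
  proof (rule AE_iff_null_sets[THEN iffD2])
    show "AE s in m x. s \<notin> ball t e"
      using AE_01[of x] by eventually_elim (use e in auto)
  qed simp
  then show False using t(1) e(1) not_in_K_iff by blast
qed

lemma compact_K: "compact K"
  using K_subset closed_K compact_Int_closed[of "{0..1}" K] by (simp add: inf.absorb2)

text \<open>The complement of the support is a union of null balls, and by Lindelof countably many
  of them cover it.\<close>

lemma AE_K: "AE t in m x. t \<in> K"
proof -
  define F where "F = {B. \<exists>t e. B = ball t e \<and> 0 < e \<and> (\<forall>x. B \<in> null_sets (m x))}"
  obtain F' where F': "F' \<subseteq> F" "countable F'" "\<Union>F' = \<Union>F"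
    using Lindelof[of F] unfolding F_def by auto
  have "\<Union>F' \<in> null_sets (m x)"
    using F'(1,2) by (intro null_sets_UN'[of F' "\<lambda>B. B", simplified]) (auto simp: F_def)
  moreover have "- K \<subseteq> \<Union>F'"
    unfolding F'(3)
  proof
    fix t assume "t \<in> - K"
    then obtain e where "0 < e" "\<forall>x. ball t e \<in> null_sets (m x)"
      using not_in_K_iff by auto
    then have "ball t e \<in> F" "t \<in> ball t e"
      by (auto simp: F_def)
    then show "t \<in> \<Union>F" by blast
  qed
  ultimately show ?thesis
    by (intro AE_I'[of "\<Union>F'"]) auto
qed

lemma LINT_K: "f \<in> borel_measurable borel \<Longrightarrow> (LINT t:K|m x. f t) = (\<integral>t. f t \<partial>m x)"
  unfolding set_lebesgue_integral_def
  by (rule integral_cong_AE) (use AE_K[of x] in \<open>auto elim!: eventually_mono\<close>)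

lemma set_integrable_K:
  fixes f :: "real \<Rightarrow> real"
  assumes "continuous_on K f"
  shows "set_integrable (m x) K f"
proof -
  interpret finite_measure "m x" by (rule finite_m)
  have borel: "(\<lambda>t. indicator K t *\<^sub>R f t) \<in> borel_measurable borel"
    by (rule borel_measurable_continuous_on_indicator[OF _ assms]) simp
  have "bounded (f ` K)"
    using compact_continuous_image[OF assms compact_K] compact_imp_bounded by blast
  then obtain C where C: "\<And>t. t \<in> K \<Longrightarrow> \<bar>f t\<bar> \<le> C"
    by (auto simp: bounded_iff)
  show ?thesis
    unfolding set_integrable_def
  proof (rule integrable_const_bound[where B="\<bar>C\<bar>"])
    show "AE t in m x. norm (indicator K t *\<^sub>R f t) \<le> \<bar>C\<bar>"
      by (rule AE_I2) (auto simp: indicator_def intro: order_trans[OF C abs_ge_self])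
  qed (use borel in \<open>simp only: borel_measurable_diagonal_measure\<close>)
qed

lemma abs_LINT_K_le:
  assumes "continuous_on K f" "\<And>t. t \<in> K \<Longrightarrow> \<bar>f t\<bar> \<le> C" "0 \<le> C"
  shows "\<bar>LINT t:K|m x. f t\<bar> \<le> C * inner x x"
proof -
  interpret finite_measure "m x" by (rule finite_m)
  have "\<bar>LINT t:K|m x. f t\<bar> \<le> (\<integral>t. C \<partial>m x)"
    unfolding set_lebesgue_integral_def
    using set_integrable_K[OF assms(1), of x] assms(2,3)
    by (intro order_trans[OF integral_abs_bound] integral_mono) (auto simp: set_integrable_def indicator_def)
  then show ?thesis by (simp add: measure_m_UNIV mult.commute)
qed

lemma op_poly_complex: "op_poly A p \<in> complex_operators"
  by (intro op_poly_in_algebra seq_closed_imp_norm_closed seq_closed_complex_operators complex)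

lemma has_operator_integral_poly: "has_operator_integral E K (poly p) (op_poly A p)"
  by (subst has_operator_integral_iff[OF op_poly_complex symmetric_op_poly[OF sym]])
     (auto intro!: set_integrable_K continuous_intros simp: LINT_K integral_poly)

lemma norm_op_poly_square: "(norm (op_poly A p x))\<^sup>2 = (LINT t:K|m x. (poly p t)\<^sup>2)"
proof -
  have "(norm (op_poly A p x))\<^sup>2 = inner x (op_poly A (p * p) x)"
    by (simp add: power2_norm_eq_inner op_poly_mult symmetricD[OF symmetric_op_poly[OF sym]])
  also have "\<dots> = (LINT t:K|m x. (poly p t)\<^sup>2)"
    using has_operator_integralD(2)[OF has_operator_integral_poly, of x "p * p"] by (simp add: power2_eq_square)
  finally show ?thesis .
qed

lemma norm_op_poly_le:
  assumes "\<And>t. t \<in> K \<Longrightarrow> \<bar>poly p t\<bar> \<le> C" "0 \<le> C"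
  shows "norm (op_poly A p) \<le> C"
proof (rule norm_blinfun_bound)
  fix x
  have "\<bar>LINT t:K|m x. (poly p t)\<^sup>2\<bar> \<le> C\<^sup>2 * inner x x"
  proof (rule abs_LINT_K_le)
    show "\<bar>(poly p t)\<^sup>2\<bar> \<le> C\<^sup>2" if "t \<in> K" for t
      using power_mono[OF assms(1)[OF that] abs_ge_zero, of 2] by simp
  qed (auto intro!: continuous_intros)
  then have "(norm (op_poly A p x))\<^sup>2 \<le> (C * norm x)\<^sup>2"
    by (simp add: norm_op_poly_square power_mult_distrib power2_norm_eq_inner[of x])
  then show "norm (op_poly A p x) \<le> C * norm x"
    by (rule power2_le_imp_le) (use assms(2) in simp)
qed (rule assms(2))

text \<open>The points of the support are approximate eigenvalues: a unit vector in the range of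
  \<open>E (ball t e)\<close> has its diagonal measure concentrated on that ball.\<close>

lemma ex_concentrated_vector:
  assumes "t \<in> K" "0 < e"
  shows "\<exists>x. norm x = 1 \<and> (AE s in m x. s \<in> ball t e \<inter> K)"
proof -
  let ?B = "ball t e"
  have "E ?B \<noteq> 0" using assms by (auto simp: K_def)
  then obtain z where z: "E ?B z \<noteq> 0"
    using blinfun_eqI[of "E ?B" 0] by auto
  define x where "x = (1 / norm (E ?B z)) *\<^sub>R E ?B z"
  have nx: "norm x = 1" using z by (simp add: x_def)
  have "E ?B (E ?B z) = E ?B z"
    using idempotent[of ?B] by (metis blinfun_apply_blinfun_compose open_ball borel_open)
  then have Ex: "E ?B x = x" by (simp add: x_def blinfun.scaleR_right)
  interpret finite_measure "m x" by (rule finite_m)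
  have "measure (m x) (space (m x) - ?B) = 0"
    using measure_m[of ?B x] by (subst finite_measure_compl) (auto simp: Ex measure_m_UNIV)
  then have "space (m x) - ?B \<in> null_sets (m x)"
    unfolding null_sets_def by (simp add: emeasure_eq_measure)
  then have "AE s in m x. s \<in> ?B"
    by (rule AE_I') auto
  then show ?thesis
  proof -
    from \<open>AE s in m x. s \<in> ?B\<close> AE_K[of x] have "AE s in m x. s \<in> ?B \<inter> K"
      by eventually_elim simp
    with nx show ?thesis by blast
  qed
qed

text \<open>At a unit vector concentrated near \<open>t\<close>, the quadratic form is an average of
  \<open>f\<close> over a small neighbourhood of \<open>t\<close> in \<open>K\<close>.\<close>

lemma ex_approximate_value:
  assumes f: "continuous_on K f" and T: "has_operator_integral E K f T"
    and t: "t \<in> K" and e: "0 < e"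
  shows "\<exists>x. norm x = 1 \<and> \<bar>inner x (T x) - f t\<bar> \<le> e"
proof -
  obtain d where d: "0 < d" "\<And>s. s \<in> K \<Longrightarrow> dist s t < d \<Longrightarrow> dist (f s) (f t) < e"
    using f t e unfolding continuous_on_iff by meson
  obtain x where x: "norm x = 1" "AE s in m x. s \<in> ball t d \<inter> K"
    using ex_concentrated_vector[OF t d(1)] by blast
  interpret finite_measure "m x" by (rule finite_m)
  have one: "inner x x = 1" using x(1) by (simp add: norm_eq_1)
  have int: "integrable (m x) (\<lambda>s. indicator K s *\<^sub>R f s)"
    using set_integrable_K[OF f] by (simp add: set_integrable_def)
  have "inner x (T x) - f t = (\<integral>s. indicator K s *\<^sub>R f s - f t \<partial>m x)"
    using has_operator_integralD(2)[OF T, of x] int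
    by (simp add: set_lebesgue_integral_def measure_m_UNIV one)
  also have "\<bar>\<dots>\<bar> \<le> (\<integral>s. \<bar>indicator K s *\<^sub>R f s - f t\<bar> \<partial>m x)"
    by (rule integral_abs_bound)
  also have "\<dots> \<le> (\<integral>s. e \<partial>m x)"
  proof (rule integral_mono_AE)
    show "AE s in m x. \<bar>indicator K s *\<^sub>R f s - f t\<bar> \<le> e"
      using x(2) by eventually_elim (use d(2) in \<open>force simp: dist_real_def dist_commute\<close>)
  qed (use int in auto)
  also have "\<dots> = e" by (simp add: measure_m_UNIV one)
  finally show ?thesis using x(1) by blast
qed

text \<open>This half of the isometry of C(K) carries operator norm estimates to each point of
  \<open>K\<close>, with no exceptional null set. It also makes continuous symbols unique.\<close>

lemma symbol_abs_le:
  assumes "continuous_on K f" "has_operator_integral E K f T" "t \<in> K"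
  shows "\<bar>f t\<bar> \<le> norm T"
proof (rule field_le_epsilon)
  fix e :: real assume "0 < e"
  then obtain x where x: "norm x = 1" "\<bar>inner x (T x) - f t\<bar> \<le> e"
    using ex_approximate_value[OF assms \<open>0 < e\<close>] by blast
  have "\<bar>inner x (T x)\<bar> \<le> norm x * norm (T x)" by (rule Cauchy_Schwarz_ineq2)
  also have "\<dots> \<le> norm T" using norm_blinfun[of T x] x(1) by simp
  finally show "\<bar>f t\<bar> \<le> norm T + e" using x(2) by linarith
qed

lemma symbol_nonneg:
  assumes "continuous_on K f" "has_operator_integral E K f T" "t \<in> K" "psd T"
  shows "0 \<le> f t"
proof (rule field_le_epsilon)
  fix e :: real assume "0 < e"
  then obtain x where x: "norm x = 1" "\<bar>inner x (T x) - f t\<bar> \<le> e"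
    using ex_approximate_value[OF assms(1-3) \<open>0 < e\<close>] by blast
  have "0 \<le> inner x (T x)" using assms(4) by (simp add: psd_def)
  then show "0 \<le> f t + e" using x(2) by linarith
qed

text \<open>Polynomials in \<open>A\<close> that are Cauchy in norm have symbols that are uniformly
  Cauchy on \<open>K\<close>, by \<open>symbol_abs_le\<close>; the uniform limit is the continuous
  symbol of \<open>T\<close>.\<close>

lemma ex_symbol:
  assumes "T \<in> closure (range (op_poly A))"
  shows "\<exists>f. continuous_on K f \<and> has_operator_integral E K f T"
proof -
  obtain p where p: "(\<lambda>n. op_poly A (p n)) \<longlonglongrightarrow> T"
    using assms closure_range_op_poly by blast
  have le: "\<bar>poly (p n) t - poly (p k) t\<bar> \<le> norm (op_poly A (p n) - op_poly A (p k))" if "t \<in> K" for n k t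
    using symbol_abs_le[OF _ has_operator_integral_poly that, of "p n - p k"]
    by (simp add: op_poly_diff continuous_intros)
  have "uniformly_Cauchy_on K (\<lambda>n. poly (p n))"
  proof (rule uniformly_Cauchy_onI)
    fix e :: real assume "0 < e"
    obtain N where N: "\<And>n k. N \<le> n \<Longrightarrow> N \<le> k \<Longrightarrow> norm (op_poly A (p n) - op_poly A (p k)) < e"
      using CauchyD[OF LIMSEQ_imp_Cauchy[OF p] \<open>0 < e\<close>] by blast
    show "\<exists>M. \<forall>x\<in>K. \<forall>m\<ge>M. \<forall>n\<ge>M. dist (poly (p m) x) (poly (p n) x) < e"
    proof (intro exI ballI allI impI)
      fix t n k assume "t \<in> K" "N \<le> n" "N \<le> k"
      then show "dist (poly (p n) t) (poly (p k) t) < e"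
        unfolding dist_real_def by (intro order_le_less_trans[OF le N])
    qed
  qed
  then obtain f where f: "uniform_limit K (\<lambda>n. poly (p n)) f sequentially"
    using Cauchy_uniformly_convergent uniformly_convergent_on_def by blast
  have cont: "continuous_on K f"
    by (rule uniform_limit_theorem[OF _ f]) (auto intro!: continuous_intros always_eventually)
  have pointwise: "(\<lambda>n. op_poly A (p n) x) \<longlonglongrightarrow> T x" for x
    by (intro blinfun.tendsto p tendsto_const)
  have T: "T \<in> complex_operators" "symmetric T"
    by (rule complex_operators_pointwise_limit[OF op_poly_complex pointwise]
        symmetric_pointwise_limit[OF symmetric_op_poly[OF sym] pointwise])+
  have "inner x (T x) = (LINT t:K|m x. f t)" for x
  proof (rule LIMSEQ_unique)
    show "(\<lambda>n. inner x (op_poly A (p n) x)) \<longlonglongrightarrow> inner x (T x)"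
      by (intro tendsto_intros p blinfun.tendsto)
    have "(\<lambda>n. LINT t:K|m x. poly (p n) t) \<longlonglongrightarrow> (LINT t:K|m x. f t)"
    proof (rule LIMSEQ_I)
      fix e :: real assume e: "0 < e"
      \<comment> \<open>The integral over \<open>m x\<close> multiplies a uniform error by the total
        mass \<open>inner x x\<close>; the summand 1 covers \<open>x = 0\<close>.\<close>
      define d where "d = e / (inner x x + 1)"
      have d: "0 < d" using e by (simp add: d_def add_nonneg_pos)
      then obtain N where N: "\<And>n t. N \<le> n \<Longrightarrow> t \<in> K \<Longrightarrow> \<bar>poly (p n) t - f t\<bar> < d"
        using uniform_limitD[OF f, of d] by (auto simp: eventually_sequentially dist_real_def)
      have "\<bar>(LINT t:K|m x. poly (p n) t) - (LINT t:K|m x. f t)\<bar> < e" if "N \<le> n" for n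
      proof -
        have "\<bar>LINT t:K|m x. poly (p n) t - f t\<bar> \<le> d * inner x x"
          using N[OF that] d by (intro abs_LINT_K_le) (auto intro!: continuous_intros cont less_imp_le)
        also have "\<dots> < e"
          using e inner_ge_zero[of x] by (simp add: d_def pos_divide_less_eq add_nonneg_pos)
        finally show ?thesis
          by (subst set_integral_diff(2)[symmetric]) (auto intro!: set_integrable_K continuous_intros cont)
      qed
      then show "\<exists>no. \<forall>n\<ge>no. norm ((LINT t:K|m x. poly (p n) t) - (LINT t:K|m x. f t)) < e"
        by (intro exI[of _ N]) auto
    qed
    then show "(\<lambda>n. inner x (op_poly A (p n) x)) \<longlonglongrightarrow> (LINT t:K|m x. f t)"
      by (simp add: has_operator_integralD(2)[OF has_operator_integral_poly])
  qed
  then show ?thesis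
    using cont T by (intro exI[of _ f]) (simp add: has_operator_integral_iff set_integrable_K)
qed

end

section \<open>The spectrum\<close>

context spectral_calculus
begin

text \<open>The function 1/r is continuous on the compact set \<open>K\<close>, hence a uniform
  limit of polynomials there. The norm is controlled by the supremum on \<open>K\<close>, so these
  polynomials in \<open>A\<close> converge in norm, and the limit inherits commutation with
  \<open>A\<close>.\<close>

lemma ex_inverse_op_poly:
  assumes "\<And>t. t \<in> K \<Longrightarrow> poly r t \<noteq> 0"
  obtains G where "G \<in> complex_operators" "G o\<^sub>L op_poly A r = id_blinfun"
    "op_poly A r o\<^sub>L G = id_blinfun" "G o\<^sub>L A = A o\<^sub>L G"
proof -
  let ?e = "\<lambda>n. inverse (real (Suc n))"
  have "\<exists>q. \<forall>t\<in>K. \<bar>poly q t - inverse (poly r t)\<bar> < ?e n" for n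
  proof -
    have "continuous_on K (\<lambda>t. inverse (poly r t))"
      using assms by (intro continuous_intros) auto
    then obtain q where "\<And>t. t \<in> K \<Longrightarrow> \<bar>poly q t - inverse (poly r t)\<bar> < ?e n"
      using Weierstrass_poly[OF compact_K, of "\<lambda>t. inverse (poly r t)" "?e n"] by auto
    then show ?thesis by blast
  qed
  then obtain q where q: "\<And>n t. t \<in> K \<Longrightarrow> \<bar>poly (q n) t - inverse (poly r t)\<bar> < ?e n"
    by metis
  have "Cauchy (\<lambda>n. op_poly A (q n))"
  proof (rule CauchyI)
    fix e :: real assume e: "0 < e"
    then obtain N where N: "?e N < e / 2"
      using reals_Archimedean[of "e / 2"] by auto
    have "norm (op_poly A (q i) - op_poly A (q j)) < e" if "N \<le> i" "N \<le> j" for i j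
    proof -
      have "norm (op_poly A (q i - q j)) \<le> 2 * ?e N"
      proof (rule norm_op_poly_le)
        fix t assume t: "t \<in> K"
        have "?e i \<le> ?e N" "?e j \<le> ?e N" using that by (auto simp: field_simps)
        then show "\<bar>poly (q i - q j) t\<bar> \<le> 2 * ?e N"
          using q[OF t, of i] q[OF t, of j] unfolding poly_diff by linarith
      qed simp
      then show ?thesis using N by (simp add: op_poly_diff)
    qed
    then show "\<exists>M. \<forall>m\<ge>M. \<forall>n\<ge>M. norm (op_poly A (q m) - op_poly A (q n)) < e" by blast
  qed
  then obtain G where G: "(\<lambda>n. op_poly A (q n)) \<longlonglongrightarrow> G"
    using Cauchy_convergent convergent_def by blast
  obtain C where C: "\<And>t. t \<in> K \<Longrightarrow> \<bar>poly r t\<bar> \<le> C" "0 \<le> C"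
  proof -
    have "bounded (poly r ` K)"
      by (intro compact_imp_bounded compact_continuous_image compact_K continuous_intros)
    then obtain C where "\<And>t. t \<in> K \<Longrightarrow> \<bar>poly r t\<bar> \<le> C"
      by (auto simp: bounded_iff)
    then show ?thesis by (intro that[of "\<bar>C\<bar>"]) (auto intro: order_trans[OF _ abs_ge_self])
  qed
  have "(\<lambda>n. (op_poly A (q n) o\<^sub>L op_poly A r) - id_blinfun) \<longlonglongrightarrow> 0"
  proof (rule Lim_null_comparison)
    show "\<forall>\<^sub>F n in sequentially. norm ((op_poly A (q n) o\<^sub>L op_poly A r) - id_blinfun) \<le> C * ?e n"
    proof (rule always_eventually, rule allI)
      fix n
      have "norm (op_poly A (q n * r - 1)) \<le> C * ?e n"
      proof (rule norm_op_poly_le)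
        fix t assume t: "t \<in> K"
        have "poly (q n * r - 1) t = poly r t * (poly (q n) t - inverse (poly r t))"
          using assms[OF t] by (simp add: algebra_simps)
        then have "\<bar>poly (q n * r - 1) t\<bar> = \<bar>poly r t\<bar> * \<bar>poly (q n) t - inverse (poly r t)\<bar>"
          by (simp only: abs_mult)
        also have "\<dots> \<le> C * ?e n"
          using q[OF t, of n] C(1)[OF t] C(2) by (intro mult_mono) auto
        finally show "\<bar>poly (q n * r - 1) t\<bar> \<le> C * ?e n" .
      qed (use C in auto)
      then show "norm ((op_poly A (q n) o\<^sub>L op_poly A r) - id_blinfun) \<le> C * ?e n"
        by (simp add: op_poly_diff op_poly_mult)
    qed
    show "(\<lambda>n. C * ?e n) \<longlonglongrightarrow> 0"
      by (rule tendsto_mult_right_zero[OF LIMSEQ_inverse_real_of_nat])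
  qed
  then have lim_id: "(\<lambda>n. op_poly A (q n) o\<^sub>L op_poly A r) \<longlonglongrightarrow> id_blinfun"
    by (rule LIM_zero_cancel)
  have comm: "op_poly A (q n) o\<^sub>L op_poly A r = op_poly A r o\<^sub>L op_poly A (q n)" for n
    by (simp only: op_poly_mult[symmetric] mult.commute)
  note lims = bounded_bilinear.tendsto[OF bounded_bilinear_blinfun_compose]
  show ?thesis
  proof (rule that)
    show "G \<in> complex_operators"
      by (rule complex_operators_pointwise_limit[where S="\<lambda>n. op_poly A (q n)", OF op_poly_complex])
         (intro blinfun.tendsto G tendsto_const)
    show "G o\<^sub>L op_poly A r = id_blinfun"
      using LIMSEQ_unique[OF lims[OF G tendsto_const] lim_id] .
    show "op_poly A r o\<^sub>L G = id_blinfun"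
      using LIMSEQ_unique[OF lims[OF tendsto_const G] lim_id[unfolded comm]] .
    show "G o\<^sub>L A = A o\<^sub>L G"
      using LIMSEQ_unique[OF lims[OF G tendsto_const] lims[OF tendsto_const G, of A, unfolded op_poly_commute]] .
  qed
qed

lemma spectrum_subset: "spectrum A \<subseteq> complex_of_real ` K"
proof
  fix z assume z: "z \<in> spectrum A"
  show "z \<in> complex_of_real ` K"
  proof (rule ccontr)
    assume nz: "z \<notin> complex_of_real ` K"
    \<comment> \<open>The real polynomial (X - z)(X - cnj z) handles complex \<open>z\<close> within
      the real calculus. It has a zero in \<open>K\<close> only if \<open>z\<close> itself is a
      point of \<open>K\<close>.\<close>
    define r where "r = [:(cmod z)\<^sup>2, - 2 * Re z, 1:]"
    have "poly r t \<noteq> 0" if "t \<in> K" for t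
    proof
      assume "poly r t = 0"
      moreover have "poly r t = (t - Re z)\<^sup>2 + (Im z)\<^sup>2"
        unfolding r_def cmod_power2 by (simp add: power2_eq_square algebra_simps)
      ultimately have "(t - Re z)\<^sup>2 + (Im z)\<^sup>2 = 0"
        by simp
      then have "z = complex_of_real t"
        by (simp add: sum_power2_eq_zero_iff complex_eq_iff)
      then show False using nz that by blast
    qed
    then obtain G where G: "G \<in> complex_operators" "G o\<^sub>L op_poly A r = id_blinfun"
      "op_poly A r o\<^sub>L G = id_blinfun" "G o\<^sub>L A = A o\<^sub>L G"
      using ex_inverse_op_poly by blast
    let ?S = "\<lambda>w. A - scaleC_blinfun w id_blinfun"
    have S: "?S w x = A x - w *\<^sub>C x" for w x
      by (simp add: blinfun.diff_left scaleC_blinfun_apply)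
    have S_complex: "?S w \<in> complex_operators" for w
      using complex by (simp add: complex_operators_def S scaleC_scaleC scaleC_diff_right mult.commute)
    have prod: "?S (cnj z) (?S z x) = op_poly A r x" "?S z (?S (cnj z) x) = op_poly A r x" for x
    proof -
      have r: "op_poly A r x = A (A x) - (2 * Re z) *\<^sub>R A x + (cmod z)\<^sup>2 *\<^sub>R x"
        by (simp add: r_def blinfun.bilinear_simps)
      have sq: "(cmod z)\<^sup>2 *\<^sub>R x = (z * cnj z) *\<^sub>C x"
        by (simp only: scaleR_scaleC complex_norm_square)
      have "(2 * Re z) *\<^sub>R A x = z *\<^sub>C A x + cnj z *\<^sub>C A x"
        by (simp only: scaleR_scaleC scaleC_add_left[symmetric] complex_add_cnj)
      then show "?S (cnj z) (?S z x) = op_poly A r x" "?S z (?S (cnj z) x) = op_poly A r x"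
        unfolding r S sq
        by (simp_all add: blinfun.diff_right complex_operatorsD[OF complex] scaleC_diff_right scaleC_scaleC
            mult.commute)
    qed
    have GS: "G (?S w x) = ?S w (G x)" for w x
    proof -
      have "G (A x) = A (G x)" using G(4) by (metis blinfun_apply_blinfun_compose)
      then show ?thesis
        by (simp add: S blinfun.diff_right complex_operatorsD[OF G(1)])
    qed
    have GR: "G (op_poly A r x) = x" "op_poly A r (G x) = x" for x
      using G(2,3) by (metis blinfun_apply_blinfun_compose blinfun_apply_id_blinfun)+
    \<comment> \<open>Since \<open>G\<close> inverts the product of \<open>?S z\<close> and
      \<open>?S (cnj z)\<close> and commutes with both, the inverse of \<open>?S z\<close> is
      \<open>?S (cnj z) o\<^sub>L G\<close>.\<close>
    have "?S (cnj z) o\<^sub>L G \<in> complex_operators"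
      by (intro complex_operators_compose S_complex G)
    moreover have "(?S (cnj z) o\<^sub>L G) o\<^sub>L ?S z = id_blinfun"
      by (rule blinfun_eqI) (simp add: GS prod GR)
    moreover have "?S z o\<^sub>L (?S (cnj z) o\<^sub>L G) = id_blinfun"
      by (rule blinfun_eqI) (simp add: prod GR)
    ultimately show False
      using z unfolding spectrum_def by blast
  qed
qed

text \<open>Concentrated unit vectors are approximate eigenvectors, and a bounded inverse excludes
  these.\<close>

lemma K_subset_spectrum:
  assumes t: "t \<in> K"
  shows "complex_of_real t \<in> spectrum A"
proof (rule ccontr)
  assume "complex_of_real t \<notin> spectrum A"
  then obtain B where B: "B o\<^sub>L (A - t *\<^sub>R id_blinfun) = id_blinfun"
    by (auto simp: spectrum_def scaleC_blinfun_of_real)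
  have Bx: "B (A x - t *\<^sub>R x) = x" for x
    using arg_cong[OF B, of "\<lambda>T. T x"] by (simp add: blinfun.diff_left blinfun.scaleR_left)
  \<comment> \<open>Chosen so that \<open>norm B * e < 1\<close>, also when
    \<open>B = 0\<close>.\<close>
  define e where "e = 1 / (norm B + 1)"
  have e: "0 < e" by (simp add: e_def add_nonneg_pos)
  obtain x where x: "norm x = 1" "AE s in m x. s \<in> ball t e \<inter> K"
    using ex_concentrated_vector[OF t e] by blast
  interpret finite_measure "m x" by (rule finite_m)
  have one: "inner x x = 1" using x(1) by (simp add: norm_eq_1)
  have "(norm (A x - t *\<^sub>R x))\<^sup>2 = (\<integral>s. (s - t)\<^sup>2 \<partial>m x)"
    using norm_op_poly_square[of "[:- t, 1:]" x]
    by (simp add: LINT_K blinfun.bilinear_simps)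
  also have "\<dots> \<le> (\<integral>s. e\<^sup>2 \<partial>m x)"
  proof (rule integral_mono_AE')
    show "AE s in m x. (s - t)\<^sup>2 \<le> e\<^sup>2"
      using x(2)
    proof eventually_elim
      case (elim s)
      then have "\<bar>s - t\<bar> \<le> e" by (simp add: dist_real_def abs_minus_commute)
      then show ?case by (rule abs_le_square_iff[THEN iffD1, OF order_trans[OF _ abs_ge_self]])
    qed
  qed auto
  finally have "(norm (A x - t *\<^sub>R x))\<^sup>2 \<le> e\<^sup>2"
    by (simp add: measure_m_UNIV one)
  then have le: "norm (A x - t *\<^sub>R x) \<le> e"
    using e by (simp add: power_mono_iff)
  have "1 = norm (B (A x - t *\<^sub>R x))"
    using x(1) by (simp add: Bx)
  also have "\<dots> \<le> norm B * e"
    by (rule order_trans[OF norm_blinfun mult_left_mono[OF le norm_ge_zero]])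
  also have "\<dots> < 1"
    by (simp add: e_def add_nonneg_pos)
  finally show False by simp
qed

lemma real_spectrum_eq: "real_spectrum A = K"
  using spectrum_subset K_subset_spectrum by (auto simp: real_spectrum_def)

end

section \<open>Generating projections by one operator\<close>

lemma norm_closed_algebraD:
  assumes "norm_closed_algebra N"
  shows "id_blinfun \<in> N" "S \<in> N \<Longrightarrow> T \<in> N \<Longrightarrow> S + T \<in> N" "S \<in> N \<Longrightarrow> T \<in> N \<Longrightarrow> S o\<^sub>L T \<in> N"
    "T \<in> N \<Longrightarrow> r *\<^sub>R T \<in> N" "closed N"
  using assms by (simp_all add: norm_closed_algebra_def)

lemma norm_closed_algebra_diff:
  "norm_closed_algebra N \<Longrightarrow> S \<in> N \<Longrightarrow> T \<in> N \<Longrightarrow> S - T \<in> N"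
  using norm_closed_algebraD(2)[of N S "(-1) *\<^sub>R T"] norm_closed_algebraD(4)[of N T "-1"] by simp

lemma norm_closed_algebra_zero: "norm_closed_algebra N \<Longrightarrow> 0 \<in> N"
  using norm_closed_algebraD(4)[of N id_blinfun 0] norm_closed_algebraD(1)[of N] by simp

lemma norm_closed_algebra_sum:
  "norm_closed_algebra N \<Longrightarrow> (\<And>i. i \<in> I \<Longrightarrow> f i \<in> N) \<Longrightarrow> sum f I \<in> N"
  by (induction I rule: infinite_finite_induct)
     (auto simp: norm_closed_algebra_zero intro: norm_closed_algebraD(2))

lemma norm_closed_algebra_LIMSEQ:
  "norm_closed_algebra N \<Longrightarrow> (\<And>n::nat. f n \<in> N) \<Longrightarrow> f \<longlonglongrightarrow> T \<Longrightarrow> T \<in> N"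
  using norm_closed_algebraD(5) closed_sequentially by blast

text \<open>The cubic \<open>3 t\<^sup>2 - 2 t\<^sup>3\<close> has superattracting fixed points \<open>0\<close> and \<open>1\<close>, so iterating it on an
  operator near a commuting projection converges to that projection in norm.\<close>

lemma projection_in_algebra:
  fixes P Q :: "'a::real_inner \<Rightarrow>\<^sub>L 'a"
  assumes N: "norm_closed_algebra N" and Q: "Q \<in> N"
    and idem: "P o\<^sub>L P = P" and comm: "Q o\<^sub>L P = P o\<^sub>L Q"
    and norm_P: "norm P \<le> 1" and close: "norm (Q - P) \<le> 1 / 50"
  shows "P \<in> N"
proof -
  define h :: "('a \<Rightarrow>\<^sub>L 'a) \<Rightarrow> ('a \<Rightarrow>\<^sub>L 'a)"
    where "h T = 3 *\<^sub>R (T o\<^sub>L T) - 2 *\<^sub>R (T o\<^sub>L (T o\<^sub>L T))" for T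
  have PP: "P (P x) = P x" for x
    using idem by (metis blinfun_apply_blinfun_compose)
  have step: "norm (h T - P) \<le> norm (T - P) / 2" if "T o\<^sub>L P = P o\<^sub>L T" "norm (T - P) \<le> 1 / 50" for T
  proof -
    define D where "D = T - P"
    \<comment> \<open>Expanding the cubic at \<open>P + D\<close>, the idempotence of
      \<open>P\<close> cancels the terms of order 0 and 1 in \<open>D\<close>; \<open>R\<close> is
      the quotient by the square of \<open>D\<close>.\<close>
    define R where "R = 3 *\<^sub>R id_blinfun - 6 *\<^sub>R P - 2 *\<^sub>R D"
    have TP: "T (P x) = P (T x)" for x
      using that(1) by (metis blinfun_apply_blinfun_compose)
    have "h T - P = D o\<^sub>L (D o\<^sub>L R)"
    proof (rule blinfun_eqI)
      fix x
      have "inner y ((h T - P) x) = inner y ((D o\<^sub>L (D o\<^sub>L R)) x)" for y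
        by (simp add: h_def D_def R_def blinfun.bilinear_simps TP PP inner_add_right inner_diff_right)
      then show "(h T - P) x = (D o\<^sub>L (D o\<^sub>L R)) x"
        by (metis vector_eq_ldot)
    qed
    then have "norm (h T - P) \<le> norm D * (norm D * norm R)"
      by (simp add: order_trans[OF norm_blinfun_compose mult_left_mono[OF norm_blinfun_compose]])
    \<comment> \<open>\<open>R\<close> has norm at most 3 + 6 + 2/50, generously 10; with
      \<open>norm D \<le> 1 / 50\<close> the contraction factor is at most 1/5.\<close>
    also have "\<dots> \<le> norm D * (1 / 50 * 10)"
    proof -
      have "norm R \<le> norm (3 *\<^sub>R id_blinfun - 6 *\<^sub>R P) + norm (2 *\<^sub>R D)"
        unfolding R_def by (rule norm_triangle_ineq4)
      also have "norm (3 *\<^sub>R id_blinfun - 6 *\<^sub>R P) \<le> norm (3 *\<^sub>R id_blinfun :: 'a \<Rightarrow>\<^sub>L 'a) + norm (6 *\<^sub>R P)"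
        by (rule norm_triangle_ineq4)
      also have "norm (3 *\<^sub>R id_blinfun :: 'a \<Rightarrow>\<^sub>L 'a) \<le> 3"
        using norm_blinfun_id_le[where 'a='a] by simp
      finally have "norm R \<le> 10"
        using norm_P that(2) by (simp add: D_def)
      then show ?thesis
        using that(2) by (intro mult_left_mono mult_mono) (auto simp: D_def)
    qed
    also have "\<dots> \<le> norm D / 2"
      by simp
    finally show ?thesis by (simp add: D_def)
  qed
  define q where "q n = (h ^^ n) Q" for n
  have q: "q n \<in> N \<and> q n o\<^sub>L P = P o\<^sub>L q n \<and> norm (q n - P) \<le> 1 / 50 * (1 / 2) ^ n" for n
  proof (induction n)
    case 0
    then show ?case using Q comm close by (simp add: q_def)
  next
    case (Suc n)
    have q_Suc: "q (Suc n) = h (q n)" by (simp add: q_def)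
    have TP: "q n (P x) = P (q n x)" for x
      using Suc by (metis blinfun_apply_blinfun_compose)
    have "norm (q n - P) \<le> 1 / 50"
      using Suc by (elim conjE order_trans) (simp add: power_le_one)
    then have "norm (q (Suc n) - P) \<le> norm (q n - P) / 2"
      unfolding q_Suc using Suc by (intro step) auto
    moreover have "q (Suc n) \<in> N"
      unfolding q_Suc h_def using Suc
      by (intro norm_closed_algebra_diff[OF N] norm_closed_algebraD(3,4)[OF N]) auto
    moreover have "q (Suc n) o\<^sub>L P = P o\<^sub>L q (Suc n)"
      unfolding q_Suc h_def by (rule blinfun_eqI) (simp add: blinfun.bilinear_simps TP)
    ultimately show ?case using Suc by simp
  qed
  have "(\<lambda>n. q n - P) \<longlonglongrightarrow> 0"
  proof (rule Lim_null_comparison)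
    show "\<forall>\<^sub>F n in sequentially. norm (q n - P) \<le> 1 / 50 * (1 / 2) ^ n"
      using q by (intro always_eventually) blast
    show "(\<lambda>n. 1 / 50 * (1 / 2 :: real) ^ n) \<longlonglongrightarrow> 0"
      by (intro tendsto_mult_right_zero LIMSEQ_power_zero) simp
  qed
  then have "q \<longlonglongrightarrow> P"
    by (rule LIM_zero_cancel)
  then show ?thesis
    using norm_closed_algebra_LIMSEQ[OF N] q by blast
qed

locale commuting_projections =
  fixes P :: "nat \<Rightarrow> 'h::complex_hilbert_space \<Rightarrow>\<^sub>L 'h"
  assumes complex: "P j \<in> complex_operators" and sym: "symmetric (P j)"
    and idem: "P j o\<^sub>L P j = P j" and comm: "P i o\<^sub>L P j = P j o\<^sub>L P i"
begin

text \<open>The sum 1 keeps the generator between 0 and the identity; the ratio 1/100 makes all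
  later terms together small against the current one.\<close>

definition coeff :: "nat \<Rightarrow> real" where
  "coeff j = 99 / 100 * (1 / 100) ^ j"

text \<open>\<open>tail 0\<close> is the generator. \<open>tail n\<close> is its remainder from
  index \<open>n\<close> on, multiplied by 100^n, so that one estimate serves every stage.\<close>

definition tail :: "nat \<Rightarrow> 'h \<Rightarrow>\<^sub>L 'h" where
  "tail n = (\<Sum>j. coeff j *\<^sub>R P (n + j))"

lemma coeff_sums: "coeff sums 1"
  using sums_mult[OF geometric_sums[of "1 / 100 :: real"], of "99 / 100"] by (simp add: coeff_def[abs_def])

lemma coeff_nonneg: "0 \<le> coeff j"
  by (simp add: coeff_def)

lemma inner_P: "inner x (P j x) = (norm (P j x))\<^sup>2"
proof -
  have "P j (P j x) = P j x" using idem by (metis blinfun_apply_blinfun_compose)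
  then show ?thesis using symmetricD[OF sym, of j x "P j x"] by (simp add: power2_norm_eq_inner)
qed

lemma norm_P: "norm (P j) \<le> 1"
proof (rule norm_blinfun_bound)
  fix x
  have "(norm (P j x))\<^sup>2 \<le> norm x * norm (P j x)"
    using inner_P[of x j] norm_cauchy_schwarz[of x "P j x"] by simp
  then show "norm (P j x) \<le> 1 * norm x"
    by (cases "norm (P j x) = 0") (auto simp: power2_eq_square)
qed simp

lemma summable_tail: "summable (\<lambda>j. norm (coeff j *\<^sub>R P (n + j)))"
proof (rule summable_comparison_test'[OF sums_summable[OF coeff_sums]])
  show "norm (norm (coeff j *\<^sub>R P (n + j))) \<le> coeff j" if "0 \<le> j" for j
    using mult_left_mono[OF norm_P coeff_nonneg, of j "n + j"] coeff_nonneg[of j] by simp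
qed

lemma tail_sums: "(\<lambda>j. coeff j *\<^sub>R P (n + j)) sums tail n"
  unfolding tail_def by (rule summable_sums[OF summable_norm_cancel[OF summable_tail]])

lemma tail_limit: "(\<lambda>k. \<Sum>j<k. coeff j *\<^sub>R P (n + j)) \<longlonglongrightarrow> tail n"
  using tail_sums by (simp add: sums_def)

lemma tail_pointwise: "(\<lambda>k. (\<Sum>j<k. coeff j *\<^sub>R P (n + j)) x) \<longlonglongrightarrow> tail n x"
  by (intro blinfun.tendsto tail_limit tendsto_const)

lemma norm_tail: "norm (tail n) \<le> 1"
proof -
  have "norm (tail n) \<le> (\<Sum>j. norm (coeff j *\<^sub>R P (n + j)))"
    unfolding tail_def by (rule summable_norm[OF summable_tail])
  also have "\<dots> \<le> (\<Sum>j. coeff j)"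
  proof (rule suminf_le[OF _ summable_tail sums_summable[OF coeff_sums]])
    show "norm (coeff j *\<^sub>R P (n + j)) \<le> coeff j" for j
      using mult_left_mono[OF norm_P coeff_nonneg, of j "n + j"] coeff_nonneg[of j] by simp
  qed
  finally show ?thesis using sums_unique[OF coeff_sums] by simp
qed

lemma tail_Suc: "tail n = (99 / 100) *\<^sub>R P n + (1 / 100) *\<^sub>R tail (Suc n)"
proof -
  have "(\<lambda>j. coeff (Suc j) *\<^sub>R P (n + Suc j)) sums (tail n - coeff 0 *\<^sub>R P (n + 0))"
    using sums_Suc_iff[of "\<lambda>j. coeff j *\<^sub>R P (n + j)"] tail_sums[of n] by simp
  moreover have "(\<lambda>j. coeff (Suc j) *\<^sub>R P (n + Suc j)) sums ((1 / 100) *\<^sub>R tail (Suc n))"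
    using sums_scaleR_right[OF tail_sums[of "Suc n"], of "1 / 100"] by (simp add: coeff_def)
  ultimately have "tail n - coeff 0 *\<^sub>R P n = (1 / 100) *\<^sub>R tail (Suc n)"
    by (simp add: sums_unique2)
  then show ?thesis by (simp add: coeff_def algebra_simps)
qed

lemma tail_commute: "tail n o\<^sub>L P i = P i o\<^sub>L tail n"
proof -
  note lims = bounded_bilinear.tendsto[OF bounded_bilinear_blinfun_compose]
  have "(\<Sum>j<k. coeff j *\<^sub>R P (n + j)) o\<^sub>L P i = P i o\<^sub>L (\<Sum>j<k. coeff j *\<^sub>R P (n + j))" for k
    by (simp add: bounded_bilinear.sum_left[OF bounded_bilinear_blinfun_compose]
        bounded_bilinear.sum_right[OF bounded_bilinear_blinfun_compose]
        bounded_bilinear.scaleR_left[OF bounded_bilinear_blinfun_compose]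
        bounded_bilinear.scaleR_right[OF bounded_bilinear_blinfun_compose] comm[of _ i])
  then have "(\<lambda>k. (\<Sum>j<k. coeff j *\<^sub>R P (n + j)) o\<^sub>L P i) \<longlonglongrightarrow> (P i o\<^sub>L tail n)"
    using lims[OF tendsto_const tail_limit] by simp
  with lims[OF tail_limit tendsto_const] show ?thesis
    by (rule LIMSEQ_unique)
qed

lemma tail_in_algebra:
  assumes "norm_closed_algebra N" "\<And>j. P j \<in> N"
  shows "tail n \<in> N"
  by (rule norm_closed_algebra_LIMSEQ[OF assms(1) _ tail_limit])
     (intro norm_closed_algebra_sum norm_closed_algebraD(4) assms)

lemma tail_complex: "tail n \<in> complex_operators"
  by (intro tail_in_algebra seq_closed_imp_norm_closed seq_closed_complex_operators complex)

lemma tail_symmetric: "symmetric (tail n)"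
  by (rule symmetric_pointwise_limit[OF _ tail_pointwise]) (intro symmetric_sum symmetric_scaleR sym)

lemma tail_psd: "psd (tail n)"
  unfolding psd_def
proof (intro conjI allI tail_symmetric)
  fix x
  have "(\<lambda>k. inner x ((\<Sum>j<k. coeff j *\<^sub>R P (n + j)) x)) \<longlonglongrightarrow> inner x (tail n x)"
    by (intro tendsto_inner tendsto_const tail_pointwise)
  moreover have "0 \<le> inner x ((\<Sum>j<k. coeff j *\<^sub>R P (n + j)) x)" for k
    unfolding blinfun.sum_left inner_sum_right
    by (intro sum_nonneg) (simp add: blinfun.scaleR_left inner_P coeff_nonneg)
  ultimately show "0 \<le> inner x (tail n x)"
    by (intro LIMSEQ_le_const) auto
qed

lemma tail_le_one: "inner x (tail n x) \<le> inner x x"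
proof -
  have "inner x (tail n x) \<le> norm x * norm (tail n x)" by (rule norm_cauchy_schwarz)
  also have "\<dots> \<le> norm x * (1 * norm x)"
    by (intro mult_left_mono order_trans[OF norm_blinfun] mult_right_mono norm_tail) auto
  finally show ?thesis by (simp add: power2_norm_eq_inner[symmetric] power2_eq_square)
qed

text \<open>The projections are read off like the digits of a number: \<open>tail n\<close> is
  within 2/100 of \<open>P n\<close>, so \<open>projection_in_algebra\<close> yields
  \<open>P n\<close>; subtracting it and rescaling gives \<open>tail (Suc n)\<close>.\<close>

lemma projections_in_algebra:
  assumes N: "norm_closed_algebra N" and "tail 0 \<in> N"
  shows "P n \<in> N"
proof -
  have P: "P n \<in> N" if "tail n \<in> N" for n
  proof (rule projection_in_algebra[OF N that idem tail_commute norm_P])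
    have "tail n - P n = (1 / 100) *\<^sub>R (tail (Suc n) - P n)"
    proof (rule blinfun_eqI)
      fix x
      have "inner y ((tail n - P n) x) = inner y (((1 / 100) *\<^sub>R (tail (Suc n) - P n)) x)" for y
        unfolding tail_Suc[of n] by (simp add: blinfun.bilinear_simps inner_add_right inner_diff_right)
      then show "(tail n - P n) x = ((1 / 100) *\<^sub>R (tail (Suc n) - P n)) x"
        by (metis vector_eq_ldot)
    qed
    then have "norm (tail n - P n) = norm (tail (Suc n) - P n) / 100"
      by simp
    also have "norm (tail (Suc n) - P n) \<le> 1 + 1"
      by (rule order_trans[OF norm_triangle_ineq4 add_mono[OF norm_tail norm_P]])
    finally show "norm (tail n - P n) \<le> 1 / 50" by simp
  qed
  have "tail n \<in> N" for n
  proof (induction n)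
    case (Suc n)
    have "tail (Suc n) = 100 *\<^sub>R tail n - 99 *\<^sub>R P n"
      unfolding tail_Suc[of n] by (simp add: algebra_simps)
    then show ?case
      using Suc P[OF Suc] by (auto intro!: norm_closed_algebra_diff[OF N] norm_closed_algebraD(4)[OF N])
  qed (rule assms)
  then show ?thesis by (rule P)
qed

end

section \<open>Extending a continuous kernel from a compact set\<close>

lemma ex_prob_space:
  fixes g :: "real set \<Rightarrow> real"
  assumes nonneg: "\<And>D. D \<in> sets borel \<Longrightarrow> 0 \<le> g D" and total: "g UNIV = 1"
    and sums: "\<And>D :: nat \<Rightarrow> real set. range D \<subseteq> sets borel \<Longrightarrow> disjoint_family D \<Longrightarrow>
      (\<lambda>i. g (D i)) sums g (\<Union>i. D i)"
  shows "\<exists>M. prob_space M \<and> sets M = sets borel \<and> (\<forall>D\<in>sets borel. measure M D = g D)"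
proof -
  define M where "M = measure_of UNIV (sets borel) (\<lambda>D. ennreal (g D))"
  have sets: "sets M = sets borel"
    unfolding M_def using sets.sigma_sets_eq[of "borel :: real measure"] by (simp add: sets_measure_of_conv)
  have "(\<lambda>_. g {}) sums g {}"
    using sums[of "\<lambda>_. {}"] by (simp add: disjoint_family_on_def)
  then have zero: "g {} = 0"
    using sums_summable summable_const_iff by blast
  have em: "emeasure M D = ennreal (g D)" if "D \<in> sets borel" for D
  proof (rule emeasure_measure_of[OF M_def])
    show "positive (sets M) (\<lambda>D. ennreal (g D))"
      by (simp add: positive_def zero)
    show "countably_additive (sets M) (\<lambda>D. ennreal (g D))"
    proof (rule countably_additiveI)
      fix D :: "nat \<Rightarrow> real set"
      assume "range D \<subseteq> sets M" "disjoint_family D"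
      then show "(\<Sum>i. ennreal (g (D i))) = ennreal (g (\<Union>i. D i))"
        using sums[of D] nonneg by (intro suminf_ennreal_eq) (auto simp: sets)
    qed
  qed (use that sets in auto)
  have "space M = UNIV"
    using sets_eq_imp_space_eq[OF sets] by simp
  then have "prob_space M"
    by (intro prob_spaceI) (simp add: em total)
  then show ?thesis
    using sets em nonneg by (intro exI[of _ M]) (simp add: measure_def)
qed

text \<open>Linear interpolation over the gaps of \<open>K\<close>: \<open>lo t\<close> and \<open>hi t\<close> are the neighbours of \<open>t\<close> in \<open>K\<close>.
  For \<open>t \<in> K\<close> they coincide and the quotient is \<open>0 / 0 = 0\<close>.\<close>

lemma continuous_on_interpolation:
  fixes f :: "real \<Rightarrow> real"
  assumes K: "compact K" and f: "continuous_on K f"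
    and lo: "\<And>t. t \<in> I \<Longrightarrow> lo t \<in> K \<and> lo t \<le> t" "\<And>s t. t \<in> I \<Longrightarrow> s \<in> K \<Longrightarrow> s \<le> t \<Longrightarrow> s \<le> lo t"
    and hi: "\<And>t. t \<in> I \<Longrightarrow> hi t \<in> K \<and> t \<le> hi t" "\<And>s t. t \<in> I \<Longrightarrow> s \<in> K \<Longrightarrow> t \<le> s \<Longrightarrow> hi t \<le> s"
  defines "v \<equiv> \<lambda>t. (t - lo t) / (hi t - lo t)"
  shows "continuous_on I (\<lambda>t. (1 - v t) * f (lo t) + v t * f (hi t))"
proof -
  define g where "g t = (1 - v t) * f (lo t) + v t * f (hi t)" for t
  have "bounded (f ` K)"
    by (intro compact_imp_bounded compact_continuous_image K f)
  then obtain C0 where "\<And>t. t \<in> K \<Longrightarrow> \<bar>f t\<bar> \<le> C0"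
    by (auto simp: bounded_iff)
  then obtain C where C: "0 < C" "\<And>t. t \<in> K \<Longrightarrow> \<bar>f t\<bar> \<le> C"
    by (metis abs_ge_self abs_ge_zero add.commute less_add_one order_le_less_trans order_trans less_imp_le)
  have uc: "uniformly_continuous_on K f"
    by (rule compact_uniformly_continuous[OF f K])
  have "uniformly_continuous_on I g"
    unfolding uniformly_continuous_on_def
  proof (intro allI impI)
    fix e :: real assume "0 < e"
    define \<eta> where "\<eta> = e / 4"
    have \<eta>: "0 < \<eta>" using \<open>0 < e\<close> by (simp add: \<eta>_def)
    obtain \<delta> where \<delta>: "0 < \<delta>" "\<And>s t. s \<in> K \<Longrightarrow> t \<in> K \<Longrightarrow> \<bar>s - t\<bar> < \<delta> \<Longrightarrow> \<bar>f s - f t\<bar> < \<eta>"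
      using uc \<eta> unfolding uniformly_continuous_on_def dist_real_def by meson
    define \<rho> where "\<rho> = min \<delta> (\<delta> * \<eta> / (2 * C))"
    have \<rho>: "0 < \<rho>" "\<rho> \<le> \<delta>" "\<rho> * (2 * C) \<le> \<delta> * \<eta>"
    proof -
      show "0 < \<rho>" "\<rho> \<le> \<delta>" using \<delta>(1) \<eta> C(1) by (auto simp: \<rho>_def)
      have "\<rho> * (2 * C) \<le> \<delta> * \<eta> / (2 * C) * (2 * C)"
        using C(1) by (intro mult_right_mono) (auto simp: \<rho>_def)
      then show "\<rho> * (2 * C) \<le> \<delta> * \<eta>" using C(1) by simp
    qed
    \<comment> \<open>Change over a distance below \<rho> inside one gap. In a gap shorter than
      \<delta> even the end values differ by less than \<eta>; in a longer gap the slope is at most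
      2C/\<delta>, and \<rho> was chosen for that slope.\<close>
    have slope: "d / (h - l) * \<bar>f l - f h\<bar> \<le> \<eta>"
      if "l \<in> K" "h \<in> K" "l < h" "0 \<le> d" "d \<le> h - l" "d < \<rho>" for l h d
    proof (cases "h - l < \<delta>")
      case True
      then have "\<bar>f l - f h\<bar> \<le> \<eta>" using \<delta>(2)[of l h] that by simp
      moreover have "d / (h - l) \<le> 1" using that by simp
      ultimately show ?thesis
        using mult_mono[of "d / (h - l)" 1 "\<bar>f l - f h\<bar>" \<eta>] by simp
    next
      case False
      have "d * \<bar>f l - f h\<bar> \<le> \<rho> * (2 * C)"
        using that C(2)[of l] C(2)[of h] \<rho>(1) by (intro mult_mono) auto
      also have "\<dots> \<le> \<eta> * (h - l)"
        using \<rho>(3) False \<eta> by (smt (verit) mult.commute mult_left_mono)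
      finally show ?thesis using that by (simp add: field_simps)
    qed
    have near_hi: "\<bar>g t - f (hi t)\<bar> \<le> \<eta>" if "t \<in> I" "hi t - t < \<rho>" for t
    proof (cases "lo t < hi t")
      case True
      have "1 - v t = (hi t - t) / (hi t - lo t)"
        using True by (simp add: v_def field_simps)
      moreover have "g t - f (hi t) = (1 - v t) * (f (lo t) - f (hi t))"
        by (simp add: g_def algebra_simps)
      ultimately have "g t - f (hi t) = (hi t - t) / (hi t - lo t) * (f (lo t) - f (hi t))"
        by simp
      then have "\<bar>g t - f (hi t)\<bar> = (hi t - t) / (hi t - lo t) * \<bar>f (lo t) - f (hi t)\<bar>"
        using True lo(1)[OF that(1)] hi(1)[OF that(1)] by (simp add: abs_mult)
      also have "\<dots> \<le> \<eta>"
        using True lo(1)[OF that(1)] hi(1)[OF that(1)] that by (intro slope) auto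
      finally show ?thesis .
    next
      case False
      then have "lo t = hi t" using lo(1)[OF that(1)] hi(1)[OF that(1)] by auto
      then show ?thesis using \<eta> by (simp add: g_def v_def)
    qed
    have near_lo: "\<bar>g t - f (lo t)\<bar> \<le> \<eta>" if "t \<in> I" "t - lo t < \<rho>" for t
    proof (cases "lo t < hi t")
      case True
      have "g t - f (lo t) = v t * (f (hi t) - f (lo t))"
        by (simp add: g_def algebra_simps)
      then have "g t - f (lo t) = (t - lo t) / (hi t - lo t) * (f (hi t) - f (lo t))"
        by (simp add: v_def)
      then have "\<bar>g t - f (lo t)\<bar> = (t - lo t) / (hi t - lo t) * \<bar>f (lo t) - f (hi t)\<bar>"
        using True lo(1)[OF that(1)] hi(1)[OF that(1)] by (simp add: abs_mult abs_minus_commute)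
      also have "\<dots> \<le> \<eta>"
        using True lo(1)[OF that(1)] hi(1)[OF that(1)] that by (intro slope) auto
      finally show ?thesis .
    next
      case False
      then have "lo t = hi t" using lo(1)[OF that(1)] hi(1)[OF that(1)] by auto
      then show ?thesis using \<eta> by (simp add: g_def v_def)
    qed
    \<comment> \<open>If \<open>K\<close> meets the interval from \<open>s\<close> to
      \<open>t\<close>, the comparison passes through \<open>hi s\<close> and \<open>lo t\<close>
      with three errors of size \<eta> = e/4. Otherwise both points lie in the same gap, where
      \<open>g\<close> is affine.\<close>
    have main: "\<bar>g s - g t\<bar> < e" if st: "s \<in> I" "t \<in> I" "s \<le> t" "t - s < \<rho>" for s t
    proof (cases "hi s \<le> t")
      case True
      have "s \<le> lo t" "hi s \<le> lo t"
        using lo(2)[OF st(2), of "hi s"] hi(1)[OF st(1)] True by auto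
      then have "\<bar>g s - f (hi s)\<bar> \<le> \<eta>" "\<bar>g t - f (lo t)\<bar> \<le> \<eta>"
        using near_hi[OF st(1)] near_lo[OF st(2)] True st by auto
      moreover have "\<bar>f (hi s) - f (lo t)\<bar> < \<eta>"
        using hi(1)[OF st(1)] lo(1)[OF st(2)] \<open>hi s \<le> lo t\<close> st \<rho>(2) by (intro \<delta>(2)) auto
      ultimately have "\<bar>g s - g t\<bar> < 4 * \<eta>" using \<eta> by linarith
      then show ?thesis by (simp add: \<eta>_def)
    next
      case False
      have hi_eq: "hi s = hi t"
        using hi(2)[OF st(1), of "hi t"] hi(2)[OF st(2), of "hi s"] hi(1)[OF st(1)] hi(1)[OF st(2)] st False
        by auto
      have lo_eq: "lo s = lo t"
      proof -
        have "lo t \<le> s"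
          using hi(2)[OF st(1), of "lo t"] lo(1)[OF st(2)] False by linarith
        then show ?thesis
          using lo(2)[OF st(1), of "lo t"] lo(2)[OF st(2), of "lo s"] lo(1)[OF st(1)] lo(1)[OF st(2)] st
          by auto
      qed
      have less: "lo t < hi t"
        using lo(1)[OF st(1)] st False hi_eq lo_eq by linarith
      have "v t - v s = (t - s) / (hi t - lo t)"
        by (simp add: v_def hi_eq lo_eq diff_divide_distrib)
      moreover have "g s - g t = (v t - v s) * (f (lo t) - f (hi t))"
        by (simp add: g_def hi_eq lo_eq algebra_simps)
      ultimately have "g s - g t = (t - s) / (hi t - lo t) * (f (lo t) - f (hi t))"
        by simp
      then have "\<bar>g s - g t\<bar> = (t - s) / (hi t - lo t) * \<bar>f (lo t) - f (hi t)\<bar>"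
        using less st by (simp add: abs_mult)
      also have "\<dots> \<le> \<eta>"
        using less st lo(1)[OF st(1)] lo(1)[OF st(2)] hi(1)[OF st(2)] lo_eq by (intro slope) auto
      also have "\<dots> < e" using \<open>0 < e\<close> by (simp add: \<eta>_def)
      finally show ?thesis .
    qed
    show "\<exists>d>0. \<forall>s\<in>I. \<forall>t\<in>I. dist t s < d \<longrightarrow> dist (g t) (g s) < e"
    proof (intro exI[of _ \<rho>] conjI \<rho>(1) ballI impI)
      fix s t assume "s \<in> I" "t \<in> I" "dist t s < \<rho>"
      then show "dist (g t) (g s) < e"
        using main[of s t] main[of t s] unfolding dist_real_def by linarith
    qed
  qed
  then show ?thesis
    unfolding g_def by (rule uniformly_continuous_imp_continuous)
qed

text \<open>The weights depend on \<open>t\<close> only, so each new value is a convex combination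
  of the two probability measures at the neighbours of \<open>t\<close> in \<open>K\<close> and is
  again a probability measure, while every \<open>D\<close> separately stays continuous.\<close>

lemma ex_strong_feller_extension:
  fixes f :: "real set \<Rightarrow> real \<Rightarrow> real"
  assumes K: "compact K"
    and cont: "\<And>D. D \<in> sets borel \<Longrightarrow> continuous_on K (f D)"
    and nonneg: "\<And>D t. D \<in> sets borel \<Longrightarrow> t \<in> K \<Longrightarrow> 0 \<le> f D t"
    and total: "\<And>t. t \<in> K \<Longrightarrow> f UNIV t = 1"
    and sums: "\<And>(D :: nat \<Rightarrow> real set) t. range D \<subseteq> sets borel \<Longrightarrow> disjoint_family D \<Longrightarrow> t \<in> K \<Longrightarrow>
      (\<lambda>i. f (D i) t) sums f (\<Union>i. D i) t"
  shows "\<exists>\<mu>. (\<forall>t. prob_space (\<mu> t) \<and> sets (\<mu> t) = sets borel) \<and>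
    (\<forall>D\<in>sets borel. continuous_on UNIV (\<lambda>t. measure (\<mu> t) D)) \<and>
    (\<forall>D\<in>sets borel. \<forall>t\<in>K. measure (\<mu> t) D = f D t)"
proof (cases "K = {}")
  case True
  then show ?thesis
    \<comment> \<open>The support is empty on the zero Hilbert space; any constant kernel serves
      there.\<close>
    by (intro exI[of _ "\<lambda>_. return borel 0"]) (auto intro: prob_space_return)
next
  case False
  define a b where "a = Inf K" and "b = Sup K"
  have bdd: "bdd_below K" "bdd_above K"
    by (rule bounded_imp_bdd_below bounded_imp_bdd_above, rule compact_imp_bounded[OF K])+
  have ab: "a \<in> K" "b \<in> K"
    using closed_contains_Inf[OF False bdd(1) compact_imp_closed[OF K]]
      closed_contains_Sup[OF False bdd(2) compact_imp_closed[OF K]] by (auto simp: a_def b_def)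
  have K_ab: "a \<le> t" "t \<le> b" if "t \<in> K" for t
    using cInf_lower[OF that bdd(1)] cSup_upper[OF that bdd(2)] by (auto simp: a_def b_def)
  define lo hi where "lo t = Sup (K \<inter> {..t})" and "hi t = Inf (K \<inter> {t..})" for t
  have lo: "lo t \<in> K \<inter> {..t}" "\<And>s. s \<in> K \<Longrightarrow> s \<le> t \<Longrightarrow> s \<le> lo t" if "t \<in> {a..b}" for t
  proof -
    have "K \<inter> {..t} \<noteq> {}" using ab that by auto
    then show "lo t \<in> K \<inter> {..t}"
      unfolding lo_def using bdd compact_imp_closed[OF K]
      by (intro closed_contains_Sup closed_Int closed_atMost) auto
    show "s \<le> lo t" if "s \<in> K" "s \<le> t" for s
      unfolding lo_def using bdd that by (intro cSup_upper) auto
  qed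
  have hi: "hi t \<in> K \<inter> {t..}" "\<And>s. s \<in> K \<Longrightarrow> t \<le> s \<Longrightarrow> hi t \<le> s" if "t \<in> {a..b}" for t
  proof -
    have "K \<inter> {t..} \<noteq> {}" using ab that by auto
    then show "hi t \<in> K \<inter> {t..}"
      unfolding hi_def using bdd compact_imp_closed[OF K]
      by (intro closed_contains_Inf closed_Int closed_atLeast) auto
    show "hi t \<le> s" if "s \<in> K" "t \<le> s" for s
      unfolding hi_def using bdd that by (intro cInf_lower) auto
  qed
  define v where "v = (\<lambda>t. (t - lo t) / (hi t - lo t))"
  define g where "g D t = (1 - v t) * f D (lo t) + v t * f D (hi t)" for D t
  have v: "0 \<le> v t" "v t \<le> 1" if "t \<in> {a..b}" for t
    using lo(1)[OF that] hi(1)[OF that] by (auto simp: v_def divide_le_eq_1)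
  \<comment> \<open>Outside the hull of \<open>K\<close> there is only one neighbour, and the kernel
    is continued as a constant.\<close>
  define c where "c t = max a (min t b)" for t
  have c: "c t \<in> {a..b}" for t
    using K_ab[OF ab(1)] by (auto simp: c_def)
  have c_cont: "continuous_on UNIV c"
    unfolding c_def by (intro continuous_intros)
  have "\<exists>M. prob_space M \<and> sets M = sets borel \<and> (\<forall>D\<in>sets borel. measure M D = g D (c t))" for t
  proof (rule ex_prob_space)
    note lh = lo(1)[OF c, of t] hi(1)[OF c, of t]
    show "0 \<le> g D (c t)" if "D \<in> sets borel" for D
      unfolding g_def using v[OF c, of t] nonneg[OF that] lh by auto
    show "g UNIV (c t) = 1"
      unfolding g_def using total lh by simp
    show "(\<lambda>i. g (D i) (c t)) sums g (\<Union>i. D i) (c t)"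
      if "range D \<subseteq> sets borel" "disjoint_family D" for D :: "nat \<Rightarrow> real set"
      unfolding g_def using lh by (intro sums_add sums_mult sums that) auto
  qed
  then obtain \<mu> where \<mu>: "\<And>t. prob_space (\<mu> t)" "\<And>t. sets (\<mu> t) = sets borel"
    "\<And>t D. D \<in> sets borel \<Longrightarrow> measure (\<mu> t) D = g D (c t)"
    by metis
  have "continuous_on UNIV (\<lambda>t. measure (\<mu> t) D)" if "D \<in> sets borel" for D
  proof -
    have "continuous_on {a..b} (g D)"
      unfolding g_def v_def using lo hi by (intro continuous_on_interpolation[OF K cont[OF that]]) auto
    then have "continuous_on UNIV (g D \<circ> c)"
      by (intro continuous_on_compose c_cont) (auto intro: continuous_on_subset simp: image_subset_iff intro!: c)
    then show ?thesis using \<mu>(3)[OF that] by (simp add: o_def)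
  qed
  moreover have "measure (\<mu> t) D = f D t" if "D \<in> sets borel" "t \<in> K" for D t
  proof -
    have t: "t \<in> {a..b}" "c t = t" using K_ab[OF that(2)] by (auto simp: c_def)
    have "lo t = t" "hi t = t"
      using lo[OF t(1)] hi[OF t(1)] that(2) by (auto intro: antisym)
    then show ?thesis using \<mu>(3)[OF that(1), of t] t by (simp add: g_def v_def)
  qed
  ultimately show ?thesis using \<mu>(1,2) by blast
qed

section \<open>Operator integrals and spectral projections\<close>

lemma has_operator_integral_zero: "has_operator_integral E S (\<lambda>_. 0) 0"
  by (simp add: has_operator_integral_def complex_operators_zero set_integrable_def set_lebesgue_integral_def)

lemma has_operator_integral_add:
  assumes "has_operator_integral E S f T" "has_operator_integral E S g U"
  shows "has_operator_integral E S (\<lambda>t. f t + g t) (T + U)"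
  using assms complex_operators_add
  by (auto simp: has_operator_integral_def set_integral_add blinfun.add_left cinner_add_right)

lemma has_operator_integral_sum:
  assumes "\<And>i. i \<in> I \<Longrightarrow> has_operator_integral E S (f i) (T i)"
  shows "has_operator_integral E S (\<lambda>t. \<Sum>i\<in>I. f i t) (\<Sum>i\<in>I. T i)"
  using assms
  by (induction I rule: infinite_finite_induct)
     (simp_all add: has_operator_integral_zero has_operator_integral_add)

lemma has_operator_integral_cong:
  assumes "S \<in> sets borel" "\<And>t. t \<in> S \<Longrightarrow> f t = g t" "has_operator_integral E S f T"
  shows "has_operator_integral E S g T"
proof -
  have "indicator S t *\<^sub>R f t = indicator S t *\<^sub>R g t" for t
    using assms(2) by (simp add: indicator_def)
  then have "(\<lambda>t. indicator S t *\<^sub>R f t) = (\<lambda>t. indicator S t *\<^sub>R g t)" by blast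
  then show ?thesis
    using assms(3)
    by (simp only: has_operator_integral_def set_integrable_def set_lebesgue_integral_def) simp
qed

lemma povm_empty: "povm E \<Longrightarrow> E {} = 0"
  by (rule symmetric_eqI) (simp_all add: povm_symmetric symmetric_zero measure_diagonal_measure[symmetric])

lemma povm_compl:
  assumes "povm E" "normalized E" "D \<in> sets borel"
  shows "E (- D) = id_blinfun - E D"
proof (rule symmetric_eqI)
  show "symmetric (E (- D))" "symmetric (id_blinfun - E D)"
    using assms by (auto intro!: povm_symmetric symmetric_diff symmetric_id)
  fix x
  interpret finite_measure "diagonal_measure E x"
    by (rule finite_diagonal_measure[OF assms(1)])
  have "measure (diagonal_measure E x) (UNIV - D) = measure (diagonal_measure E x) UNIV - measure (diagonal_measure E x) D"
    using finite_measure_compl[of D] assms(3) by simp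
  moreover have "E (UNIV - D) = E (- D)"
    by (simp add: Compl_eq_Diff_UNIV)
  ultimately show "inner x (E (- D) x) = inner x ((id_blinfun - E D) x)"
    using assms by (simp add: measure_diagonal_measure normalized_def blinfun.diff_left inner_diff_right)
qed

lemma op_poly_closure_algebra: "norm_closed_algebra (closure (range (op_poly A)))"
proof -
  let ?N = "closure (range (op_poly A))"
  have seq: "\<exists>p. (\<lambda>n. op_poly A (p n)) \<longlonglongrightarrow> T" if "T \<in> ?N" for T
    using that closure_range_op_poly by blast
  have lim: "T \<in> ?N" if "(\<lambda>n. op_poly A (p n)) \<longlonglongrightarrow> T" for T and p :: "nat \<Rightarrow> real poly"
    using that closure_range_op_poly by blast
  note comp = bounded_bilinear.tendsto[OF bounded_bilinear_blinfun_compose]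
  show ?thesis
    unfolding norm_closed_algebra_def
  proof (intro conjI ballI allI)
    show "id_blinfun \<in> ?N"
      using closure_subset[of "range (op_poly A)"] op_poly_1[of A] by (metis rangeI subsetD)
    fix S T assume "S \<in> ?N" "T \<in> ?N"
    then obtain p q where pq: "(\<lambda>n. op_poly A (p n)) \<longlonglongrightarrow> S" "(\<lambda>n. op_poly A (q n)) \<longlonglongrightarrow> T"
      using seq by blast
    show "S + T \<in> ?N"
      using tendsto_add[OF pq] by (intro lim[of "\<lambda>n. p n + q n"]) (simp add: op_poly_add)
    show "S o\<^sub>L T \<in> ?N"
      using comp[OF pq] by (intro lim[of "\<lambda>n. p n * q n"]) (simp add: op_poly_mult)
  next
    fix r T assume "T \<in> ?N"
    then obtain p where p: "(\<lambda>n. op_poly A (p n)) \<longlonglongrightarrow> T"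
      using seq by blast
    show "r *\<^sub>R T \<in> ?N"
      using tendsto_scaleR[OF tendsto_const p, of r] by (intro lim[of "\<lambda>n. smult r (p n)"]) (simp add: op_poly_smult)
  qed simp
qed

text \<open>The indicators count the \<open>i \<ge> 1\<close> with \<open>i / n \<le> t\<close>, so
  the sum is the floor of \<open>n * t\<close> divided by \<open>n\<close>; \<open>t \<le> 1\<close>
  keeps the count within the range of summation.\<close>

lemma floor_sum_approx:
  fixes t :: real
  assumes "t \<in> {0..1}" "0 < n"
  shows "t - (\<Sum>i=1..n. 1 / real n * indicator {real i / real n..} t) \<in> {0..1 / real n}"
proof -
  define k where "k = nat \<lfloor>real n * t\<rfloor>"
  have nt: "0 \<le> real n * t" "real n * t \<le> real n"
    using assms by (auto simp: mult_left_le)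
  have k: "real k \<le> real n * t" "real n * t < real k + 1"
    using nt by (auto simp: k_def)
  have "real i / real n \<le> t \<longleftrightarrow> i \<le> k" for i
  proof -
    have "real i / real n \<le> t \<longleftrightarrow> real i \<le> real n * t"
      using assms(2) pos_divide_le_eq[of "real n" "real i" t] by (simp add: mult.commute)
    also have "\<dots> \<longleftrightarrow> i \<le> k"
      using k by linarith
    finally show ?thesis .
  qed
  then have "(\<Sum>i=1..n. 1 / real n * indicator {real i / real n..} t) = (\<Sum>i=1..n. if i \<le> k then 1 / real n else 0)"
    by (intro sum.cong) (auto simp: indicator_def)
  also have "\<dots> = (\<Sum>i\<in>{1..k}. 1 / real n)"
  proof -
    have "k \<le> n" using k nt by linarith
    then have "{1..n} \<inter> {i. i \<le> k} = {1..k}" by auto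
    then show ?thesis by (simp add: sum.If_cases)
  qed
  finally have sum: "(\<Sum>i=1..n. 1 / real n * indicator {real i / real n..} t) = real k / real n"
    by simp
  have "real k / real n \<le> t" "t \<le> (real k + 1) / real n"
    using k assms(2) by (simp_all add: pos_divide_le_eq pos_le_divide_eq mult.commute)
  then show ?thesis
    unfolding sum by (simp add: add_divide_distrib)
qed

text \<open>The error of the staircase is an integral of a function with values between 0 and
  \<open>1 / Suc n\<close>, hence a positive operator of at most that norm. The staircase thus
  approximates in norm while its projections stay in every weakly closed algebra around
  \<open>T\<close>.\<close>

lemma ex_spectral_projections:
  fixes T :: "'h::complex_hilbert_space \<Rightarrow>\<^sub>L 'h"
  assumes T: "T \<in> complex_operators" "psd T" "\<And>x. inner x (T x) \<le> inner x x"
  shows "\<exists>Q. (\<forall>n i :: nat. Q n i \<in> complex_operators \<and> symmetric (Q n i) \<and> Q n i o\<^sub>L Q n i = Q n i) \<and>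
    (\<forall>M n i. seq_closed_algebra M \<longrightarrow> T \<in> M \<longrightarrow> Q n i \<in> M) \<and>
    (\<lambda>n. \<Sum>i=1..Suc n. (1 / real (Suc n)) *\<^sub>R Q n i) \<longlonglongrightarrow> T"
proof -
  obtain E where E: "spectral_measure T E"
    and in_algebra: "\<And>D M. D \<in> sets borel \<Longrightarrow> seq_closed_algebra M \<Longrightarrow> T \<in> M \<Longrightarrow> E D \<in> M"
    and AE: "\<And>x. AE t in diagonal_measure E x. t \<in> {0..1}"
    and poly: "\<And>x p. (\<integral>t. poly p t \<partial>diagonal_measure E x) = inner x (op_poly T p x)"
    using spectral_theorem[OF T] by blast
  have povm: "povm E" and norm_E: "normalized E" and idem: "D \<in> sets borel \<Longrightarrow> E D o\<^sub>L E D = E D" for D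
    using E by (auto simp: spectral_measure_def)
  define Q where "Q n i = E {real i / real (Suc n)..}" for n i :: nat
  define R where "R n = T - (\<Sum>i=1..Suc n. (1 / real (Suc n)) *\<^sub>R Q n i)" for n
  have sym: "symmetric T" using T(2) by (simp add: psd_def)
  have R: "psd (R n)" "\<And>x. inner x (R n x) \<le> 1 / real (Suc n) * (norm x)\<^sup>2" for n
  proof -
    let ?g = "\<lambda>t::real. t - (\<Sum>i=1..Suc n. 1 / real (Suc n) * indicator {real i / real (Suc n)..} t)"
    have quad: "inner x (R n x) = (\<integral>t. ?g t \<partial>diagonal_measure E x)"
      and int: "integrable (diagonal_measure E x) ?g" for x
    proof -
      interpret finite_measure "diagonal_measure E x"
        by (rule finite_diagonal_measure[OF povm])
      have int_t: "integrable (diagonal_measure E x) (\<lambda>t. t)"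
        using E has_operator_integralD(1)[of E UNIV "\<lambda>t. t" T x] by (simp add: spectral_measure_def set_integrable_def)
      have int_i: "integrable (diagonal_measure E x) (\<lambda>t. 1 / real (Suc n) * indicator {real i / real (Suc n)..} t :: real)" for i
        by (intro integrable_mult_right) (auto simp: emeasure_eq_measure)
      show "integrable (diagonal_measure E x) ?g"
        by (intro Bochner_Integration.integrable_diff Bochner_Integration.integrable_sum int_t int_i)
      have "(\<integral>t. ?g t \<partial>diagonal_measure E x) = (\<integral>t. t \<partial>diagonal_measure E x) -
          (\<Sum>i=1..Suc n. \<integral>t. 1 / real (Suc n) * indicator {real i / real (Suc n)..} t \<partial>diagonal_measure E x)"
        by (simp only: Bochner_Integration.integral_diff[OF int_t Bochner_Integration.integrable_sum[OF int_i]]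
            Bochner_Integration.integral_sum[OF int_i])
      also have "\<dots> = inner x (T x) - (\<Sum>i=1..Suc n. 1 / real (Suc n) * inner x (Q n i x))"
      proof -
        have "(\<integral>t. t \<partial>diagonal_measure E x) = inner x (T x)"
          using poly[of x "[:0, 1:]"] by simp
        moreover have "(\<integral>t. 1 / real (Suc n) * indicator {real i / real (Suc n)..} t \<partial>diagonal_measure E x)
            = 1 / real (Suc n) * inner x (Q n i x)" for i
          by (subst integral_mult_right_zero) (simp add: Q_def measure_diagonal_measure[OF povm, symmetric])
        ultimately show ?thesis by simp
      qed
      also have "\<dots> = inner x (R n x)"
        unfolding R_def blinfun.diff_left blinfun.sum_left blinfun.scaleR_left inner_diff_right inner_sum_right
          inner_scaleR_right ..
      finally show "inner x (R n x) = (\<integral>t. ?g t \<partial>diagonal_measure E x)" ..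
    qed
    have bounds: "AE t in diagonal_measure E x. ?g t \<in> {0..1 / real (Suc n)}" for x
      using AE[of x] by eventually_elim (rule floor_sum_approx, auto)
    have "0 \<le> inner x (R n x)" for x
      unfolding quad by (rule integral_nonneg_AE) (use bounds[of x] in eventually_elim, simp)
    moreover have "symmetric (R n)"
      unfolding R_def Q_def
      by (intro symmetric_diff sym symmetric_sum symmetric_scaleR povm_symmetric[OF povm]) auto
    ultimately show "psd (R n)"
      by (simp add: psd_def)
    fix x
    interpret finite_measure "diagonal_measure E x"
      by (rule finite_diagonal_measure[OF povm])
    have "inner x (R n x) \<le> (\<integral>t. 1 / real (Suc n) \<partial>diagonal_measure E x)"
      unfolding quad
    proof (rule integral_mono_AE[OF int])
      show "AE t in diagonal_measure E x. ?g t \<le> 1 / real (Suc n)"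
        using bounds[of x] by eventually_elim simp
    qed simp
    also have "\<dots> = 1 / real (Suc n) * (norm x)\<^sup>2"
      using norm_E by (simp add: measure_diagonal_measure[OF povm] normalized_def power2_norm_eq_inner)
    finally show "inner x (R n x) \<le> 1 / real (Suc n) * (norm x)\<^sup>2" .
  qed
  have "norm (R n) \<le> inverse (real (Suc n))" for n
    using psd_norm_le[OF R] by (simp add: divide_inverse)
  then have "R \<longlonglongrightarrow> 0"
    by (intro Lim_null_comparison[OF _ LIMSEQ_inverse_real_of_nat] always_eventually allI)
  then have "(\<lambda>n. T - R n) \<longlonglongrightarrow> T - 0"
    by (intro tendsto_diff tendsto_const)
  moreover have "(\<lambda>n. T - R n) = (\<lambda>n. \<Sum>i=1..Suc n. (1 / real (Suc n)) *\<^sub>R Q n i)"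
    by (rule ext) (simp only: R_def diff_diff_eq2 add_diff_cancel_left')
  ultimately have "(\<lambda>n. \<Sum>i=1..Suc n. (1 / real (Suc n)) *\<^sub>R Q n i) \<longlonglongrightarrow> T"
    by (simp only: diff_zero)
  moreover have "Q n i \<in> complex_operators \<and> symmetric (Q n i) \<and> Q n i o\<^sub>L Q n i = Q n i" for n i
    unfolding Q_def using povm_complex[OF povm] povm_symmetric[OF povm] idem by simp
  moreover have "Q n i \<in> M" if "seq_closed_algebra M" "T \<in> M" for M n i
    unfolding Q_def by (rule in_algebra[OF _ that]) simp
  ultimately show ?thesis
    by (intro exI[of _ Q] conjI allI impI) simp_all
qed

text \<open>Dini's theorem. Points \<open>s n\<close> where \<open>h n\<close> is still at least
  \<open>e\<close> accumulate at some \<open>t\<close>; a fixed \<open>h N\<close> that is below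
  \<open>e\<close> at \<open>t\<close> is below \<open>e\<close> near \<open>t\<close>, and so are
  all later functions.\<close>

lemma antimono_uniform_zero:
  fixes h :: "nat \<Rightarrow> real \<Rightarrow> real"
  assumes S: "compact S" and cont: "\<And>n. continuous_on S (h n)"
    and anti: "\<And>n k t. t \<in> S \<Longrightarrow> n \<le> k \<Longrightarrow> h k t \<le> h n t"
    and lim: "\<And>t. t \<in> S \<Longrightarrow> (\<lambda>n. h n t) \<longlonglongrightarrow> 0" and e: "0 < e"
  shows "\<exists>N. \<forall>n\<ge>N. \<forall>t\<in>S. h n t < e"
proof (rule ccontr)
  assume not: "\<not> ?thesis"
  have "\<forall>N. \<exists>t\<in>S. e \<le> h N t"
  proof
    fix N
    from not obtain n t where nt: "N \<le> n" "t \<in> S" "\<not> h n t < e"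
      by blast
    then have "e \<le> h N t"
      using anti[OF nt(2,1)] by linarith
    with nt(2) show "\<exists>t\<in>S. e \<le> h N t" by blast
  qed
  then obtain s where s: "\<And>n. s n \<in> S" "\<And>n. e \<le> h n (s n)"
    by metis
  obtain t r where t: "t \<in> S" "strict_mono r" "(s \<circ> r) \<longlonglongrightarrow> t"
    using S s(1) unfolding compact_def by meson
  have "\<forall>\<^sub>F n in sequentially. h n t < e"
    using lim[OF t(1)] e by (rule order_tendstoD)
  then obtain N where N: "h N t < e"
    by (auto simp: eventually_sequentially)
  have "(\<lambda>k. h N (s (r k))) \<longlonglongrightarrow> h N t"
    using continuous_on_tendsto_compose[OF cont t(3) t(1)] s(1) by (simp add: o_def)
  then have "\<forall>\<^sub>F k in sequentially. h N (s (r k)) < e"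
    using N by (rule order_tendstoD)
  then obtain k where k: "N \<le> k" "h N (s (r k)) < e"
    unfolding eventually_sequentially by (meson nle_le)
  have "N \<le> r k"
    using seq_suble[OF t(2), of k] k(1) by simp
  then have "h (r k) (s (r k)) \<le> h N (s (r k))"
    using anti s(1) by blast
  then show False using s(2)[of "r k"] k(2) by linarith
qed

lemma strong_feller_imp_uniformly_continuous:
  assumes "povm F" and "admits_strong_feller_kernel F"
  shows "uniformly_continuous F"
  unfolding uniformly_continuous_def
proof (intro allI impI)
  fix D :: "nat \<Rightarrow> real set"
  assume D: "range D \<subseteq> sets borel" "disjoint_family D"
  obtain A E \<mu> where E: "spectral_measure A E" and kernel: "markov_kernel_on {0..1} \<mu>"
    and feller: "strong_feller_on {0..1} \<mu>"
    and F: "\<And>\<Delta>. \<Delta> \<in> sets borel \<Longrightarrow> has_operator_integral E {0..1} (\<lambda>t. measure (\<mu> t) \<Delta>) (F \<Delta>)"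
    using assms(2) unfolding admits_strong_feller_kernel_def by blast
  have povm: "povm E" and norm_E: "normalized E"
    using E by (auto simp: spectral_measure_def)
  have Di: "D i \<in> sets borel" for i using D by auto
  have UD: "(\<Union>i. D i) \<in> sets borel" using Di by auto
  define h where "h n t = measure (\<mu> t) (\<Union>i. D i) - (\<Sum>i<n. measure (\<mu> t) (D i))" for n t
  define R where "R n = F (\<Union>i. D i) - (\<Sum>i<n. F (D i))" for n
  have sums: "(\<lambda>i. measure (\<mu> t) (D i)) sums measure (\<mu> t) (\<Union>i. D i)" if "t \<in> {0..1}" for t
  proof -
    interpret prob_space "\<mu> t" using kernel that by (simp add: markov_kernel_on_def)
    show ?thesis
      using D kernel that by (intro finite_measure_UNION) (auto simp: markov_kernel_on_def)
  qed
  have h_lim: "(\<lambda>n. h n t) \<longlonglongrightarrow> 0" if "t \<in> {0..1}" for t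
    using tendsto_diff[OF tendsto_const sums[OF that, unfolded sums_def], of "measure (\<mu> t) (\<Union>i. D i)"]
    by (simp add: h_def)
  have h_anti: "h k t \<le> h n t" if "n \<le> k" for n k t
    unfolding h_def using that by (intro diff_left_mono sum_mono2) auto
  have h_nonneg: "0 \<le> h n t" if "t \<in> {0..1}" for n t
    using sum_le_suminf[OF sums_summable[OF sums[OF that]], of "{..<n}"] sums_unique[OF sums[OF that]]
    by (simp add: h_def)
  have h_cont: "continuous_on {0..1} (h n)" for n
    unfolding h_def using feller UD Di unfolding strong_feller_on_def
    by (intro continuous_on_diff continuous_on_sum) auto
  have R: "has_operator_integral E {0..1} (h n) (R n)" for n
    unfolding h_def R_def
    by (intro has_operator_integral_diff has_operator_integral_sum F UD Di)
  have R_sym: "symmetric (R n)" for n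
    unfolding R_def by (intro symmetric_diff symmetric_sum povm_symmetric[OF assms(1)] UD Di)
  have "R \<longlonglongrightarrow> 0"
  proof (rule LIMSEQ_I)
    fix e :: real assume e: "0 < e"
    have "\<exists>N. \<forall>n\<ge>N. \<forall>t\<in>{0..1}. h n t < e / 2"
      using e by (intro antimono_uniform_zero h_cont h_anti h_lim) auto
    then obtain N where N: "\<And>n t. N \<le> n \<Longrightarrow> t \<in> {0..1} \<Longrightarrow> h n t < e / 2"
      by blast
    \<comment> \<open>The symbol of \<open>R n\<close> lies between 0 and \<open>e / 2\<close>, and
      \<open>E\<close> has total mass the identity, so the form of the positive operator
      \<open>R n\<close> is at most \<open>e / 2\<close> times the squared norm.\<close>
    have "norm (R n) \<le> e / 2" if "N \<le> n" for n
    proof (rule psd_norm_le)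
      have quad: "0 \<le> inner x (R n x)" "inner x (R n x) \<le> e / 2 * (norm x)\<^sup>2" for x
      proof -
        interpret finite_measure "diagonal_measure E x"
          by (rule finite_diagonal_measure[OF povm])
        have eq: "inner x (R n x) = (\<integral>t. indicator {0..1} t *\<^sub>R h n t \<partial>diagonal_measure E x)"
          using has_operator_integralD(2)[OF R] by (simp add: set_lebesgue_integral_def)
        have int: "integrable (diagonal_measure E x) (\<lambda>t. indicator {0..1} t *\<^sub>R h n t)"
          using has_operator_integralD(1)[OF R] by (simp add: set_integrable_def)
        show "0 \<le> inner x (R n x)"
          unfolding eq by (rule Bochner_Integration.integral_nonneg) (simp add: indicator_def h_nonneg)
        have "inner x (R n x) \<le> (\<integral>t. e / 2 \<partial>diagonal_measure E x)"
          unfolding eq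
        proof (rule integral_mono[OF int])
          show "indicator {0..1} t *\<^sub>R h n t \<le> e / 2" for t
            using N[OF that, of t] e by (simp add: indicator_def less_imp_le)
        qed simp
        also have "\<dots> = e / 2 * (norm x)\<^sup>2"
          using norm_E by (simp add: measure_diagonal_measure[OF povm] normalized_def power2_norm_eq_inner)
        finally show "inner x (R n x) \<le> e / 2 * (norm x)\<^sup>2" .
      qed
      show "psd (R n)" using quad(1) R_sym by (simp add: psd_def)
      show "inner x (R n x) \<le> e / 2 * (norm x)\<^sup>2" for x by (rule quad(2))
    qed (use e in simp)
    then show "\<exists>N. \<forall>n\<ge>N. norm (R n - 0) < e"
      using e by (intro exI[of _ N]) fastforce
  qed
  then have "(\<lambda>n. F (\<Union>i. D i) - R n) \<longlonglongrightarrow> F (\<Union>i. D i) - 0"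
    by (intro tendsto_diff tendsto_const)
  then show "(\<lambda>n. \<Sum>i<n. F (D i)) \<longlonglongrightarrow> F (\<Union>i. D i)"
    by (simp add: R_def)
qed

section \<open>Sharp versions and strong Feller kernels\<close>

text \<open>Uniform continuity makes the sets with values in \<open>N\<close> closed under countable
  disjoint unions. Weak convergence of the series would only keep the values in a weakly closed
  algebra.\<close>

lemma povm_in_norm_closed_algebra:
  assumes F: "povm F" "normalized F" "uniformly_continuous F" and N: "norm_closed_algebra N"
    and half: "\<And>q. F {..real_of_rat q} \<in> N" and D: "D \<in> sets borel"
  shows "F D \<in> N"
  using D
proof (induction rule: borel_induct)
  case empty
  show ?case by (simp add: povm_empty[OF F(1)] norm_closed_algebra_zero[OF N])
next
  case (half_line q)
  show ?case by (rule half)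
next
  case (compl D)
  then show ?case
    by (simp add: povm_compl[OF F(1,2)] norm_closed_algebra_diff[OF N] norm_closed_algebraD(1)[OF N])
next
  case (union D)
  have "(\<lambda>n. \<Sum>i<n. F (D i)) \<longlonglongrightarrow> F (\<Union>i. D i)"
    using F(3) union(1,2) by (simp add: uniformly_continuous_def)
  then show ?case
    by (rule norm_closed_algebra_LIMSEQ[OF N, rotated]) (intro norm_closed_algebra_sum[OF N] union(3))
qed

text \<open>With the closure of the polynomials in \<open>A\<close> as the norm closed algebra, this says that every
  \<open>F D\<close> is a continuous function of \<open>A\<close>.\<close>

lemma ex_generator:
  fixes F :: "real set \<Rightarrow> ('h::complex_hilbert_space \<Rightarrow>\<^sub>L 'h)"
  assumes F: "povm F" "normalized F" "commutative F" "uniformly_continuous F"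
  shows "\<exists>A. A \<in> complex_operators \<and> psd A \<and> (\<forall>x. inner x (A x) \<le> inner x x) \<and>
    (\<forall>N D. norm_closed_algebra N \<longrightarrow> A \<in> N \<longrightarrow> D \<in> sets borel \<longrightarrow> F D \<in> N) \<and>
    (\<forall>M. seq_closed_algebra M \<longrightarrow> F ` sets borel \<subseteq> M \<longrightarrow> A \<in> M)"
proof -
  define T where "T q = F {..real_of_rat q}" for q
  have half: "{..real_of_rat q} \<in> sets borel" for q by simp
  have T_complex: "T q \<in> complex_operators" for q
    unfolding T_def by (rule povm_complex[OF F(1) half])
  define S where "S q Q \<longleftrightarrow>
    (\<forall>n i :: nat. Q n i \<in> complex_operators \<and> symmetric (Q n i) \<and> Q n i o\<^sub>L Q n i = Q n i) \<and>
    (\<forall>M n i. seq_closed_algebra M \<longrightarrow> T q \<in> M \<longrightarrow> Q n i \<in> M) \<and>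
    (\<lambda>n. \<Sum>i=1..Suc n. (1 / real (Suc n)) *\<^sub>R Q n i) \<longlonglongrightarrow> T q" for q Q
  have "\<exists>Q. S q Q" for q
    unfolding S_def T_def
    by (rule ex_spectral_projections[OF povm_complex[OF F(1) half] povm_psd[OF F(1) half]
          normalized_povm_le_one[OF F(1,2) half]])
  then obtain Q where S: "\<And>q. S q (Q q)"
    by metis
  have Q: "Q q n i \<in> complex_operators" "symmetric (Q q n i)" "Q q n i o\<^sub>L Q q n i = Q q n i" for q n i
    using S[of q] by (simp_all add: S_def)
  have Q_in: "Q q n i \<in> M" if "seq_closed_algebra M" "T q \<in> M" for q n i M
    using S[of q] that unfolding S_def by blast
  have Q_lim: "(\<lambda>n. \<Sum>i=1..Suc n. (1 / real (Suc n)) *\<^sub>R Q q n i) \<longlonglongrightarrow> T q" for q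
    using S[of q] unfolding S_def by blast
  \<comment> \<open>Commutation passes from the values of \<open>F\<close> to their projections one
    factor at a time, through the commutant of \<open>T q'\<close> and then that of
    \<open>Q q n i\<close>.\<close>
  have Q_comm: "Q q n i o\<^sub>L Q q' n' i' = Q q' n' i' o\<^sub>L Q q n i" for q n i q' n' i'
  proof -
    let ?C = "\<lambda>S. {T \<in> complex_operators. T o\<^sub>L S = S o\<^sub>L T}"
    have "T q \<in> ?C (T q')"
      using F(3) half T_complex by (simp add: commutative_def T_def)
    moreover have "symmetric (T q')"
      unfolding T_def by (rule povm_symmetric[OF F(1) half])
    ultimately have "Q q n i \<in> ?C (T q')"
      using Q_in commutant_seq_closed by blast
    then have "T q' \<in> ?C (Q q n i)"
      using T_complex by simp
    then have "Q q' n' i' \<in> ?C (Q q n i)"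
      using Q_in commutant_seq_closed[OF Q(2)] by blast
    then show ?thesis by simp
  qed
  \<comment> \<open>A single enumeration of all projections, possible because the half lines have
    rational end points.\<close>
  define P where "P j = (case from_nat j :: rat \<times> nat \<times> nat of (q, n, i) \<Rightarrow> Q q n i)" for j
  have P: "\<exists>q n i. P j = Q q n i" for j
    by (cases "from_nat j :: rat \<times> nat \<times> nat") (auto simp: P_def)
  have Q_P: "Q q n i = P (to_nat (q, n, i))" for q n i
    by (simp add: P_def)
  interpret commuting_projections P
  proof
    fix i j
    obtain q n k where i: "P i = Q q n k" using P by blast
    obtain q' n' k' where j: "P j = Q q' n' k'" using P by blast
    show "P i \<in> complex_operators" "symmetric (P i)" "P i o\<^sub>L P i = P i" "P i o\<^sub>L P j = P j o\<^sub>L P i"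
      unfolding i j by (rule Q Q_comm)+
  qed
  show ?thesis
  proof (intro exI[of _ "tail 0"] conjI allI impI)
    fix N D assume N: "norm_closed_algebra N" "tail 0 \<in> N" and D: "(D :: real set) \<in> sets borel"
    have "Q q n i \<in> N" for q n i
      unfolding Q_P by (rule projections_in_algebra[OF N])
    then have "F {..real_of_rat q} \<in> N" for q
      unfolding T_def[symmetric]
      by (intro norm_closed_algebra_LIMSEQ[OF N(1) _ Q_lim] norm_closed_algebra_sum[OF N(1)]
          norm_closed_algebraD(4)[OF N(1)])
    then show "F D \<in> N"
      using povm_in_norm_closed_algebra[OF F(1,2,4) N(1) _ D] by blast
  next
    fix M assume M: "seq_closed_algebra M" "F ` sets borel \<subseteq> M"
    have "T q \<in> M" for q
      using M(2) half unfolding T_def by blast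
    then have "P j \<in> M" for j
      using Q_in[OF M(1)] P[of j] by metis
    then show "tail 0 \<in> M"
      by (rule tail_in_algebra[OF seq_closed_imp_norm_closed[OF M(1)]])
  qed (rule tail_complex tail_psd tail_le_one)+
qed

lemma uniformly_continuous_imp_strong_feller:
  fixes F :: "real set \<Rightarrow> ('h::complex_hilbert_space \<Rightarrow>\<^sub>L 'h)"
  assumes F: "povm F" "normalized F" "commutative F" "uniformly_continuous F"
  shows "admits_strong_feller_kernel F"
proof -
  obtain A where A: "A \<in> complex_operators" "psd A" "\<And>x. inner x (A x) \<le> inner x x"
    and F_in: "\<And>N D. norm_closed_algebra N \<Longrightarrow> A \<in> N \<Longrightarrow> D \<in> sets borel \<Longrightarrow> F D \<in> N"
    and A_in: "\<And>M. seq_closed_algebra M \<Longrightarrow> F ` sets borel \<subseteq> M \<Longrightarrow> A \<in> M"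
    using ex_generator[OF F] by blast
  obtain E where E: "spectral_measure A E"
    "\<And>D M. D \<in> sets borel \<Longrightarrow> seq_closed_algebra M \<Longrightarrow> A \<in> M \<Longrightarrow> E D \<in> M"
    "\<And>x. AE t in diagonal_measure E x. t \<in> {0..1}"
    "\<And>x p. (\<integral>t. poly p t \<partial>diagonal_measure E x) = inner x (op_poly A p x)"
    using spectral_theorem[OF A] by blast
  have A_sym: "symmetric A" using A(2) by (simp add: psd_def)
  interpret spectral_calculus A E
    by standard (rule A A_sym E(1) E(3) E(4))+
  have "op_poly A [:0, 1:] = A" by simp
  then have "A \<in> closure (range (op_poly A))"
    using closure_subset[of "range (op_poly A)"] by (metis rangeI subsetD)
  \<comment> \<open>The algebra \<open>N\<close> of the generator is specialized to the norm closure
    of the polynomials in \<open>A\<close>, whose members all have continuous symbols.\<close>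
  then have "\<exists>f. continuous_on K f \<and> has_operator_integral E K f (F D)" if "D \<in> sets borel" for D
    using ex_symbol F_in[OF op_poly_closure_algebra _ that] by blast
  then obtain f where f: "\<And>D. D \<in> sets borel \<Longrightarrow> continuous_on K (f D)"
    "\<And>D. D \<in> sets borel \<Longrightarrow> has_operator_integral E K (f D) (F D)"
    by metis
  have "\<exists>\<mu>. (\<forall>t. prob_space (\<mu> t) \<and> sets (\<mu> t) = sets borel) \<and>
    (\<forall>D\<in>sets borel. continuous_on UNIV (\<lambda>t. measure (\<mu> t) D)) \<and>
    (\<forall>D\<in>sets borel. \<forall>t\<in>K. measure (\<mu> t) D = f D t)"
  proof (rule ex_strong_feller_extension[OF compact_K f(1)])
    show "0 \<le> f D t" if "D \<in> sets borel" "t \<in> K" for D t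
      by (rule symbol_nonneg[OF f(1)[OF that(1)] f(2)[OF that(1)] that(2) povm_psd[OF F(1) that(1)]])
    show "f UNIV t = 1" if t: "t \<in> K" for t
    proof -
      \<comment> \<open>This difference is the continuous symbol of the zero operator, so it
        vanishes at every point of \<open>K\<close>.\<close>
      have "has_operator_integral E K (\<lambda>s. f UNIV s - poly 1 s) (F UNIV - op_poly A 1)"
        by (rule has_operator_integral_diff[OF f(2) has_operator_integral_poly]) simp
      moreover have "continuous_on K (\<lambda>s. f UNIV s - poly 1 s)"
        by (rule continuous_on_diff[OF f(1)]) (auto intro: continuous_intros)
      ultimately have "\<bar>f UNIV t - poly 1 t\<bar> \<le> norm (F UNIV - op_poly A 1)"
        using symbol_abs_le t by blast
      then show ?thesis
        using F(2) by (simp add: normalized_def)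
    qed
    show "(\<lambda>i. f (D i) t) sums f (\<Union>i. D i) t"
      if D: "range D \<subseteq> sets borel" "disjoint_family D" and t: "t \<in> K" for D :: "nat \<Rightarrow> real set" and t
    proof -
      have Di: "D i \<in> sets borel" for i using D by auto
      have UD: "(\<Union>i. D i) \<in> sets borel" using Di by auto
      \<comment> \<open>The remainder at \<open>t\<close> is dominated by the operator norm of the
        remainder of \<open>F\<close>, which uniform continuity sends to 0.\<close>
      have le: "\<bar>(\<Sum>i<n. f (D i) t) - f (\<Union>i. D i) t\<bar> \<le> norm ((\<Sum>i<n. F (D i)) - F (\<Union>i. D i))" for n
      proof (rule symbol_abs_le[OF _ _ t])
        show "continuous_on K (\<lambda>t. (\<Sum>i<n. f (D i) t) - f (\<Union>i. D i) t)"
          by (rule continuous_on_diff[OF continuous_on_sum[OF f(1)[OF Di]] f(1)[OF UD]])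
        show "has_operator_integral E K (\<lambda>t. (\<Sum>i<n. f (D i) t) - f (\<Union>i. D i) t)
            ((\<Sum>i<n. F (D i)) - F (\<Union>i. D i))"
          by (rule has_operator_integral_diff[OF has_operator_integral_sum[OF f(2)[OF Di]] f(2)[OF UD]])
      qed
      have "(\<lambda>n. (\<Sum>i<n. F (D i)) - F (\<Union>i. D i)) \<longlonglongrightarrow> 0"
        using F(4) D by (intro LIM_zero) (simp add: uniformly_continuous_def)
      then have "(\<lambda>n. (\<Sum>i<n. f (D i) t) - f (\<Union>i. D i) t) \<longlonglongrightarrow> 0"
        by (rule Lim_null_comparison[OF always_eventually tendsto_norm_zero, rotated])
           (simp add: le)
      then show ?thesis
        unfolding sums_def by (rule LIM_zero_cancel)
    qed
  qed
  then obtain \<mu> where \<mu>: "\<And>t. prob_space (\<mu> t)" "\<And>t. sets (\<mu> t) = sets borel"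
    "\<And>D. D \<in> sets borel \<Longrightarrow> continuous_on UNIV (\<lambda>t. measure (\<mu> t) D)"
    and \<mu>_f: "\<And>D t. D \<in> sets borel \<Longrightarrow> t \<in> K \<Longrightarrow> measure (\<mu> t) D = f D t"
    by blast
  have \<mu>_borel [measurable]: "(\<lambda>t. measure (\<mu> t) D) \<in> borel_measurable borel" if "D \<in> sets borel" for D
    by (rule borel_measurable_continuous_onI[OF \<mu>(3)[OF that]])
  \<comment> \<open>One kernel, defined on the whole line, serves both the spectrum in
    \<open>sharp_version\<close> and the interval [0,1].\<close>
  have kernel: "markov_kernel_on S \<mu>" for S
    unfolding markov_kernel_on_def using \<mu>(1,2) \<mu>_borel by (auto intro!: measurable_restrict_space1)
  have on_K: "has_operator_integral E K (\<lambda>t. measure (\<mu> t) D) (F D)" if "D \<in> sets borel" for D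
    using \<mu>_f[OF that] by (intro has_operator_integral_cong[OF K_borel _ f(2)[OF that]]) simp
  have on_01: "has_operator_integral E {0..1} (\<lambda>t. measure (\<mu> t) D) (F D)" if D: "D \<in> sets borel" for D
  proof (subst has_operator_integral_iff[OF povm_complex[OF F(1) D] povm_symmetric[OF F(1) D]], intro allI conjI)
    fix x
    \<comment> \<open>The part of [0,1] outside \<open>K\<close> is null for every diagonal measure,
      so the interpolated values do not affect the integral.\<close>
    have AE: "AE t in m x. indicator {0..1} t *\<^sub>R measure (\<mu> t) D = indicator K t *\<^sub>R measure (\<mu> t) D"
      using AE_K[of x] by eventually_elim (use K_subset in auto)
    have meas: "(\<lambda>t. indicator S t *\<^sub>R measure (\<mu> t) D) \<in> borel_measurable (m x)" if "S \<in> sets borel" for S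
      using \<mu>_borel[OF D] that by simp
    note K_int = has_operator_integralD[OF on_K[OF D], of x, unfolded set_integrable_def set_lebesgue_integral_def]
    show "set_integrable (m x) {0..1} (\<lambda>t. measure (\<mu> t) D)"
      unfolding set_integrable_def
      using K_int(1) integrable_cong_AE[OF meas meas AE] by simp
    show "inner x (F D x) = (LINT t:{0..1}|m x. measure (\<mu> t) D)"
      unfolding set_lebesgue_integral_def
      using K_int(2) integral_cong_AE[OF meas meas AE] by simp
  qed
  have generated: "generated_von_neumann_algebra {A} = generated_von_neumann_algebra (F ` sets borel)"
  proof -
    \<comment> \<open>\<open>A\<close> is a weak limit of operators built from \<open>F\<close>, and
      each value of \<open>F\<close> is a norm limit of polynomials in \<open>A\<close>; hence both
      families lie in the same von Neumann algebras.\<close>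
    have "{A} \<subseteq> M \<longleftrightarrow> F ` sets borel \<subseteq> M" if "von_neumann_algebra M" for M
    proof -
      note M = von_neumann_imp_seq_closed[OF that]
      show ?thesis
        using A_in[OF M] F_in[OF seq_closed_imp_norm_closed[OF M]] by auto
    qed
    then show ?thesis
      unfolding generated_von_neumann_algebra_def hull_def by (metis (no_types, lifting))
  qed
  have "sharp_version F A"
    unfolding sharp_version_def real_spectrum_eq
    using A(1) A_sym E(1) kernel on_K generated by (auto simp: selfadjoint_iff)
  moreover have "spectrum A \<subseteq> complex_of_real ` {0..1}"
    using spectrum_subset K_subset by blast
  moreover have "strong_feller_on {0..1} \<mu>"
    unfolding strong_feller_on_def using \<mu>(3) continuous_on_subset by blast
  ultimately show ?thesis
    unfolding admits_strong_feller_kernel_def using E(1) kernel on_01 by blast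
qed

theorem theorem5p5:
  fixes F :: "real set \<Rightarrow> ('h::complex_hilbert_space \<Rightarrow>\<^sub>L 'h)"
  assumes "povm F" and "normalized F" and "commutative F"
  shows "admits_strong_feller_kernel F \<longleftrightarrow> uniformly_continuous F"
  using assms strong_feller_imp_uniformly_continuous uniformly_continuous_imp_strong_feller by blast

end
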